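(* Let $V$ be a $2$-dimensional vector space over $\mathbb{F}_p$ and $G\subseteq\mathrm{GL}(V)$ a subgroup. The following are equivalent. (1) (i) $V$ and $\mathrm{End}(V)$ have no common irreducible composition factor as $G$-modules, and (ii) $\mathrm{H}^1(G,V)=0$. (2) (i) $G$ is not contained in any subgroup of $\mathrm{GL}(V)$ isomorphic to the symmetric group $S_3$ (in particular $p>2$), and (ii) if $V$ is a reducible $G$-module, i.e. an extension $0\to\chi_1\to V\to\chi_2\to0$ for characters $\chi_i:G\to\mathbb{F}_p^\ast$, then $\chi_1\neq\mathbf{1},\chi_2^2$ and $\chi_2\neq\mathbf{1},\chi_1^2$.
   Context: $\mathrm{End}(V)$ is a $G$-module via conjugation (adjoint representation); $\mathbf{1}$ denotes the trivial character. *)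

theory Defs
  imports
    "HOL-Algebra.Algebra"
    "HOL-Algebra.Algebraic_Closure_Type"
    "HOL-Computational_Algebra.Primes"
    "HOL-Library.Cardinality"
begin

section \<open>Modules over a ring with a linear action of a group\<close>

text \<open>The record \<^type>\<open>module\<close> extends that of rings; its fields
  \<open>mult\<close> and \<open>one\<close> play no role for modules and are left \<open>undefined\<close> below.\<close>

record ('a, 'b, 'g) gmodule = "('a, 'b) module" +
  act :: "'g \<Rightarrow> 'b \<Rightarrow> 'b"

definition gmodule_hom ::
    "('a, 'r) ring_scheme \<Rightarrow> ('g, 's) monoid_scheme \<Rightarrow>
     ('a, 'b, 'g) gmodule \<Rightarrow> ('a, 'c, 'g) gmodule \<Rightarrow> ('b \<Rightarrow> 'c) set" where
  "gmodule_hom R G M N =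
     {h \<in> hom (add_monoid M) (add_monoid N).
        (\<forall>r\<in>carrier R. \<forall>x\<in>carrier M. h (r \<odot>\<^bsub>M\<^esub> x) = r \<odot>\<^bsub>N\<^esub> h x) \<and>
        (\<forall>g\<in>carrier G. \<forall>x\<in>carrier M. h (act M g x) = act N g (h x))}"

locale gmodule = module R M + G: group G
  for R (structure) and G :: "('g, 's) monoid_scheme" (structure)
    and M :: "('a, 'b, 'g) gmodule" (structure) +
  assumes act_hom: "g \<in> carrier G \<Longrightarrow>
      act M g \<in> hom (add_monoid M) (add_monoid M)"
    and act_smult: "\<lbrakk>g \<in> carrier G; r \<in> carrier R; x \<in> carrier M\<rbrakk> \<Longrightarrow>
      act M g (r \<odot>\<^bsub>M\<^esub> x) = r \<odot>\<^bsub>M\<^esub> act M g x"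
    and act_one: "x \<in> carrier M \<Longrightarrow> act M \<one>\<^bsub>G\<^esub> x = x"
    and act_mult: "\<lbrakk>g \<in> carrier G; h \<in> carrier G; x \<in> carrier M\<rbrakk> \<Longrightarrow>
      act M (g \<otimes>\<^bsub>G\<^esub> h) x = act M g (act M h x)"

text \<open>The notions below do not repeat the axioms of \<^locale>\<open>gmodule\<close>; they are meant for records
  \<open>M\<close> with \<open>gmodule R G M\<close>.\<close>

definition gmodule_isomorphic ::
    "('a, 'r) ring_scheme \<Rightarrow> ('g, 's) monoid_scheme \<Rightarrow>
     ('a, 'b, 'g) gmodule \<Rightarrow> ('a, 'c, 'g) gmodule \<Rightarrow> bool" where
  "gmodule_isomorphic R G M N \<longleftrightarrow>
     (\<exists>h\<in>gmodule_hom R G M N. bij_betw h (carrier M) (carrier N))"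

definition gsubmodule ::
    "'b set \<Rightarrow> ('a, 'r) ring_scheme \<Rightarrow> ('g, 's) monoid_scheme \<Rightarrow> ('a, 'b, 'g) gmodule \<Rightarrow> bool" where
  "gsubmodule W R G M \<longleftrightarrow>
     submodule W R M \<and> (\<forall>g\<in>carrier G. \<forall>w\<in>W. act M g w \<in> W)"

text \<open>In the quotient module, the union over all representatives \<open>x\<close> of a coset \<open>C\<close> is a union
  of equal cosets.\<close>

definition quotient_gmodule ::
    "('a, 'b, 'g) gmodule \<Rightarrow> 'b set \<Rightarrow> ('a, 'b set, 'g) gmodule" where
  "quotient_gmodule M N =
     \<lparr>carrier = a_rcosets\<^bsub>M\<^esub> N, monoid.mult = undefined, one = undefined,
      ring.zero = N, add = set_add M,
      module.smult = (\<lambda>r C. \<Union>x\<in>C. N +>\<^bsub>M\<^esub> (r \<odot>\<^bsub>M\<^esub> x)),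
      act = (\<lambda>g C. \<Union>x\<in>C. N +>\<^bsub>M\<^esub> (act M g x))\<rparr>"

definition irreducible_gmodule ::
    "('a, 'r) ring_scheme \<Rightarrow> ('g, 's) monoid_scheme \<Rightarrow> ('a, 'b, 'g) gmodule \<Rightarrow> bool" where
  "irreducible_gmodule R G M \<longleftrightarrow>
     carrier M \<noteq> {\<zero>\<^bsub>M\<^esub>} \<and>
     (\<forall>W. gsubmodule W R G M \<longrightarrow> W = {\<zero>\<^bsub>M\<^esub>} \<or> W = carrier M)"

abbreviation subquotient_gmodule ::
    "('a, 'b, 'g) gmodule \<Rightarrow> 'b set \<Rightarrow> 'b set \<Rightarrow> ('a, 'b set, 'g) gmodule" where
  "subquotient_gmodule M W N \<equiv> quotient_gmodule (M\<lparr>carrier := W\<rparr>) N"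

definition composition_series_gmodule ::
    "('a, 'r) ring_scheme \<Rightarrow> ('g, 's) monoid_scheme \<Rightarrow>
     ('a, 'b, 'g) gmodule \<Rightarrow> 'b set list \<Rightarrow> bool" where
  "composition_series_gmodule R G M Ws \<longleftrightarrow>
     Ws \<noteq> [] \<and> hd Ws = {\<zero>\<^bsub>M\<^esub>} \<and> last Ws = carrier M \<and>
     (\<forall>W\<in>set Ws. gsubmodule W R G M) \<and>
     (\<forall>i. Suc i < length Ws \<longrightarrow>
        Ws ! i \<subset> Ws ! Suc i \<and>
        irreducible_gmodule R G (subquotient_gmodule M (Ws ! Suc i) (Ws ! i)))"

definition common_composition_factor ::
    "('a, 'r) ring_scheme \<Rightarrow> ('g, 's) monoid_scheme \<Rightarrow>
     ('a, 'b, 'g) gmodule \<Rightarrow> ('a, 'c, 'g) gmodule \<Rightarrow> bool" where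
  "common_composition_factor R G M N \<longleftrightarrow>
     (\<exists>Ws Us i j.
        composition_series_gmodule R G M Ws \<and> Suc i < length Ws \<and>
        composition_series_gmodule R G N Us \<and> Suc j < length Us \<and>
        gmodule_isomorphic R G
          (subquotient_gmodule M (Ws ! Suc i) (Ws ! i))
          (subquotient_gmodule N (Us ! Suc j) (Us ! j)))"

definition is_extension ::
    "('a, 'r) ring_scheme \<Rightarrow> ('g, 's) monoid_scheme \<Rightarrow>
     ('a, 'b, 'g) gmodule \<Rightarrow> ('a, 'c, 'g) gmodule \<Rightarrow> ('a, 'd, 'g) gmodule \<Rightarrow> bool" where
  "is_extension R G A M B \<longleftrightarrow>
     (\<exists>\<iota>\<in>gmodule_hom R G A M. \<exists>\<pi>\<in>gmodule_hom R G M B.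
        inj_on \<iota> (carrier A) \<and> \<iota> ` carrier A = a_kernel M B \<pi> \<and>
        \<pi> ` carrier M = carrier B)"


section \<open>First group cohomology\<close>

text \<open>Crossed homomorphisms are taken to be \<open>undefined\<close> outside the group, so that two of them
  are equal iff they agree on the group.\<close>

definition crossed_homs ::
    "('g, 's) monoid_scheme \<Rightarrow> ('a, 'b, 'g) gmodule \<Rightarrow> ('g \<Rightarrow> 'b) monoid" where
  "crossed_homs G M =
     \<lparr>carrier = {f \<in> carrier G \<rightarrow>\<^sub>E carrier M. \<forall>g\<in>carrier G. \<forall>h\<in>carrier G.
                   f (g \<otimes>\<^bsub>G\<^esub> h) = f g \<oplus>\<^bsub>M\<^esub> act M g (f h)},
      monoid.mult = (\<lambda>f f'. \<lambda>g\<in>carrier G. f g \<oplus>\<^bsub>M\<^esub> f' g),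
      one = (\<lambda>g\<in>carrier G. \<zero>\<^bsub>M\<^esub>)\<rparr>"

definition principal_crossed_homs ::
    "('g, 's) monoid_scheme \<Rightarrow> ('a, 'b, 'g) gmodule \<Rightarrow> ('g \<Rightarrow> 'b) set" where
  "principal_crossed_homs G M =
     (\<lambda>m. \<lambda>g\<in>carrier G. act M g m \<ominus>\<^bsub>M\<^esub> m) ` carrier M"

definition H1 ::
    "('g, 's) monoid_scheme \<Rightarrow> ('a, 'b, 'g) gmodule \<Rightarrow> ('g \<Rightarrow> 'b) set monoid" where
  "H1 G M = crossed_homs G M Mod principal_crossed_homs G M"


section \<open>Linear groups\<close>

text \<open>A vector space is given by its scalar multiplication \<open>scale\<close> on a type, as in
  \<^locale>\<open>vector_space\<close>.\<close>

abbreviation base_ring :: "'f::field ring" where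
  "base_ring \<equiv> ring_of_type_algebra"

definition GL :: "('f::field \<Rightarrow> 'v::ab_group_add \<Rightarrow> 'v) \<Rightarrow> ('v \<Rightarrow> 'v) monoid" where
  "GL scale =
     \<lparr>carrier = {g. Vector_Spaces.linear scale scale g \<and> bij g}, monoid.mult = (\<circ>), one = id\<rparr>"

abbreviation linear_group ::
    "('f::field \<Rightarrow> 'v::ab_group_add \<Rightarrow> 'v) \<Rightarrow> ('v \<Rightarrow> 'v) set \<Rightarrow> ('v \<Rightarrow> 'v) monoid" where
  "linear_group scale G \<equiv> (GL scale)\<lparr>carrier := G\<rparr>"

definition standard_gmodule ::
    "('f::field \<Rightarrow> 'v::ab_group_add \<Rightarrow> 'v) \<Rightarrow> ('f, 'v, 'v \<Rightarrow> 'v) gmodule" where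
  "standard_gmodule scale =
     \<lparr>carrier = UNIV, monoid.mult = undefined, one = undefined,
      ring.zero = 0, add = (+), module.smult = scale, act = (\<lambda>g v. g v)\<rparr>"

definition End_gmodule ::
    "('f::field \<Rightarrow> 'v::ab_group_add \<Rightarrow> 'v) \<Rightarrow> ('f, 'v \<Rightarrow> 'v, 'v \<Rightarrow> 'v) gmodule" where
  "End_gmodule scale =
     \<lparr>carrier = {f. Vector_Spaces.linear scale scale f}, monoid.mult = undefined, one = undefined,
      ring.zero = (\<lambda>v. 0), add = (\<lambda>f f' v. f v + f' v), module.smult = (\<lambda>c f v. scale c (f v)),
      act = (\<lambda>g f. g \<circ> f \<circ> inv\<^bsub>GL scale\<^esub> g)\<rparr>"

definition characters :: "('g, 's) monoid_scheme \<Rightarrow> ('g \<Rightarrow> 'f::field) set" where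
  "characters G = hom G (units_of base_ring)"

definition character_gmodule :: "('g \<Rightarrow> 'f::field) \<Rightarrow> ('f, 'f, 'g) gmodule" where
  "character_gmodule \<chi> =
     \<lparr>carrier = UNIV, monoid.mult = undefined, one = undefined,
      ring.zero = 0, add = (+), module.smult = (*), act = (\<lambda>g x. \<chi> g * x)\<rparr>"

text \<open>Equality of characters is agreement on the group, since a HOL function representing a
  character has arbitrary values elsewhere.\<close>

definition same_character :: "('g, 's) monoid_scheme \<Rightarrow> ('g \<Rightarrow> 'f::field) \<Rightarrow> ('g \<Rightarrow> 'f) \<Rightarrow> bool" where
  "same_character G \<chi> \<psi> \<longleftrightarrow> (\<forall>g\<in>carrier G. \<chi> g = \<psi> g)"

definition contained_in_S3 :: "('v \<Rightarrow> 'v) set \<Rightarrow> ('f::field \<Rightarrow> 'v::ab_group_add \<Rightarrow> 'v) \<Rightarrow> bool" where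
  "contained_in_S3 G scale \<longleftrightarrow>
     (\<exists>H. subgroup H (GL scale) \<and> G \<subseteq> H \<and> linear_group scale H \<cong> sym_group 3)"

end

theory Submission
  imports Defs
begin

text \<open>If \<open>V\<close> is reducible with characters \<open>\<chi>\<^sub>1\<close>, \<open>\<chi>\<^sub>2\<close>, then \<open>End V\<close> has a filtration with characters
  \<open>\<chi>\<^sub>1/\<chi>\<^sub>2\<close>, \<open>1\<close>, \<open>1\<close>, \<open>\<chi>\<^sub>2/\<chi>\<^sub>1\<close>, so the conditions on characters say exactly that no composition factor is
  shared; they also kill cohomology, because a cocycle with values in either character vanishes
  on the unipotent elements and hence factors through an abelian quotient.

  Let \<open>V\<close> be irreducible. A scalar \<open>c \<noteq> 1\<close> in \<open>G\<close> separates \<open>V\<close> from \<open>End V\<close> and kills cohomology, and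
  a nontrivial unipotent forces \<open>-1 \<in> G\<close>. Otherwise \<open>p\<close> does not divide the order of \<open>G\<close>, and averaging
  shows that \<open>H\<^sup>1\<close> vanishes. If now \<open>V\<close> occurs in \<open>End V\<close>, the eigenvalues of each \<open>g \<in> G\<close> on \<open>V\<close> are
  among those on \<open>End V\<close>, so \<open>g\<close> has eigenvalue \<open>1\<close>, or trace \<open>-1\<close> and determinant \<open>1\<close>. The identity
  \<open>tr ab + tr ab\<inverse> = tr a tr b\<close> then shows that the elements of determinant \<open>1\<close> form a group of order \<open>3\<close>,
  and \<open>G\<close> permutes three vectors of sum \<open>0\<close>.\<close>

section \<open>Submodules and subquotients\<close>

text \<open>A common factor may sit in any pair of composition series, so refuting one has to cover
  all series without uniqueness of factors. Two devices do this: a polynomial in one group element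
  that kills a subquotient kills every isomorphic one, and an irreducible subquotient of a module
  filtered with scalar steps acts through one of the scalars. To produce a factor, an equivariant
  map onto an irreducible module is enough, because chains of submodules of a finite module can be
  refined.

  That (1) implies (2) also requires a common factor for every group inside a copy of S_3, in every
  characteristic and for an abstract copy whose position in GL(V) is unknown. The copy enters
  through a few identities between its elements. For reducible V they force a coincidence of
  characters; for irreducible V they rebuild the three vectors of sum 0, and an equivariant map from
  End V to V is written down.

  The case p = 2, where -1 is no help, is absorbed by S_3: GL(V) then permutes the three nonzero
  vectors.\<close>

context gmodule
begin

lemma minus_add_cancel:
  "\<lbrakk>a \<in> carrier M; x \<in> carrier M\<rbrakk> \<Longrightarrow> a \<oplus>\<^bsub>M\<^esub> x \<ominus>\<^bsub>M\<^esub> x = a"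
  "\<lbrakk>a \<in> carrier M; x \<in> carrier M\<rbrakk> \<Longrightarrow> a \<ominus>\<^bsub>M\<^esub> x \<oplus>\<^bsub>M\<^esub> x = a"
  by (simp_all add: M.minus_eq M.a_assoc M.r_neg M.l_neg)

lemma minus_add_minus:
  "\<lbrakk>a \<in> carrier M; b \<in> carrier M; c \<in> carrier M; d \<in> carrier M\<rbrakk>
    \<Longrightarrow> (a \<oplus>\<^bsub>M\<^esub> b) \<ominus>\<^bsub>M\<^esub> (c \<oplus>\<^bsub>M\<^esub> d) = (a \<ominus>\<^bsub>M\<^esub> c) \<oplus>\<^bsub>M\<^esub> (b \<ominus>\<^bsub>M\<^esub> d)"
  by (simp add: M.minus_eq M.minus_add M.a_ac)

lemma minus_minus_minus:
  "\<lbrakk>a \<in> carrier M; b \<in> carrier M\<rbrakk> \<Longrightarrow> \<ominus>\<^bsub>M\<^esub> (a \<ominus>\<^bsub>M\<^esub> b) = b \<ominus>\<^bsub>M\<^esub> a"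
  by (simp add: M.minus_eq M.minus_add M.a_ac)

lemma minus_telescope:
  "\<lbrakk>a \<in> carrier M; b \<in> carrier M; c \<in> carrier M\<rbrakk>
    \<Longrightarrow> (a \<ominus>\<^bsub>M\<^esub> b) \<oplus>\<^bsub>M\<^esub> (b \<ominus>\<^bsub>M\<^esub> c) = a \<ominus>\<^bsub>M\<^esub> c"
  by (metis M.minus_closed M.minus_eq M.a_assoc M.add.inv_closed minus_add_cancel(2))

lemma smult_minus:
  "\<lbrakk>r \<in> carrier R; a \<in> carrier M; b \<in> carrier M\<rbrakk>
    \<Longrightarrow> r \<odot>\<^bsub>M\<^esub> (a \<ominus>\<^bsub>M\<^esub> b) = r \<odot>\<^bsub>M\<^esub> a \<ominus>\<^bsub>M\<^esub> r \<odot>\<^bsub>M\<^esub> b"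
  by (simp add: M.minus_eq smult_r_distr smult_r_minus)

lemma act_closed [simp]: "\<lbrakk>g \<in> carrier G; x \<in> carrier M\<rbrakk> \<Longrightarrow> act M g x \<in> carrier M"
  using act_hom by (auto simp: hom_def)

lemma act_add:
  "\<lbrakk>g \<in> carrier G; x \<in> carrier M; y \<in> carrier M\<rbrakk>
    \<Longrightarrow> act M g (x \<oplus>\<^bsub>M\<^esub> y) = act M g x \<oplus>\<^bsub>M\<^esub> act M g y"
  using act_hom by (auto simp: hom_def)

lemma act_zero [simp]: "g \<in> carrier G \<Longrightarrow> act M g \<zero>\<^bsub>M\<^esub> = \<zero>\<^bsub>M\<^esub>"
  by (metis M.add.r_cancel_one' M.r_zero M.zero_closed act_add act_closed)

lemma act_uminus:
  "\<lbrakk>g \<in> carrier G; x \<in> carrier M\<rbrakk> \<Longrightarrow> act M g (\<ominus>\<^bsub>M\<^esub> x) = \<ominus>\<^bsub>M\<^esub> act M g x"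
  by (metis M.a_inv_closed M.l_neg M.minus_equality act_add act_closed act_zero)

lemma act_minus:
  "\<lbrakk>g \<in> carrier G; x \<in> carrier M; y \<in> carrier M\<rbrakk>
    \<Longrightarrow> act M g (x \<ominus>\<^bsub>M\<^esub> y) = act M g x \<ominus>\<^bsub>M\<^esub> act M g y"
  by (simp add: M.minus_eq act_add act_uminus)

lemma gsubmoduleD:
  assumes "gsubmodule W R G M"
  shows "W \<subseteq> carrier M" "\<zero>\<^bsub>M\<^esub> \<in> W"
    "\<And>x y. x \<in> W \<Longrightarrow> y \<in> W \<Longrightarrow> x \<oplus>\<^bsub>M\<^esub> y \<in> W"
    "\<And>x. x \<in> W \<Longrightarrow> \<ominus>\<^bsub>M\<^esub> x \<in> W"
    "\<And>x y. x \<in> W \<Longrightarrow> y \<in> W \<Longrightarrow> x \<ominus>\<^bsub>M\<^esub> y \<in> W"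
    "\<And>r x. r \<in> carrier R \<Longrightarrow> x \<in> W \<Longrightarrow> r \<odot>\<^bsub>M\<^esub> x \<in> W"
    "\<And>g x. g \<in> carrier G \<Longrightarrow> x \<in> W \<Longrightarrow> act M g x \<in> W"
proof -
  have s: "submodule W R M" using assms by (simp add: gsubmodule_def)
  show "W \<subseteq> carrier M" using submoduleE(1)[OF s] .
  show "\<zero>\<^bsub>M\<^esub> \<in> W" using subgroup.one_closed[OF submodule.axioms(1)[OF s]] by simp
  show add: "\<And>x y. x \<in> W \<Longrightarrow> y \<in> W \<Longrightarrow> x \<oplus>\<^bsub>M\<^esub> y \<in> W" using submoduleE(5)[OF s] .
  show neg: "\<And>x. x \<in> W \<Longrightarrow> \<ominus>\<^bsub>M\<^esub> x \<in> W" using submoduleE(3)[OF s] .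
  show "\<And>x y. x \<in> W \<Longrightarrow> y \<in> W \<Longrightarrow> x \<ominus>\<^bsub>M\<^esub> y \<in> W"
    using add neg by (simp add: M.minus_eq)
  show "\<And>r x. r \<in> carrier R \<Longrightarrow> x \<in> W \<Longrightarrow> r \<odot>\<^bsub>M\<^esub> x \<in> W" using submoduleE(4)[OF s] .
  show "\<And>g x. g \<in> carrier G \<Longrightarrow> x \<in> W \<Longrightarrow> act M g x \<in> W"
    using assms by (simp add: gsubmodule_def)
qed

lemma gsubmoduleI:
  assumes "W \<subseteq> carrier M" "\<zero>\<^bsub>M\<^esub> \<in> W"
    and "\<And>x y. x \<in> W \<Longrightarrow> y \<in> W \<Longrightarrow> x \<oplus>\<^bsub>M\<^esub> y \<in> W"
    and smult: "\<And>r x. r \<in> carrier R \<Longrightarrow> x \<in> W \<Longrightarrow> r \<odot>\<^bsub>M\<^esub> x \<in> W"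
    and "\<And>g x. g \<in> carrier G \<Longrightarrow> x \<in> W \<Longrightarrow> act M g x \<in> W"
  shows "gsubmodule W R G M"
proof -
  have "\<ominus>\<^bsub>M\<^esub> x \<in> W" if "x \<in> W" for x
  proof -
    have "(\<ominus>\<^bsub>R\<^esub> \<one>\<^bsub>R\<^esub>) \<odot>\<^bsub>M\<^esub> x \<in> W" using smult that by simp
    moreover have "x \<in> carrier M" using that assms(1) by blast
    ultimately show ?thesis by (simp add: smult_l_minus)
  qed
  then show ?thesis
    unfolding gsubmodule_def using assms by (auto intro!: submoduleI)
qed

lemma gsubmodule_zero: "gsubmodule {\<zero>\<^bsub>M\<^esub>} R G M"
  by (rule gsubmoduleI) auto

lemma gsubmodule_carrier: "gsubmodule (carrier M) R G M"
  by (rule gsubmoduleI) auto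

lemma mem_coset_iff:
  assumes "gsubmodule N R G M" "x \<in> carrier M"
  shows "z \<in> N +>\<^bsub>M\<^esub> x \<longleftrightarrow> z \<in> carrier M \<and> z \<ominus>\<^bsub>M\<^esub> x \<in> N"
proof
  assume "z \<in> N +>\<^bsub>M\<^esub> x"
  then obtain n where "n \<in> N" "z = n \<oplus>\<^bsub>M\<^esub> x" by (auto simp: a_r_coset_def')
  moreover have "n \<in> carrier M" using gsubmoduleD(1)[OF assms(1)] \<open>n \<in> N\<close> by blast
  ultimately show "z \<in> carrier M \<and> z \<ominus>\<^bsub>M\<^esub> x \<in> N"
    using assms(2) by (simp add: minus_add_cancel)
next
  assume "z \<in> carrier M \<and> z \<ominus>\<^bsub>M\<^esub> x \<in> N"
  then show "z \<in> N +>\<^bsub>M\<^esub> x"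
    using minus_add_cancel(2)[of z x] assms(2) by (auto simp: a_r_coset_def' intro!: bexI)
qed

lemma coset_eq_iff:
  assumes N: "gsubmodule N R G M" and x: "x \<in> carrier M" and y: "y \<in> carrier M"
  shows "N +>\<^bsub>M\<^esub> x = N +>\<^bsub>M\<^esub> y \<longleftrightarrow> x \<ominus>\<^bsub>M\<^esub> y \<in> N"
proof
  assume "N +>\<^bsub>M\<^esub> x = N +>\<^bsub>M\<^esub> y"
  moreover have "x \<in> N +>\<^bsub>M\<^esub> x"
    using x gsubmoduleD(2)[OF N] by (simp add: mem_coset_iff[OF N] M.minus_eq M.r_neg)
  ultimately show "x \<ominus>\<^bsub>M\<^esub> y \<in> N" using y by (simp add: mem_coset_iff[OF N])
next
  assume xy: "x \<ominus>\<^bsub>M\<^esub> y \<in> N"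
  then have yx: "y \<ominus>\<^bsub>M\<^esub> x \<in> N"
    using gsubmoduleD(4)[OF N xy] x y by (simp add: minus_minus_minus)
  show "N +>\<^bsub>M\<^esub> x = N +>\<^bsub>M\<^esub> y"
  proof (rule Set.set_eqI)
    fix z
    have "z \<ominus>\<^bsub>M\<^esub> y \<in> N" if "z \<in> carrier M" "z \<ominus>\<^bsub>M\<^esub> x \<in> N"
      using gsubmoduleD(3)[OF N that(2) xy] that x y by (simp add: minus_telescope)
    moreover have "z \<ominus>\<^bsub>M\<^esub> x \<in> N" if "z \<in> carrier M" "z \<ominus>\<^bsub>M\<^esub> y \<in> N"
      using gsubmoduleD(3)[OF N that(2) yx] that x y by (simp add: minus_telescope)
    ultimately show "z \<in> N +>\<^bsub>M\<^esub> x \<longleftrightarrow> z \<in> N +>\<^bsub>M\<^esub> y"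
      using x y by (auto simp: mem_coset_iff[OF N])
  qed
qed

lemma coset_eq_self_iff:
  assumes "gsubmodule N R G M" "x \<in> carrier M"
  shows "N +>\<^bsub>M\<^esub> x = N \<longleftrightarrow> x \<in> N"
proof -
  have "N +>\<^bsub>M\<^esub> \<zero>\<^bsub>M\<^esub> = N"
  proof -
    have "n \<oplus>\<^bsub>M\<^esub> \<zero>\<^bsub>M\<^esub> = n" if "n \<in> N" for n
      using gsubmoduleD(1)[OF assms(1)] that by (intro M.r_zero) blast
    then show ?thesis by (simp add: a_r_coset_def')
  qed
  then show ?thesis
    using coset_eq_iff[OF assms M.zero_closed] assms(2) by (simp add: M.minus_eq M.minus_equality[of "\<zero>\<^bsub>M\<^esub>" "\<zero>\<^bsub>M\<^esub>"])
qed

end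

section \<open>Cosets and the submodules of a subquotient\<close>

locale gsubquotient = gmodule R G M
  for R (structure) and G :: "('g, 's) monoid_scheme" (structure)
    and M :: "('a, 'b, 'g) gmodule" (structure) +
  fixes W N
  assumes W: "gsubmodule W R G M" and N: "gsubmodule N R G M" and N_le_W: "N \<subseteq> W"
begin

abbreviation Q where "Q \<equiv> subquotient_gmodule M W N"

lemma W_carrier: "x \<in> W \<Longrightarrow> x \<in> carrier M"
  using gsubmoduleD(1)[OF W] by blast

abbreviation coset where "coset x \<equiv> N +>\<^bsub>M\<^esub> x"

lemma sq_carrier: "carrier Q = coset ` W"
  by (auto simp: quotient_gmodule_def A_RCOSETS_def' a_r_coset_def')

lemma sq_zero: "\<zero>\<^bsub>Q\<^esub> = N"
  by (simp add: quotient_gmodule_def)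

lemma coset_self: "x \<in> W \<Longrightarrow> x \<in> coset x"
  using gsubmoduleD(2)[OF N] by (simp add: mem_coset_iff[OF N] W_carrier M.minus_eq M.r_neg)

lemma sq_add:
  assumes "x \<in> W" "y \<in> W"
  shows "(coset x) \<oplus>\<^bsub>Q\<^esub> (coset y) = coset (x \<oplus>\<^bsub>M\<^esub> y)"
proof -
  have "(coset x) \<oplus>\<^bsub>Q\<^esub> (coset y) = (coset x) <+>\<^bsub>M\<^esub> (coset y)"
    by (simp add: quotient_gmodule_def set_add_def')
  also have "\<dots> = coset (x \<oplus>\<^bsub>M\<^esub> y)"
  proof (rule abelian_subgroup.a_rcos_sum)
    have "subgroup N (add_monoid M)"
      using N unfolding gsubmodule_def using submodule.axioms(1) by auto
    then show "abelian_subgroup N M"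
      by (intro abelian_subgroupI3) (auto intro: additive_subgroupI M.abelian_group_axioms)
  qed (use assms W_carrier in auto)
  finally show ?thesis .
qed

lemma sq_smult:
  assumes r: "r \<in> carrier R" and x: "x \<in> W"
  shows "r \<odot>\<^bsub>Q\<^esub> (coset x) = coset (r \<odot>\<^bsub>M\<^esub> x)"
proof -
  have "coset (r \<odot>\<^bsub>M\<^esub> z) = coset (r \<odot>\<^bsub>M\<^esub> x)" if "z \<in> coset x" for z
  proof -
    have z: "z \<in> carrier M" "z \<ominus>\<^bsub>M\<^esub> x \<in> N"
      using that x by (simp_all add: mem_coset_iff[OF N] W_carrier)
    then show ?thesis
      using gsubmoduleD(6)[OF N r z(2)] r x by (simp add: coset_eq_iff[OF N] W_carrier smult_minus)
  qed
  moreover have "r \<odot>\<^bsub>Q\<^esub> (coset x) = (\<Union>z\<in>coset x. coset (r \<odot>\<^bsub>M\<^esub> z))"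
    by (simp add: quotient_gmodule_def a_r_coset_def')
  ultimately show ?thesis using coset_self[OF x] by (metis (no_types, lifting) SUP_eq_const empty_iff)
qed

lemma sq_act:
  assumes g: "g \<in> carrier G" and x: "x \<in> W"
  shows "act Q g (coset x) = coset (act M g x)"
proof -
  have "coset (act M g z) = coset (act M g x)" if "z \<in> coset x" for z
  proof -
    have z: "z \<in> carrier M" "z \<ominus>\<^bsub>M\<^esub> x \<in> N"
      using that x by (simp_all add: mem_coset_iff[OF N] W_carrier)
    then show ?thesis
      using gsubmoduleD(7)[OF N g z(2)] g x by (simp add: coset_eq_iff[OF N] W_carrier act_minus)
  qed
  moreover have "act Q g (coset x) = (\<Union>z\<in>coset x. coset (act M g z))"
    by (simp add: quotient_gmodule_def a_r_coset_def')
  ultimately show ?thesis using coset_self[OF x] by (metis (no_types, lifting) SUP_eq_const empty_iff)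
qed

lemma zero_coset: "coset \<zero>\<^bsub>M\<^esub> = N"
  using coset_eq_self_iff[OF N M.zero_closed] gsubmoduleD(2)[OF N] by simp

lemma abelian_group_sq: "abelian_group Q"
proof (rule abelian_groupI)
  show "\<zero>\<^bsub>Q\<^esub> \<in> carrier Q"
    using zero_coset gsubmoduleD(2)[OF W] image_eqI[of N "coset" "\<zero>\<^bsub>M\<^esub>" W]
    unfolding sq_carrier sq_zero by simp
  fix x y z assume "x \<in> carrier Q" "y \<in> carrier Q"
  then obtain a b where ab: "a \<in> W" "b \<in> W" "x = coset a" "y = coset b"
    unfolding sq_carrier by blast
  show "x \<oplus>\<^bsub>Q\<^esub> y \<in> carrier Q"
    using ab gsubmoduleD(3)[OF W] unfolding sq_carrier by (simp add: sq_add)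
  show "x \<oplus>\<^bsub>Q\<^esub> y = y \<oplus>\<^bsub>Q\<^esub> x" using ab by (simp add: sq_add W_carrier M.a_comm)
  show "\<zero>\<^bsub>Q\<^esub> \<oplus>\<^bsub>Q\<^esub> x = x"
  proof -
    have "\<zero>\<^bsub>Q\<^esub> \<oplus>\<^bsub>Q\<^esub> x = (coset \<zero>\<^bsub>M\<^esub>) \<oplus>\<^bsub>Q\<^esub> (coset a)"
      by (simp only: zero_coset sq_zero ab(3))
    then show ?thesis using ab gsubmoduleD(2)[OF W] by (simp add: sq_add W_carrier)
  qed
  show "\<exists>y\<in>carrier Q. y \<oplus>\<^bsub>Q\<^esub> x = \<zero>\<^bsub>Q\<^esub>"
  proof
    show "(coset (\<ominus>\<^bsub>M\<^esub> a)) \<oplus>\<^bsub>Q\<^esub> x = \<zero>\<^bsub>Q\<^esub>"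
      using ab gsubmoduleD(4)[OF W] by (simp add: sq_add W_carrier M.l_neg zero_coset sq_zero)
    show "coset (\<ominus>\<^bsub>M\<^esub> a) \<in> carrier Q"
      using ab gsubmoduleD(4)[OF W] by (simp add: sq_carrier)
  qed
  assume "z \<in> carrier Q"
  then obtain c where c: "c \<in> W" "z = coset c" unfolding sq_carrier by blast
  show "x \<oplus>\<^bsub>Q\<^esub> y \<oplus>\<^bsub>Q\<^esub> z = x \<oplus>\<^bsub>Q\<^esub> (y \<oplus>\<^bsub>Q\<^esub> z)"
    using ab c gsubmoduleD(3)[OF W] by (simp add: sq_add W_carrier M.a_assoc)
qed

lemma gmodule_sq: "gmodule R G Q"
proof -
  have 1: "module R Q"
  proof (rule moduleI[OF R.is_cring abelian_group_sq])
    fix a b x y assume a: "a \<in> carrier R" and b: "b \<in> carrier R"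
      and x: "x \<in> carrier Q" and y: "y \<in> carrier Q"
    from x y obtain x' y' where xy: "x' \<in> W" "y' \<in> W" "x = coset x'" "y = coset y'"
      unfolding sq_carrier by blast
    note sq = sq_add sq_smult W_carrier gsubmoduleD(3,6)[OF W]
    show "a \<odot>\<^bsub>Q\<^esub> x \<in> carrier Q" using a xy by (simp add: sq sq_carrier)
    show "(a \<oplus>\<^bsub>R\<^esub> b) \<odot>\<^bsub>Q\<^esub> x = a \<odot>\<^bsub>Q\<^esub> x \<oplus>\<^bsub>Q\<^esub> b \<odot>\<^bsub>Q\<^esub> x"
      using a b xy by (simp add: sq smult_l_distr)
    show "a \<odot>\<^bsub>Q\<^esub> (x \<oplus>\<^bsub>Q\<^esub> y) = a \<odot>\<^bsub>Q\<^esub> x \<oplus>\<^bsub>Q\<^esub> a \<odot>\<^bsub>Q\<^esub> y"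
      using a xy by (simp add: sq smult_r_distr)
    show "a \<otimes>\<^bsub>R\<^esub> b \<odot>\<^bsub>Q\<^esub> x = a \<odot>\<^bsub>Q\<^esub> (b \<odot>\<^bsub>Q\<^esub> x)"
      using a b xy by (simp add: sq smult_assoc1)
  next
    fix x assume "x \<in> carrier Q"
    then show "\<one>\<^bsub>R\<^esub> \<odot>\<^bsub>Q\<^esub> x = x" by (auto simp: sq_carrier sq_smult W_carrier)
  qed
  note sq = sq_add sq_smult sq_act W_carrier gsubmoduleD(3,6,7)[OF W]
  have "gmodule_axioms R G Q"
  proof
    fix g assume g: "g \<in> carrier G"
    show "act Q g \<in> hom (add_monoid Q) (add_monoid Q)"
      using g by (auto simp: hom_def sq_carrier sq act_add)
    fix r x assume "r \<in> carrier R" "x \<in> carrier Q"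
    then show "act Q g (r \<odot>\<^bsub>Q\<^esub> x) = r \<odot>\<^bsub>Q\<^esub> act Q g x"
      using g by (auto simp: sq_carrier sq act_smult)
  next
    fix x assume x: "x \<in> carrier Q"
    then show "act Q \<one>\<^bsub>G\<^esub> x = x" by (auto simp: sq_carrier sq act_one)
    fix g h assume "g \<in> carrier G" "h \<in> carrier G"
    then show "act Q (g \<otimes>\<^bsub>G\<^esub> h) x = act Q g (act Q h x)"
      using x by (auto simp: sq_carrier sq act_mult)
  qed
  with 1 show ?thesis
    by (intro gmodule.intro) (auto intro: G.is_group)
qed

text \<open>The correspondence theorem: submodules of the quotient are images of submodules between
  \<open>N\<close> and \<open>W\<close>. After it, irreducibility is tested inside \<open>M\<close>,
  and cosets disappear from most arguments.\<close>

lemma irreducible_sq_iff: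
  "irreducible_gmodule R G Q \<longleftrightarrow>
    N \<noteq> W \<and> (\<forall>Z. gsubmodule Z R G M \<longrightarrow> N \<subseteq> Z \<longrightarrow> Z \<subseteq> W \<longrightarrow> Z = N \<or> Z = W)"
proof -
  interpret Q: gmodule R G Q by (rule gmodule_sq)
  have "carrier Q \<noteq> {\<zero>\<^bsub>Q\<^esub>} \<longleftrightarrow> N \<noteq> W"
  proof -
    have "carrier Q = {N} \<longleftrightarrow> (\<forall>x\<in>W. coset x = N)"
      using gsubmoduleD(2)[OF W] zero_coset unfolding sq_carrier by blast
    then have "carrier Q = {N} \<longleftrightarrow> W \<subseteq> N"
      using coset_eq_self_iff[OF N] W_carrier by auto
    then show ?thesis using N_le_W sq_zero by auto
  qed
  moreover have "(\<forall>Y. gsubmodule Y R G Q \<longrightarrow> Y = {\<zero>\<^bsub>Q\<^esub>} \<or> Y = carrier Q) \<longleftrightarrow>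
    (\<forall>Z. gsubmodule Z R G M \<longrightarrow> N \<subseteq> Z \<longrightarrow> Z \<subseteq> W \<longrightarrow> Z = N \<or> Z = W)" (is "?A \<longleftrightarrow> ?B")
  proof
    assume ?A
    show ?B
    proof (intro allI impI)
      fix Z assume Z: "gsubmodule Z R G M" "N \<subseteq> Z" "Z \<subseteq> W"
      note XW = subsetD[OF Z(3)]
      have "gsubmodule (coset ` Z) R G Q"
      proof (rule Q.gsubmoduleI)
        show "\<zero>\<^bsub>Q\<^esub> \<in> coset ` Z" unfolding sq_zero using zero_coset gsubmoduleD(2)[OF Z(1)] by (rule image_eqI[OF sym])
      qed (use XW gsubmoduleD(3,6,7)[OF Z(1)] in \<open>auto simp: sq_carrier sq_add sq_smult sq_act\<close>)
      then consider "coset ` Z = {\<zero>\<^bsub>Q\<^esub>}" | "coset ` Z = carrier Q"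
        using \<open>?A\<close> by blast
      then show "Z = N \<or> Z = W"
      proof cases
        case 1
        then have "x \<in> N" if "x \<in> Z" for x
          using that coset_eq_self_iff[OF N W_carrier[OF XW[OF that]]] sq_zero by blast
        then show ?thesis using Z(2) by blast
      next
        case 2
        have "x \<in> Z" if "x \<in> W" for x
        proof -
          from 2 that obtain z where z: "z \<in> Z" "coset x = coset z" unfolding sq_carrier by blast
          then have "x \<ominus>\<^bsub>M\<^esub> z \<in> N" using that XW by (simp add: coset_eq_iff[OF N] W_carrier)
          then have "x \<ominus>\<^bsub>M\<^esub> z \<oplus>\<^bsub>M\<^esub> z \<in> Z" using Z(2) z(1) gsubmoduleD(3)[OF Z(1)] by blast
          then show ?thesis using that z XW by (simp add: minus_add_cancel W_carrier)
        qed
        then show ?thesis using Z(3) by blast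
      qed
    qed
  next
    assume ?B
    show ?A
    proof (intro allI impI)
      fix Y assume Y: "gsubmodule Y R G Q"
      define Z where "Z = {x \<in> W. coset x \<in> Y}"
      have "gsubmodule Z R G M"
      proof (rule gsubmoduleI)
        show "\<zero>\<^bsub>M\<^esub> \<in> Z"
          using Q.gsubmoduleD(2)[OF Y] gsubmoduleD(2)[OF W] zero_coset by (simp add: Z_def sq_zero)
      next
        fix x y assume "x \<in> Z" "y \<in> Z"
        then show "x \<oplus>\<^bsub>M\<^esub> y \<in> Z"
          using Q.gsubmoduleD(3)[OF Y, of "coset x" "coset y"] gsubmoduleD(3)[OF W]
          by (auto simp: Z_def sq_add)
      next
        fix r x assume "x \<in> Z" "r \<in> carrier R"
        then show "r \<odot>\<^bsub>M\<^esub> x \<in> Z"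
          using Q.gsubmoduleD(6)[OF Y, of r "coset x"] gsubmoduleD(6)[OF W]
          by (auto simp: Z_def sq_smult)
      next
        fix g x assume "x \<in> Z" "g \<in> carrier G"
        then show "act M g x \<in> Z"
          using Q.gsubmoduleD(7)[OF Y, of g "coset x"] gsubmoduleD(7)[OF W]
          by (auto simp: Z_def sq_act)
      qed (auto simp: Z_def W_carrier)
      moreover have "N \<subseteq> Z"
      proof
        fix x assume "x \<in> N"
        then have "x \<in> W" "coset x = N" using N_le_W coset_eq_self_iff[OF N] W_carrier by blast+
        then show "x \<in> Z" using Q.gsubmoduleD(2)[OF Y] unfolding Z_def by (simp add: sq_zero)
      qed
      ultimately consider "Z = N" | "Z = W" using \<open>?B\<close> by (auto simp: Z_def)
      then show "Y = {\<zero>\<^bsub>Q\<^esub>} \<or> Y = carrier Q"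
      proof cases
        case 1
        have "y = N" if "y \<in> Y" for y
        proof -
          from that obtain x where x: "x \<in> W" "y = coset x"
            using Q.gsubmoduleD(1)[OF Y] unfolding sq_carrier by blast
          then have "x \<in> Z" using that by (simp add: Z_def)
          then show ?thesis using 1 x coset_eq_self_iff[OF N] W_carrier by simp
        qed
        then have "Y = {N}" using Q.gsubmoduleD(2)[OF Y] unfolding sq_zero by blast
        then show ?thesis by (simp add: sq_zero)
      next
        case 2
        then show ?thesis using Q.gsubmoduleD(1)[OF Y] by (auto simp: Z_def sq_carrier)
      qed
    qed
  qed
  ultimately show ?thesis unfolding irreducible_gmodule_def by simp
qed

end


section \<open>Homomorphisms, isomorphisms and annihilating polynomials\<close>

lemma gmodule_hom_zero:
  assumes "gmodule R G A" "gmodule R G B" "h \<in> gmodule_hom R G A B"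
  shows "h \<zero>\<^bsub>A\<^esub> = \<zero>\<^bsub>B\<^esub>"
proof -
  interpret A: gmodule R G A by fact
  interpret B: gmodule R G B by fact
  have h: "h \<in> hom (add_monoid A) (add_monoid B)" using assms(3) by (simp add: gmodule_hom_def)
  have "h (\<zero>\<^bsub>A\<^esub> \<oplus>\<^bsub>A\<^esub> \<zero>\<^bsub>A\<^esub>) = h \<zero>\<^bsub>A\<^esub> \<oplus>\<^bsub>B\<^esub> h \<zero>\<^bsub>A\<^esub>" "h \<zero>\<^bsub>A\<^esub> \<in> carrier B"
    using hom_mult[OF h, of "\<zero>\<^bsub>A\<^esub>" "\<zero>\<^bsub>A\<^esub>"] hom_in_carrier[OF h, of "\<zero>\<^bsub>A\<^esub>"] by simp_all
  then show ?thesis by (metis A.M.r_zero A.M.zero_closed B.M.add.r_cancel_one')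
qed

lemma gmodule_iso_sym:
  assumes "gmodule R G A" "gmodule_isomorphic R G A B"
  shows "gmodule_isomorphic R G B A"
proof -
  interpret A: gmodule R G A by fact
  obtain h where h: "h \<in> gmodule_hom R G A B" "bij_betw h (carrier A) (carrier B)"
    using assms(2) unfolding gmodule_isomorphic_def by blast
  define k where "k = inv_into (carrier A) h"
  have k: "bij_betw k (carrier B) (carrier A)"
    unfolding k_def by (rule bij_betw_inv_into) fact
  have hk: "h (k y) = y" "k y \<in> carrier A" if "y \<in> carrier B" for y
    using that h(2) k unfolding k_def by (auto simp: bij_betw_inv_into_right bij_betwE)
  have kI: "k y = x" if "x \<in> carrier A" "h x = y" for x y
    using that h(2) unfolding k_def by (auto simp: bij_betw_inv_into_left)
  have hh: "\<And>x y. x \<in> carrier A \<Longrightarrow> y \<in> carrier A \<Longrightarrow> h (x \<oplus>\<^bsub>A\<^esub> y) = h x \<oplus>\<^bsub>B\<^esub> h y"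
    "\<And>r x. r \<in> carrier R \<Longrightarrow> x \<in> carrier A \<Longrightarrow> h (r \<odot>\<^bsub>A\<^esub> x) = r \<odot>\<^bsub>B\<^esub> h x"
    "\<And>g x. g \<in> carrier G \<Longrightarrow> x \<in> carrier A \<Longrightarrow> h (act A g x) = act B g (h x)"
    using h(1) by (auto simp: gmodule_hom_def hom_def)
  have "k \<in> gmodule_hom R G B A"
    unfolding gmodule_hom_def hom_def
    by (auto simp: hk hh intro!: kI)
  with k show ?thesis unfolding gmodule_isomorphic_def by blast
qed

lemma gmodule_iso_trans:
  assumes "gmodule_isomorphic R G A B" "gmodule_isomorphic R G B C"
  shows "gmodule_isomorphic R G A C"
proof -
  obtain h k where h: "h \<in> gmodule_hom R G A B" "bij_betw h (carrier A) (carrier B)"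
    and k: "k \<in> gmodule_hom R G B C" "bij_betw k (carrier B) (carrier C)"
    using assms unfolding gmodule_isomorphic_def by blast
  have "x \<in> carrier A \<Longrightarrow> h x \<in> carrier B" for x using h(2) by (auto simp: bij_betw_def)
  then have "k \<circ> h \<in> gmodule_hom R G A C"
    using h(1) k(1) by (auto simp: gmodule_hom_def hom_def Pi_def)
  with bij_betw_trans[OF h(2) k(2)] show ?thesis unfolding gmodule_isomorphic_def by blast
qed

lemma irreducible_gmodule_isomorphic:
  assumes A: "gmodule R G A" and B: "gmodule R G B" and iso: "gmodule_isomorphic R G A B"
    and irr: "irreducible_gmodule R G A"
  shows "irreducible_gmodule R G B"
proof -
  interpret A: gmodule R G A by fact
  interpret B: gmodule R G B by fact
  obtain h where h: "h \<in> gmodule_hom R G A B" and bij: "bij_betw h (carrier A) (carrier B)"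
    using iso unfolding gmodule_isomorphic_def by blast
  have h0: "h \<zero>\<^bsub>A\<^esub> = \<zero>\<^bsub>B\<^esub>" by (rule gmodule_hom_zero[OF A B h])
  have hh: "\<And>x y. x \<in> carrier A \<Longrightarrow> y \<in> carrier A \<Longrightarrow> h (x \<oplus>\<^bsub>A\<^esub> y) = h x \<oplus>\<^bsub>B\<^esub> h y"
    "\<And>r x. r \<in> carrier R \<Longrightarrow> x \<in> carrier A \<Longrightarrow> h (r \<odot>\<^bsub>A\<^esub> x) = r \<odot>\<^bsub>B\<^esub> h x"
    "\<And>g x. g \<in> carrier G \<Longrightarrow> x \<in> carrier A \<Longrightarrow> h (act A g x) = act B g (h x)"
    using h by (auto simp: gmodule_hom_def hom_def)
  have im: "h ` carrier A = carrier B" using bij by (simp add: bij_betw_def)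
  have "W = {\<zero>\<^bsub>B\<^esub>} \<or> W = carrier B" if W: "gsubmodule W R G B" for W
  proof -
    define V where "V = {x \<in> carrier A. h x \<in> W}"
    have hV: "h ` V = W"
    proof
      show "W \<subseteq> h ` V"
      proof
        fix y assume "y \<in> W"
        then have "y \<in> h ` carrier A" using B.gsubmoduleD(1)[OF W] im by blast
        then show "y \<in> h ` V" using \<open>y \<in> W\<close> unfolding V_def by blast
      qed
    qed (auto simp: V_def)
    have "gsubmodule V R G A"
      by (rule A.gsubmoduleI) (auto simp: V_def hh h0 B.gsubmoduleD[OF W])
    then have "V = {\<zero>\<^bsub>A\<^esub>} \<or> V = carrier A" using irr by (simp add: irreducible_gmodule_def)
    with hV h0 im show ?thesis by auto
  qed
  moreover have "carrier B \<noteq> {\<zero>\<^bsub>B\<^esub>}"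
  proof
    assume "carrier B = {\<zero>\<^bsub>B\<^esub>}"
    have "x = \<zero>\<^bsub>A\<^esub>" if "x \<in> carrier A" for x
    proof (rule inj_onD[OF bij_betw_imp_inj_on[OF bij] _ that A.M.zero_closed])
      show "h x = h \<zero>\<^bsub>A\<^esub>" using that im h0 \<open>carrier B = {\<zero>\<^bsub>B\<^esub>}\<close> by auto
    qed
    then have "carrier A = {\<zero>\<^bsub>A\<^esub>}" using A.M.zero_closed by blast
    then show False using irr by (simp add: irreducible_gmodule_def)
  qed
  ultimately show ?thesis by (simp add: irreducible_gmodule_def)
qed

text \<open>\<open>\<phi>\<close> is a homomorphism on \<open>W\<close> only, since the maps used
  later, such as single matrix entries, are often equivariant only on a step of a
  filtration.\<close>

lemma (in gsubquotient) first_isomorphism: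
  assumes F: "gmodule R G F" and phi: "\<phi> \<in> gmodule_hom R G (M\<lparr>carrier := W\<rparr>) F"
    and onto: "\<phi> ` W = carrier F" and ker: "\<And>x. x \<in> W \<Longrightarrow> \<phi> x = \<zero>\<^bsub>F\<^esub> \<longleftrightarrow> x \<in> N"
  shows "gmodule_isomorphic R G Q F"
proof -
  interpret F: gmodule R G F by fact
  have ph: "\<And>x y. x \<in> W \<Longrightarrow> y \<in> W \<Longrightarrow> \<phi> (x \<oplus>\<^bsub>M\<^esub> y) = \<phi> x \<oplus>\<^bsub>F\<^esub> \<phi> y"
    "\<And>r x. r \<in> carrier R \<Longrightarrow> x \<in> W \<Longrightarrow> \<phi> (r \<odot>\<^bsub>M\<^esub> x) = r \<odot>\<^bsub>F\<^esub> \<phi> x"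
    "\<And>g x. g \<in> carrier G \<Longrightarrow> x \<in> W \<Longrightarrow> \<phi> (act M g x) = act F g (\<phi> x)"
    "\<And>x. x \<in> W \<Longrightarrow> \<phi> x \<in> carrier F"
    using phi by (auto simp: gmodule_hom_def hom_def)
  have eq: "\<phi> x = \<phi> y \<longleftrightarrow> coset x = coset y" if "x \<in> W" "y \<in> W" for x y
  proof -
    have d: "x \<ominus>\<^bsub>M\<^esub> y \<in> W" using gsubmoduleD(5)[OF W] that .
    have "\<phi> x = \<phi> (x \<ominus>\<^bsub>M\<^esub> y) \<oplus>\<^bsub>F\<^esub> \<phi> y"
      using ph(1)[OF d that(2)] that by (simp add: minus_add_cancel W_carrier)
    moreover have "\<phi> (x \<ominus>\<^bsub>M\<^esub> y) \<oplus>\<^bsub>F\<^esub> \<phi> y = \<phi> y \<longleftrightarrow> \<phi> (x \<ominus>\<^bsub>M\<^esub> y) = \<zero>\<^bsub>F\<^esub>"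
      using F.M.add.r_cancel_one[OF ph(4)[OF that(2)] ph(4)[OF d]] by simp
    ultimately have "\<phi> x = \<phi> y \<longleftrightarrow> \<phi> (x \<ominus>\<^bsub>M\<^esub> y) = \<zero>\<^bsub>F\<^esub>" by simp
    then show ?thesis using ker[OF d] that by (simp add: coset_eq_iff[OF N] W_carrier)
  qed
  \<comment> \<open>The induced map takes any representative of the coset; \<open>eq\<close> says
    that the value does not depend on it.\<close>
  define h where "h C = \<phi> (SOME x. x \<in> W \<and> C = coset x)" for C
  have h: "h (coset x) = \<phi> x" if "x \<in> W" for x
  proof -
    have "(SOME z. z \<in> W \<and> coset x = coset z) \<in> W \<and>
        coset x = coset (SOME z. z \<in> W \<and> coset x = coset z)"
      using that by (intro someI[where P = "\<lambda>z. z \<in> W \<and> coset x = coset z"]) simp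
    then show ?thesis unfolding h_def using eq that by metis
  qed
  have "h \<in> gmodule_hom R G Q F"
    unfolding gmodule_hom_def hom_def
    by (auto simp: sq_carrier sq_add sq_smult sq_act h ph gsubmoduleD(3,6,7)[OF W])
  moreover have "bij_betw h (carrier Q) (carrier F)"
  proof (rule bij_betwI')
    fix C D assume "C \<in> carrier Q" "D \<in> carrier Q"
    then obtain x y where "x \<in> W" "y \<in> W" "C = coset x" "D = coset y"
      unfolding sq_carrier by blast
    then show "h C = h D \<longleftrightarrow> C = D" by (simp add: h eq)
  next
    fix C assume "C \<in> carrier Q"
    then show "h C \<in> carrier F" by (auto simp: sq_carrier h ph)
  next
    fix y assume "y \<in> carrier F"
    then obtain x where "x \<in> W" "y = \<phi> x" using onto by blast
    then show "\<exists>C\<in>carrier Q. y = h C"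
      unfolding sq_carrier using h by auto
  qed
  ultimately show ?thesis unfolding gmodule_isomorphic_def by blast
qed

text \<open>Coefficients are listed in increasing order of degree (Horner scheme).\<close>

definition poly_act ::
    "('a, 'b, 'g) gmodule \<Rightarrow> 'g \<Rightarrow> 'a list \<Rightarrow> 'b \<Rightarrow> 'b" where
  "poly_act M g cs x = foldr (\<lambda>c y. c \<odot>\<^bsub>M\<^esub> x \<oplus>\<^bsub>M\<^esub> act M g y) cs \<zero>\<^bsub>M\<^esub>"

lemma poly_act_simps [simp]:
  "poly_act M g [] x = \<zero>\<^bsub>M\<^esub>"
  "poly_act M g (c # cs) x = c \<odot>\<^bsub>M\<^esub> x \<oplus>\<^bsub>M\<^esub> act M g (poly_act M g cs x)"
  by (simp_all add: poly_act_def)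

lemma (in gmodule) poly_act_in:
  assumes "gsubmodule W R G M" "g \<in> carrier G" "set cs \<subseteq> carrier R" "x \<in> W"
  shows "poly_act M g cs x \<in> W"
  using assms(3) by (induction cs) (use assms gsubmoduleD[OF assms(1)] in auto)

lemma poly_act_hom:
  assumes A: "gmodule R G A" and B: "gmodule R G B" and h: "h \<in> gmodule_hom R G A B"
    and g: "g \<in> carrier G" and cs: "set cs \<subseteq> carrier R" and x: "x \<in> carrier A"
  shows "h (poly_act A g cs x) = poly_act B g cs (h x)"
  using cs
proof (induction cs)
  case Nil
  then show ?case using gmodule_hom_zero[OF A B h] by simp
next
  case (Cons c cs)
  interpret A: gmodule R G A by fact
  have p: "poly_act A g cs x \<in> carrier A"
    using A.poly_act_in[OF A.gsubmodule_carrier g _ x] Cons.prems by simp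
  have "h (poly_act A g (c # cs) x) = h (c \<odot>\<^bsub>A\<^esub> x) \<oplus>\<^bsub>B\<^esub> h (act A g (poly_act A g cs x))"
    using h g x p Cons.prems by (simp add: gmodule_hom_def hom_def)
  then show ?case
    using h g x p Cons by (simp add: gmodule_hom_def)
qed

lemma (in gsubquotient) poly_act_sq:
  assumes g: "g \<in> carrier G" and cs: "set cs \<subseteq> carrier R" and x: "x \<in> W"
  shows "poly_act Q g cs (coset x) = coset (poly_act M g cs x)"
  using cs
proof (induction cs)
  case Nil
  then show ?case by (simp add: sq_zero zero_coset)
next
  case (Cons c cs)
  have "poly_act M g cs x \<in> W" using poly_act_in[OF W g _ x] Cons.prems by simp
  then show ?case
    using Cons g x gsubmoduleD(3,6,7)[OF W] by (simp add: sq_smult sq_act sq_add)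
qed

text \<open>An isomorphism commutes with polynomials in \<open>g\<close>, so relations pass from one
  subquotient to the other. With the second subquotient inside End V, this imposes on V the
  equations that hold on End V.\<close>

lemma annihilator_transfer:
  assumes 1: "gsubquotient R G M W N" and 2: "gsubquotient R G M' W' N'"
    and iso: "gmodule_isomorphic R G (subquotient_gmodule M W N) (subquotient_gmodule M' W' N')"
    and g: "g \<in> carrier G" and cs: "set cs \<subseteq> carrier R"
    and ann: "\<And>y. y \<in> W' \<Longrightarrow> poly_act M' g cs y \<in> N'"
    and x: "x \<in> W"
  shows "poly_act M g cs x \<in> N"
proof -
  interpret A: gsubquotient R G M W N by fact
  interpret B: gsubquotient R G M' W' N' by fact
  obtain h where h: "h \<in> gmodule_hom R G A.Q B.Q" "bij_betw h (carrier A.Q) (carrier B.Q)"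
    using iso unfolding gmodule_isomorphic_def by blast
  note hom = A.gmodule_sq B.gmodule_sq h(1)
  have c: "N +>\<^bsub>M\<^esub> x \<in> carrier A.Q" using x by (simp add: A.sq_carrier)
  then have "h (N +>\<^bsub>M\<^esub> x) \<in> carrier B.Q" using bij_betwE[OF h(2)] by blast
  then obtain y where y: "y \<in> W'" "h (N +>\<^bsub>M\<^esub> x) = N' +>\<^bsub>M'\<^esub> y"
    unfolding B.sq_carrier by blast
  have p: "poly_act M g cs x \<in> W" by (rule A.poly_act_in[OF A.W g cs x])
  have py: "poly_act M' g cs y \<in> W'" by (rule B.poly_act_in[OF B.W g cs y(1)])
  have "h (N +>\<^bsub>M\<^esub> poly_act M g cs x) = poly_act B.Q g cs (N' +>\<^bsub>M'\<^esub> y)"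
    using poly_act_hom[OF hom g cs c] y A.poly_act_sq[OF g cs x] by simp
  also have "\<dots> = N'"
    using B.poly_act_sq[OF g cs y(1)] ann[OF y(1)] B.coset_eq_self_iff[OF B.N B.W_carrier[OF py]]
    by simp
  also have "\<dots> = h N"
    using gmodule_hom_zero[OF hom] by (simp add: A.sq_zero B.sq_zero)
  finally have "N +>\<^bsub>M\<^esub> poly_act M g cs x = N"
  proof (rule inj_onD[OF bij_betw_imp_inj_on[OF h(2)]])
    show "N +>\<^bsub>M\<^esub> poly_act M g cs x \<in> carrier A.Q" using p by (simp add: A.sq_carrier)
    show "N \<in> carrier A.Q"
      using abelian_group.a_group[OF A.abelian_group_sq] abelian_monoid.zero_closed[of A.Q]
        abelian_group.axioms(1)[OF A.abelian_group_sq] by (simp add: A.sq_zero)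
  qed
  then show ?thesis using A.coset_eq_self_iff[OF A.N A.W_carrier[OF p]] by simp
qed

section \<open>Composition series through a given factor\<close>

text \<open>Induction on the number of elements of \<open>W - N\<close>: a submodule of least
  cardinality strictly above \<open>N\<close> leaves nothing in between, so it is the next term of
  the chain.\<close>

lemma (in gmodule) composition_chain_exists:
  assumes fin: "finite (carrier M)"
  shows "\<lbrakk>gsubmodule N R G M; gsubmodule W R G M; N \<subseteq> W\<rbrakk> \<Longrightarrow>
    \<exists>Xs. Xs \<noteq> [] \<and> hd Xs = N \<and> last Xs = W \<and> (\<forall>Z\<in>set Xs. gsubmodule Z R G M) \<and>
      successively (\<lambda>A B. A \<subset> B \<and> irreducible_gmodule R G (subquotient_gmodule M B A)) Xs"
proof (induction "card (W - N)" arbitrary: N rule: less_induct)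
  case less
  show ?case
  proof (cases "N = W")
    case True
    then show ?thesis using less.prems by (intro exI[of _ "[N]"]) simp
  next
    case False
    have finW: "finite W" using fin gsubmoduleD(1)[OF less.prems(2)] by (rule rev_finite_subset)
    define P where "P Z \<longleftrightarrow> gsubmodule Z R G M \<and> N \<subset> Z \<and> Z \<subseteq> W" for Z
    have "P W" using less.prems False by (auto simp: P_def)
    then obtain Z where Z: "P Z" and min: "\<And>Y. P Y \<Longrightarrow> card Z \<le> card Y"
      using arg_min_natI[of P W card] arg_min_nat_le[of P _ card] by blast
    have Zs: "gsubmodule Z R G M" "N \<subset> Z" "Z \<subseteq> W" using Z by (auto simp: P_def)
    have finZ: "finite Z" using finW Zs(3) by (rule rev_finite_subset)
    have "irreducible_gmodule R G (subquotient_gmodule M Z N)"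
    proof -
      interpret S: gsubquotient R G M Z N
        by unfold_locales (use Zs less.prems in auto)
      have "Y = N \<or> Y = Z" if "gsubmodule Y R G M" "N \<subseteq> Y" "Y \<subseteq> Z" for Y
      proof (rule ccontr)
        assume n: "\<not> (Y = N \<or> Y = Z)"
        then have "P Y" using that Zs by (auto simp: P_def)
        moreover have "card Y < card Z" using n that finZ by (intro psubset_card_mono) auto
        ultimately show False using min[of Y] by simp
      qed
      then show ?thesis unfolding S.irreducible_sq_iff using Zs by blast
    qed
    moreover obtain Xs where Xs: "Xs \<noteq> []" "hd Xs = Z" "last Xs = W"
        "\<forall>Z\<in>set Xs. gsubmodule Z R G M"
        "successively (\<lambda>A B. A \<subset> B \<and> irreducible_gmodule R G (subquotient_gmodule M B A)) Xs"
    proof -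
      have "card (W - Z) < card (W - N)"
        using finW Zs by (intro psubset_card_mono) auto
      from less.hyps[OF this Zs(1) less.prems(2) Zs(3)] show ?thesis using that by blast
    qed
    ultimately show ?thesis
      using less.prems Zs by (intro exI[of _ "N # Xs"]) (cases Xs, auto)
  qed
qed

text \<open>A composition factor is by definition a step of a whole series, so the step from
  \<open>N\<close> to \<open>W\<close> is completed by refining below \<open>N\<close> and above
  \<open>W\<close>.\<close>

lemma (in gsubquotient) composition_series_through:
  assumes fin: "finite (carrier M)" and irr: "irreducible_gmodule R G Q"
  shows "\<exists>Ws i. composition_series_gmodule R G M Ws \<and> Suc i < length Ws \<and>
    Ws ! i = N \<and> Ws ! Suc i = W"
proof -
  let ?P = "\<lambda>A B. A \<subset> B \<and> irreducible_gmodule R G (subquotient_gmodule M B A)"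
  obtain Xs where Xs: "Xs \<noteq> []" "hd Xs = {\<zero>\<^bsub>M\<^esub>}" "last Xs = N"
      "\<forall>Z\<in>set Xs. gsubmodule Z R G M" "successively ?P Xs"
    using composition_chain_exists[OF fin gsubmodule_zero N] gsubmoduleD(2)[OF N] by blast
  obtain Ys where Ys: "Ys \<noteq> []" "hd Ys = W" "last Ys = carrier M"
      "\<forall>Z\<in>set Ys. gsubmodule Z R G M" "successively ?P Ys"
    using composition_chain_exists[OF fin W gsubmodule_carrier] gsubmoduleD(1)[OF W] by blast
  have "?P N W" using irr irreducible_sq_iff N_le_W by blast
  then have "successively ?P (Xs @ Ys)"
    using Xs Ys by (simp add: successively_append_iff)
  then have "composition_series_gmodule R G M (Xs @ Ys)"
    using Xs Ys unfolding composition_series_gmodule_def by (auto simp: successively_conv_nth)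
  \<comment> \<open>\<open>N\<close> is the last entry of \<open>Xs\<close> and \<open>W\<close> the
    first of \<open>Ys\<close>, hence the index \<open>length Xs - 1\<close>.\<close>
  moreover have "(Xs @ Ys) ! (length Xs - 1) = N" "(Xs @ Ys) ! Suc (length Xs - 1) = W"
    using Xs Ys by (auto simp: nth_append last_conv_nth hd_conv_nth)
  moreover have "Suc (length Xs - 1) < length (Xs @ Ys)" using Xs(1) Ys(1) by simp
  ultimately show ?thesis by blast
qed

text \<open>\<open>F\<close> is a common model: both factors are compared with it and never directly
  with each other.\<close>

lemma common_factorI:
  assumes 1: "gsubquotient R G M W N" and 2: "gsubquotient R G M' W' N'"
    and fin: "finite (carrier M)" "finite (carrier M')"
    and F: "gmodule R G F" "irreducible_gmodule R G F"
    and phi: "\<phi> \<in> gmodule_hom R G (M\<lparr>carrier := W\<rparr>) F" "\<phi> ` W = carrier F"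
      "\<And>x. x \<in> W \<Longrightarrow> \<phi> x = \<zero>\<^bsub>F\<^esub> \<longleftrightarrow> x \<in> N"
    and psi: "\<psi> \<in> gmodule_hom R G (M'\<lparr>carrier := W'\<rparr>) F" "\<psi> ` W' = carrier F"
      "\<And>x. x \<in> W' \<Longrightarrow> \<psi> x = \<zero>\<^bsub>F\<^esub> \<longleftrightarrow> x \<in> N'"
  shows "common_composition_factor R G M M'"
proof -
  interpret A: gsubquotient R G M W N by fact
  interpret B: gsubquotient R G M' W' N' by fact
  have a: "gmodule_isomorphic R G A.Q F" by (rule A.first_isomorphism[OF F(1) phi])
  have b: "gmodule_isomorphic R G B.Q F" by (rule B.first_isomorphism[OF F(1) psi])
  have a': "gmodule_isomorphic R G F A.Q" by (rule gmodule_iso_sym[OF A.gmodule_sq a])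
  have b': "gmodule_isomorphic R G F B.Q" by (rule gmodule_iso_sym[OF B.gmodule_sq b])
  have "irreducible_gmodule R G A.Q" "irreducible_gmodule R G B.Q"
    using irreducible_gmodule_isomorphic[OF F(1) A.gmodule_sq a' F(2)]
      irreducible_gmodule_isomorphic[OF F(1) B.gmodule_sq b' F(2)] by auto
  then obtain Ws i Us j where "composition_series_gmodule R G M Ws" "Suc i < length Ws"
      "Ws ! i = N" "Ws ! Suc i = W" "composition_series_gmodule R G M' Us" "Suc j < length Us"
      "Us ! j = N'" "Us ! Suc j = W'"
    using A.composition_series_through[OF fin(1)] B.composition_series_through[OF fin(2)] by metis
  then show ?thesis
    unfolding common_composition_factor_def using gmodule_iso_trans[OF a b'] by metis
qed

lemma common_factorE:
  assumes "common_composition_factor R G M M'" and M: "gmodule R G M" and M': "gmodule R G M'"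
  obtains W N W' N' where "gsubquotient R G M W N" "gsubquotient R G M' W' N'"
    "irreducible_gmodule R G (subquotient_gmodule M W N)"
    "irreducible_gmodule R G (subquotient_gmodule M' W' N')"
    "gmodule_isomorphic R G (subquotient_gmodule M W N) (subquotient_gmodule M' W' N')"
proof -
  from assms(1) obtain Ws Us i j where
    1: "composition_series_gmodule R G M Ws" "Suc i < length Ws"
    and 2: "composition_series_gmodule R G M' Us" "Suc j < length Us"
    and iso: "gmodule_isomorphic R G
          (subquotient_gmodule M (Ws ! Suc i) (Ws ! i))
          (subquotient_gmodule M' (Us ! Suc j) (Us ! j))"
    unfolding common_composition_factor_def by blast
  show ?thesis
  proof (rule that[OF _ _ _ _ iso])
    show "gsubquotient R G M (Ws ! Suc i) (Ws ! i)"
      using 1 M unfolding gsubquotient_def gsubquotient_axioms_def composition_series_gmodule_def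
      by (meson Suc_lessD nth_mem psubset_imp_subset)
    show "gsubquotient R G M' (Us ! Suc j) (Us ! j)"
      using 2 M' unfolding gsubquotient_def gsubquotient_axioms_def composition_series_gmodule_def
      by (meson Suc_lessD nth_mem psubset_imp_subset)
  qed (use 1 2 in \<open>auto simp: composition_series_gmodule_def\<close>)
qed

text \<open>A substitute for the Jordan--Hoelder theorem: the character is the one belonging to the first
  step of the filtration at which \<open>W\<close> leaves \<open>N\<close>.\<close>

lemma (in gsubquotient) irreducible_scalar_action:
  fixes Ms :: "nat \<Rightarrow> 'b set" and \<chi> :: "nat \<Rightarrow> 'g \<Rightarrow> 'a"
  assumes irr: "irreducible_gmodule R G Q"
    and Ms: "Ms 0 = {\<zero>\<^bsub>M\<^esub>}" "Ms n = carrier M"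
    and chi: "\<And>k g. k < n \<Longrightarrow> g \<in> carrier G \<Longrightarrow> \<chi> k g \<in> carrier R"
    and step: "\<And>k g x. k < n \<Longrightarrow> g \<in> carrier G \<Longrightarrow> x \<in> Ms (Suc k) \<Longrightarrow>
      act M g x \<ominus>\<^bsub>M\<^esub> \<chi> k g \<odot>\<^bsub>M\<^esub> x \<in> Ms k"
  obtains k where "k < n"
    "\<And>g x. g \<in> carrier G \<Longrightarrow> x \<in> W \<Longrightarrow> act M g x \<ominus>\<^bsub>M\<^esub> \<chi> k g \<odot>\<^bsub>M\<^esub> x \<in> N"
proof -
  have NW: "N \<noteq> W" and max: "\<And>Z. gsubmodule Z R G M \<Longrightarrow> N \<subseteq> Z \<Longrightarrow> Z \<subseteq> W \<Longrightarrow> Z = N \<or> Z = W"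
    using irr irreducible_sq_iff by auto
  have "\<exists>k<n. W \<inter> Ms k \<subseteq> N \<and> \<not> W \<inter> Ms (Suc k) \<subseteq> N"
  proof (rule ccontr)
    assume c: "\<not> ?thesis"
    have "k \<le> n \<Longrightarrow> W \<inter> Ms k \<subseteq> N" for k
    proof (induction k)
      case 0
      then show ?case using Ms(1) gsubmoduleD(2)[OF N] by auto
    next
      case (Suc k)
      then show ?case using c by (meson Suc_le_eq less_imp_le)
    qed
    from this[of n] have "W \<subseteq> N" using Ms(2) W_carrier by auto
    then show False using NW N_le_W by blast
  qed
  then obtain k x where k: "k < n" "W \<inter> Ms k \<subseteq> N" and x: "x \<in> W" "x \<in> Ms (Suc k)" "x \<notin> N"
    by blast
  define d where "d g z = act M g z \<ominus>\<^bsub>M\<^esub> \<chi> k g \<odot>\<^bsub>M\<^esub> z" for g z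
  \<comment> \<open>\<open>Z\<close> collects the vectors of \<open>W\<close> on which all of
    \<open>G\<close> acts by \<open>\<chi> k\<close> modulo \<open>N\<close>. It is a submodule that
    contains \<open>N\<close> and the vector \<open>x\<close> outside \<open>N\<close>, so
    irreducibility makes it all of \<open>W\<close>.\<close>
  define Z where "Z = {z \<in> W. \<forall>g\<in>carrier G. d g z \<in> N}"
  note chik = chi[OF k(1)]
  have dN: "d g z \<in> N" if "g \<in> carrier G" "z \<in> N" for g z
    unfolding d_def using gsubmoduleD(5-7)[OF N] chik that by simp
  have d_add: "d g (x \<oplus>\<^bsub>M\<^esub> y) = d g x \<oplus>\<^bsub>M\<^esub> d g y"
    if "g \<in> carrier G" "x \<in> carrier M" "y \<in> carrier M" for g x y
    unfolding d_def using that chik by (simp add: act_add smult_r_distr minus_add_minus)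
  have d_smult: "d g (r \<odot>\<^bsub>M\<^esub> x) = r \<odot>\<^bsub>M\<^esub> d g x"
    if "g \<in> carrier G" "x \<in> carrier M" "r \<in> carrier R" for g x r
    unfolding d_def using that chik
    by (simp add: act_smult smult_minus smult_assoc1[symmetric] R.m_comm)
  have "gsubmodule Z R G M"
  proof (rule gsubmoduleI)
    show "Z \<subseteq> carrier M" using W_carrier by (auto simp: Z_def)
    show "\<zero>\<^bsub>M\<^esub> \<in> Z" using gsubmoduleD(2)[OF N] gsubmoduleD(2)[OF W] dN by (auto simp: Z_def)
    fix x y assume "x \<in> Z" "y \<in> Z"
    then show "x \<oplus>\<^bsub>M\<^esub> y \<in> Z"
      using gsubmoduleD(3)[OF W] gsubmoduleD(3)[OF N] by (auto simp: Z_def d_add W_carrier)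
  next
    fix r x assume "x \<in> Z" "r \<in> carrier R"
    then show "r \<odot>\<^bsub>M\<^esub> x \<in> Z"
      using gsubmoduleD(6)[OF W] gsubmoduleD(6)[OF N] by (auto simp: Z_def d_smult W_carrier)
  next
    fix h x assume h: "h \<in> carrier G" and x: "x \<in> Z"
    then have xW: "x \<in> W" and dx: "d h x \<in> N" by (auto simp: Z_def)
    have c: "\<chi> k h \<odot>\<^bsub>M\<^esub> x \<in> W" using gsubmoduleD(6)[OF W] chik h xW by simp
    have e: "act M h x = d h x \<oplus>\<^bsub>M\<^esub> \<chi> k h \<odot>\<^bsub>M\<^esub> x"
      unfolding d_def using h xW c by (simp add: minus_add_cancel W_carrier)
    have "d g (act M h x) \<in> N" if g: "g \<in> carrier G" for g
    proof -
      have "d g x \<in> N" using x g by (simp add: Z_def)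
      moreover have "d g (act M h x) = d g (d h x) \<oplus>\<^bsub>M\<^esub> \<chi> k h \<odot>\<^bsub>M\<^esub> d g x"
        unfolding e using g h xW c dx N_le_W by (subst d_add) (auto simp: d_smult chik W_carrier)
      ultimately show ?thesis using dN[OF g dx] gsubmoduleD(3,6)[OF N] chik h by simp
    qed
    then show "act M h x \<in> Z" using gsubmoduleD(7)[OF W h xW] by (simp add: Z_def)
  qed
  moreover have "N \<subseteq> Z" using N_le_W dN by (auto simp: Z_def)
  moreover have "Z \<subseteq> W" by (auto simp: Z_def)
  moreover have "x \<in> Z"
  proof -
    have "d g x \<in> N" if "g \<in> carrier G" for g
    proof -
      have "d g x \<in> Ms k" unfolding d_def by (rule step[OF k(1) that x(2)])
      moreover have "d g x \<in> W"
        unfolding d_def using gsubmoduleD(5-7)[OF W] chik that x(1) by simp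
      ultimately show ?thesis using k(2) by blast
    qed
    then show ?thesis using x(1) by (simp add: Z_def)
  qed
  ultimately have "Z = W" using max x(3) by blast
  then show ?thesis using that[OF k(1)] unfolding Z_def d_def by blast
qed

section \<open>Vanishing of first cohomology\<close>

text \<open>\<open>trivial_group\<close> asserts that H^1 is a group, so the cocycles have to form
  one; extensionality makes the laws hold as equations of functions.\<close>

lemma (in gmodule) group_crossed_homs: "group (crossed_homs G M)"
proof -
  have cl: "f g \<in> carrier M" if "f \<in> carrier (crossed_homs G M)" "g \<in> carrier G" for f g
    using that by (auto simp: crossed_homs_def)
  have cr: "f (g \<otimes>\<^bsub>G\<^esub> h) = f g \<oplus>\<^bsub>M\<^esub> act M g (f h)"
    if "f \<in> carrier (crossed_homs G M)" "g \<in> carrier G" "h \<in> carrier G" for f g h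
    using that by (auto simp: crossed_homs_def)
  have ex: "f g = undefined" if "f \<in> carrier (crossed_homs G M)" "g \<notin> carrier G" for f g
    using that by (auto simp: crossed_homs_def PiE_def extensional_def)
  have I: "(\<lambda>g\<in>carrier G. f g) \<in> carrier (crossed_homs G M)"
    if "\<And>g. g \<in> carrier G \<Longrightarrow> f g \<in> carrier M"
      "\<And>g h. g \<in> carrier G \<Longrightarrow> h \<in> carrier G \<Longrightarrow> f (g \<otimes>\<^bsub>G\<^esub> h) = f g \<oplus>\<^bsub>M\<^esub> act M g (f h)" for f
    using that by (auto simp: crossed_homs_def)
  have mul: "f \<otimes>\<^bsub>crossed_homs G M\<^esub> f' = (\<lambda>g\<in>carrier G. f g \<oplus>\<^bsub>M\<^esub> f' g)" for f f'
    by (simp add: crossed_homs_def)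
  have one: "\<one>\<^bsub>crossed_homs G M\<^esub> = (\<lambda>g\<in>carrier G. \<zero>\<^bsub>M\<^esub>)"
    by (simp add: crossed_homs_def)
  show ?thesis
  proof (rule groupI)
    fix x y assume "x \<in> carrier (crossed_homs G M)" "y \<in> carrier (crossed_homs G M)"
    then show "x \<otimes>\<^bsub>crossed_homs G M\<^esub> y \<in> carrier (crossed_homs G M)"
      unfolding mul by (intro I) (simp_all add: cl cr act_add M.a_ac)
  next
    show "\<one>\<^bsub>crossed_homs G M\<^esub> \<in> carrier (crossed_homs G M)"
      unfolding one by (intro I) simp_all
  next
    fix x assume x: "x \<in> carrier (crossed_homs G M)"
    show "\<one>\<^bsub>crossed_homs G M\<^esub> \<otimes>\<^bsub>crossed_homs G M\<^esub> x = x"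
      unfolding mul one by (rule ext) (simp add: cl[OF x] ex[OF x])
    have "(\<lambda>g\<in>carrier G. \<ominus>\<^bsub>M\<^esub> x g) \<in> carrier (crossed_homs G M)"
      using x by (intro I) (simp_all add: cl cr act_uminus M.minus_add)
    moreover have "(\<lambda>g\<in>carrier G. \<ominus>\<^bsub>M\<^esub> x g) \<otimes>\<^bsub>crossed_homs G M\<^esub> x = \<one>\<^bsub>crossed_homs G M\<^esub>"
      unfolding mul one by (rule ext) (simp add: cl[OF x] M.l_neg)
    ultimately show "\<exists>y\<in>carrier (crossed_homs G M). y \<otimes>\<^bsub>crossed_homs G M\<^esub> x = \<one>\<^bsub>crossed_homs G M\<^esub>"
      by blast
  next
    fix x y z
    assume "x \<in> carrier (crossed_homs G M)" "y \<in> carrier (crossed_homs G M)"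
      "z \<in> carrier (crossed_homs G M)"
    then show "x \<otimes>\<^bsub>crossed_homs G M\<^esub> y \<otimes>\<^bsub>crossed_homs G M\<^esub> z =
      x \<otimes>\<^bsub>crossed_homs G M\<^esub> (y \<otimes>\<^bsub>crossed_homs G M\<^esub> z)"
      unfolding mul by (intro ext) (simp add: cl M.a_assoc)
  qed
qed

lemma (in gmodule) trivial_H1I:
  assumes "\<And>f. \<lbrakk>\<And>g. g \<in> carrier G \<Longrightarrow> f g \<in> carrier M;
      \<And>g h. g \<in> carrier G \<Longrightarrow> h \<in> carrier G \<Longrightarrow> f (g \<otimes>\<^bsub>G\<^esub> h) = f g \<oplus>\<^bsub>M\<^esub> act M g (f h)\<rbrakk>
    \<Longrightarrow> \<exists>m\<in>carrier M. \<forall>g\<in>carrier G. f g = act M g m \<ominus>\<^bsub>M\<^esub> m"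
  shows "trivial_group (H1 G M)"
proof -
  interpret C: group "crossed_homs G M" by (rule group_crossed_homs)
  have "principal_crossed_homs G M = carrier (crossed_homs G M)"
  proof
    show "carrier (crossed_homs G M) \<subseteq> principal_crossed_homs G M"
    proof
      fix f assume f: "f \<in> carrier (crossed_homs G M)"
      then obtain m where m: "m \<in> carrier M" "\<forall>g\<in>carrier G. f g = act M g m \<ominus>\<^bsub>M\<^esub> m"
        using assms[of f] by (auto simp: crossed_homs_def)
      moreover have "f = (\<lambda>g\<in>carrier G. f g)"
        using f by (auto simp: crossed_homs_def PiE_def extensional_def)
      ultimately have "f = (\<lambda>g\<in>carrier G. act M g m \<ominus>\<^bsub>M\<^esub> m)"
        by (metis (no_types, lifting) restrict_ext)
      then show "f \<in> principal_crossed_homs G M"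
        using m(1) unfolding principal_crossed_homs_def by blast
    qed
    show "principal_crossed_homs G M \<subseteq> carrier (crossed_homs G M)"
      by (auto simp: principal_crossed_homs_def crossed_homs_def act_mult act_minus minus_telescope
          M.a_comm[of "act M _ _ \<ominus>\<^bsub>M\<^esub> _"])
  qed
  moreover have "carrier (crossed_homs G M Mod carrier (crossed_homs G M))
      = {carrier (crossed_homs G M)}"
    using C.one_closed by (auto simp: FactGroup_def RCOSETS_def C.coset_join2 C.subgroup_self)
  moreover have "group (crossed_homs G M Mod carrier (crossed_homs G M))"
    by (intro normal.factorgroup_is_group C.normal_self)
  ultimately show ?thesis
    unfolding H1_def trivial_group_def by (simp add: FactGroup_def)
qed

section \<open>Linear groups\<close>

lemma base_ring_simps [simp]:
  "carrier base_ring = UNIV" "\<zero>\<^bsub>base_ring\<^esub> = 0" "\<one>\<^bsub>base_ring\<^esub> = 1"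
  "x \<oplus>\<^bsub>base_ring\<^esub> y = x + y" "x \<otimes>\<^bsub>base_ring\<^esub> y = x * y"
  by (simp_all add: ring_of_type_algebra_def)

lemma GL_simps [simp]:
  "carrier (GL scale) = {g. Vector_Spaces.linear scale scale g \<and> bij g}"
  "g \<otimes>\<^bsub>GL scale\<^esub> h = g \<circ> h" "\<one>\<^bsub>GL scale\<^esub> = id"
  by (simp_all add: GL_def)

lemma standard_gmodule_simps [simp]:
  "carrier (standard_gmodule scale) = UNIV" "\<zero>\<^bsub>standard_gmodule scale\<^esub> = 0"
  "x \<oplus>\<^bsub>standard_gmodule scale\<^esub> y = x + y" "c \<odot>\<^bsub>standard_gmodule scale\<^esub> x = scale c x"
  "act (standard_gmodule scale) g x = g x"
  by (simp_all add: standard_gmodule_def)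

lemma End_gmodule_simps [simp]:
  "carrier (End_gmodule scale) = {f. Vector_Spaces.linear scale scale f}"
  "\<zero>\<^bsub>End_gmodule scale\<^esub> = (\<lambda>v. 0)"
  "f \<oplus>\<^bsub>End_gmodule scale\<^esub> f' = (\<lambda>v. f v + f' v)"
  "c \<odot>\<^bsub>End_gmodule scale\<^esub> f = (\<lambda>v. scale c (f v))"
  "act (End_gmodule scale) g f = g \<circ> f \<circ> inv\<^bsub>GL scale\<^esub> g"
  by (simp_all add: End_gmodule_def)

lemma character_gmodule_simps [simp]:
  "carrier (character_gmodule \<chi>) = UNIV" "\<zero>\<^bsub>character_gmodule \<chi>\<^esub> = 0"
  "x \<oplus>\<^bsub>character_gmodule \<chi>\<^esub> y = x + y" "c \<odot>\<^bsub>character_gmodule \<chi>\<^esub> x = c * x"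
  "act (character_gmodule \<chi>) g x = \<chi> g * x"
  by (simp_all add: character_gmodule_def)

lemma characters_iff:
  "\<chi> \<in> characters G \<longleftrightarrow> (\<forall>g\<in>carrier G. \<chi> g \<noteq> (0::'f::field)) \<and>
    (\<forall>g\<in>carrier G. \<forall>h\<in>carrier G. \<chi> (g \<otimes>\<^bsub>G\<^esub> h) = \<chi> g * \<chi> h)"
proof -
  have "carrier (units_of (base_ring :: 'f ring)) = {x. x \<noteq> 0}"
    by (auto simp: units_of_def Units_def) (metis left_inverse right_inverse)
  then show ?thesis by (auto simp: characters_def hom_def units_of_def)
qed

section \<open>Endomorphisms and the general linear group\<close>

abbreviation endo :: "('f::field \<Rightarrow> 'v::ab_group_add \<Rightarrow> 'v) \<Rightarrow> ('v \<Rightarrow> 'v) \<Rightarrow> bool" where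
  "endo scale \<equiv> Vector_Spaces.linear scale scale"

context vector_space
begin

lemmas endo_iff = Vector_Spaces.linear_iff[of scale scale]

lemma endo_simps:
  fixes x y :: 'b
  assumes "endo scale f"
  shows "f (x + y) = f x + f y" "f (c *s x) = c *s f x" "f (- x) = - f x" "f (x - y) = f x - f y"
proof -
  show 1: "f (x + y) = f x + f y" and 2: "f (c *s x) = c *s f x" for x y c
    using assms by (simp_all add: endo_iff)
  show 3: "f (- x) = - f x" for x using 2[of "- 1" x] by simp
  show "f (x - y) = f x - f y" using 1[of x "- y"] 3[of y] by simp
qed

lemma linear_comp: "endo scale f \<Longrightarrow> endo scale g \<Longrightarrow>
    endo scale (f \<circ> g)"
  by (simp add: endo_iff)

lemma linear_inv_into:
  assumes "endo scale f" "bij f"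
  shows "endo scale (inv_into UNIV f)"
proof -
  have "inv_into UNIV f (x + y) = inv_into UNIV f x + inv_into UNIV f y" for x y
    using assms by (intro inv_f_eq) (auto simp: endo_iff bij_is_inj bij_is_surj surj_f_inv_f)
  moreover have "inv_into UNIV f (scale c x) = scale c (inv_into UNIV f x)" for c x
    using assms by (intro inv_f_eq) (auto simp: endo_iff bij_is_inj bij_is_surj surj_f_inv_f)
  ultimately show ?thesis using assms(1) by (simp add: endo_iff)
qed

lemma group_GL: "group (GL scale)"
proof (rule groupI)
  fix x assume "x \<in> carrier (GL scale)"
  then show "\<exists>y\<in>carrier (GL scale). y \<otimes>\<^bsub>GL scale\<^esub> x = \<one>\<^bsub>GL scale\<^esub>"
    by (intro bexI[of _ "inv_into UNIV x"])
      (auto simp: linear_inv_into bij_imp_bij_inv bij_is_inj)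
qed (auto simp: linear_comp bij_comp comp_assoc endo_iff vector_space_axioms)

lemma inv_GL:
  assumes "g \<in> carrier (GL scale)"
  shows "inv\<^bsub>GL scale\<^esub> g = inv_into UNIV g"
  using assms by (intro group.inv_equality group_GL)
    (auto simp: linear_inv_into bij_imp_bij_inv bij_is_inj)

end

section \<open>The modules V and End V of a linear group\<close>

locale linear_group_rep = vector_space scale
  for scale :: "'f::field \<Rightarrow> 'v::ab_group_add \<Rightarrow> 'v" (infixr \<open>*s\<close> 75) +
  fixes G :: "('v \<Rightarrow> 'v) set"
  assumes G: "subgroup G (GL scale)"
begin

abbreviation "LG \<equiv> linear_group scale G"
abbreviation "V \<equiv> standard_gmodule scale"
abbreviation "E \<equiv> End_gmodule scale"
abbreviation "irreducible_V \<equiv> irreducible_gmodule base_ring LG V"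
abbreviation "common_factor \<equiv> common_composition_factor base_ring LG V E"

lemma in_GL: "g \<in> G \<Longrightarrow> g \<in> carrier (GL scale)"
  using subgroup.subset[OF G] by blast

lemma G_linear: "g \<in> G \<Longrightarrow> endo scale g"
  and G_bij: "g \<in> G \<Longrightarrow> bij g"
  using in_GL by auto

lemma G_add: "g \<in> G \<Longrightarrow> g (x + y) = g x + g y"
  and G_scale: "g \<in> G \<Longrightarrow> g (c *s x) = c *s g x"
  using G_linear by (auto simp: endo_iff)

lemma G_zero [simp]: "g \<in> G \<Longrightarrow> g 0 = 0"
  using G_scale[of g 0 0] by simp

lemma G_uminus: "g \<in> G \<Longrightarrow> g (- x) = - g x"
  using G_scale[of g "-1" x] by simp

lemma G_diff: "g \<in> G \<Longrightarrow> g (x - y) = g x - g y"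
  using G_add[of g x "- y"] G_uminus[of g y] by simp

lemma G_eq_0_iff [simp]: "g \<in> G \<Longrightarrow> g x = 0 \<longleftrightarrow> x = 0"
  by (metis G_bij G_zero bij_pointE)

lemma id_in_G: "id \<in> G"
  using subgroup.one_closed[OF G] by simp

lemma comp_in_G: "g \<in> G \<Longrightarrow> h \<in> G \<Longrightarrow> g \<circ> h \<in> G"
  using subgroup.m_closed[OF G] by simp

lemma inv_in_G: "g \<in> G \<Longrightarrow> inv_into UNIV g \<in> G"
  using subgroup.m_inv_closed[OF G] inv_GL[OF in_GL] by metis

lemma G_inv [simp]: "g \<in> G \<Longrightarrow> g (inv_into UNIV g x) = x" "g \<in> G \<Longrightarrow> inv_into UNIV g (g x) = x"
  using G_bij by (simp_all add: bij_is_surj surj_f_inv_f bij_is_inj)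

text \<open>The commutator is characterized by \<open>u \<circ> (h \<circ> g) = g \<circ> h\<close>,
  so that applying a character, a determinant or a cocycle involves no inverse.\<close>

lemma commutator_in_G:
  assumes "g \<in> G" "h \<in> G"
  obtains u where "u \<in> G" "u \<circ> (h \<circ> g) = g \<circ> h"
proof
  let ?u = "(g \<circ> h) \<circ> inv_into UNIV (h \<circ> g)"
  have hg: "h \<circ> g \<in> G" using assms by (simp add: comp_in_G)
  show "?u \<in> G" by (intro comp_in_G inv_in_G assms)
  show "?u \<circ> (h \<circ> g) = g \<circ> h" using G_inv(2)[OF hg] by (simp add: fun_eq_iff)
qed

lemma group_LG: "group LG"
  by (rule subgroup.subgroup_is_group[OF G group_GL])

lemma act_End: "g \<in> G \<Longrightarrow> act E g f = g \<circ> f \<circ> inv_into UNIV g"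
  by (simp add: inv_GL[OF in_GL])

lemma gmoduleI:
  fixes M :: "('f, 'b, 'v \<Rightarrow> 'v) gmodule"
  assumes "abelian_group M"
    and "\<And>a x. x \<in> carrier M \<Longrightarrow> a \<odot>\<^bsub>M\<^esub> x \<in> carrier M"
    and "\<And>a b x. x \<in> carrier M \<Longrightarrow> (a + b) \<odot>\<^bsub>M\<^esub> x = a \<odot>\<^bsub>M\<^esub> x \<oplus>\<^bsub>M\<^esub> b \<odot>\<^bsub>M\<^esub> x"
    and "\<And>a x y. x \<in> carrier M \<Longrightarrow> y \<in> carrier M \<Longrightarrow>
      a \<odot>\<^bsub>M\<^esub> (x \<oplus>\<^bsub>M\<^esub> y) = a \<odot>\<^bsub>M\<^esub> x \<oplus>\<^bsub>M\<^esub> a \<odot>\<^bsub>M\<^esub> y"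
    and "\<And>a b x. x \<in> carrier M \<Longrightarrow> (a * b) \<odot>\<^bsub>M\<^esub> x = a \<odot>\<^bsub>M\<^esub> (b \<odot>\<^bsub>M\<^esub> x)"
    and "\<And>x. x \<in> carrier M \<Longrightarrow> 1 \<odot>\<^bsub>M\<^esub> x = x"
    and "\<And>g x. g \<in> G \<Longrightarrow> x \<in> carrier M \<Longrightarrow> act M g x \<in> carrier M"
    and "\<And>g x y. g \<in> G \<Longrightarrow> x \<in> carrier M \<Longrightarrow> y \<in> carrier M \<Longrightarrow>
      act M g (x \<oplus>\<^bsub>M\<^esub> y) = act M g x \<oplus>\<^bsub>M\<^esub> act M g y"
    and "\<And>g r x. g \<in> G \<Longrightarrow> x \<in> carrier M \<Longrightarrow> act M g (r \<odot>\<^bsub>M\<^esub> x) = r \<odot>\<^bsub>M\<^esub> act M g x"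
    and "\<And>x. x \<in> carrier M \<Longrightarrow> act M id x = x"
    and "\<And>g h x. g \<in> G \<Longrightarrow> h \<in> G \<Longrightarrow> x \<in> carrier M \<Longrightarrow> act M (g \<circ> h) x = act M g (act M h x)"
  shows "gmodule base_ring LG M"
proof -
  have "module base_ring M"
    by (rule moduleI[OF cring_from_type_algebra assms(1)]) (use assms in simp_all)
  then show ?thesis
    by (intro gmodule.intro gmodule_axioms.intro group_LG) (use assms in \<open>auto simp: hom_def\<close>)
qed

lemma gmodule_V: "gmodule base_ring LG V"
proof (rule gmoduleI)
  show "abelian_group V"
    by (rule abelian_groupI) (auto simp: add_ac intro: exI[of _ "- _"] left_minus)
qed (auto simp: scale_left_distrib scale_right_distrib G_add G_scale)

lemma gmodule_E: "gmodule base_ring LG E"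
proof (rule gmoduleI)
  show "abelian_group E"
  proof (rule abelian_groupI)
    fix f assume f: "f \<in> carrier E"
    show "\<exists>f'\<in>carrier E. f' \<oplus>\<^bsub>E\<^esub> f = \<zero>\<^bsub>E\<^esub>"
      using f by (intro bexI[of _ "\<lambda>v. - f v"]) (simp_all add: endo_iff)
  qed (auto simp: endo_iff vector_space_axioms add_ac scale_right_distrib)
next
  fix g f assume "g \<in> G" "f \<in> carrier E"
  then show "act E g f \<in> carrier E"
    unfolding act_End[OF \<open>g \<in> G\<close>] using G_linear inv_in_G by (simp add: linear_comp)
next
  fix g h f assume "g \<in> G" "h \<in> G" "f \<in> carrier E"
  then show "act E (g \<circ> h) f = act E g (act E h f)"
    using group.inv_mult_group[OF group_GL in_GL in_GL, of g h] by (simp add: comp_assoc)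
next
  fix f assume "f \<in> carrier E"
  then show "act E id f = f" unfolding act_End[OF id_in_G] by simp
qed (auto simp: endo_iff scale_left_distrib scale_right_distrib G_add G_scale fun_eq_iff
    act_End mult.commute)

lemma gmodule_character:
  fixes \<chi> :: "('v \<Rightarrow> 'v) \<Rightarrow> 'f"
  assumes "\<chi> \<in> characters LG"
  shows "gmodule base_ring LG (character_gmodule \<chi>)"
proof (rule gmoduleI)
  have nz: "\<chi> g \<noteq> 0" if "g \<in> G" for g using assms that by (simp add: characters_iff)
  have hom: "\<chi> (g \<circ> h) = \<chi> g * \<chi> h" if "g \<in> G" "h \<in> G" for g h
    using assms that by (simp add: characters_iff)
  have "\<chi> id = 1" using hom[OF id_in_G id_in_G] nz[OF id_in_G] by simp
  then show "act (character_gmodule \<chi>) id x = x" for x by simp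
  show "abelian_group (character_gmodule \<chi>)"
    by (rule abelian_groupI) (auto simp: add_ac intro: exI[of _ "- _"] left_minus)
  show "act (character_gmodule \<chi>) (g \<circ> h) x = act (character_gmodule \<chi>) g (act (character_gmodule \<chi>) h x)"
    if "g \<in> G" "h \<in> G" for g h x using hom that by simp
qed (auto simp: algebra_simps)

lemma minus_V [simp]: "x \<ominus>\<^bsub>V\<^esub> y = x - y"
proof -
  interpret V: gmodule base_ring LG V by (rule gmodule_V)
  have "\<ominus>\<^bsub>V\<^esub> y = - y" using V.M.minus_equality[of "- y" y] by simp
  then show ?thesis by (simp add: V.M.minus_eq)
qed

lemma minus_E:
  assumes "endo scale f'"
  shows "f \<ominus>\<^bsub>E\<^esub> f' = (\<lambda>v. f v - f' v)"
proof -
  interpret E: gmodule base_ring LG E by (rule gmodule_E)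
  have "\<ominus>\<^bsub>E\<^esub> f' = (\<lambda>v. - f' v)"
    using E.M.minus_equality[of "\<lambda>v. - f' v" f'] assms by (simp add: endo_iff)
  then show ?thesis by (simp add: a_minus_def)
qed

lemma gsubmodule_V_iff:
  "gsubmodule W base_ring LG V \<longleftrightarrow> 0 \<in> W \<and> (\<forall>x\<in>W. \<forall>y\<in>W. x + y \<in> W) \<and> (\<forall>c. \<forall>x\<in>W. c *s x \<in> W) \<and>
    (\<forall>g\<in>G. \<forall>x\<in>W. g x \<in> W)"
proof -
  interpret V: gmodule base_ring LG V by (rule gmodule_V)
  show ?thesis
    using V.gsubmoduleD[of W] by (auto intro!: V.gsubmoduleI)
qed

lemma irreducible_V_iff:
  "irreducible_V \<longleftrightarrow> (\<exists>v::'v. v \<noteq> 0) \<and>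
    (\<forall>W. gsubmodule W base_ring LG V \<longrightarrow> W = {0} \<or> W = UNIV)"
  unfolding irreducible_gmodule_def by auto

lemma trivial_H1_V:
  assumes "\<And>f. (\<And>g h. g \<in> G \<Longrightarrow> h \<in> G \<Longrightarrow> f (g \<circ> h) = f g + g (f h)) \<Longrightarrow> \<exists>m. \<forall>g\<in>G. f g = g m - m"
  shows "trivial_group (H1 LG V)"
proof -
  interpret V: gmodule base_ring LG V by (rule gmodule_V)
  show ?thesis by (rule V.trivial_H1I) (use assms in auto)
qed

text \<open>A central element acting on \<open>V\<close> without fixed points kills cohomology, and it separates \<open>V\<close>
  from \<open>End V\<close>, on which scalars act trivially.\<close>

lemma scalar_trivial_H1:
  assumes z: "(\<lambda>v. c *s v) \<in> G" and c: "c \<noteq> 1"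
  shows "trivial_group (H1 LG V)"
proof (rule trivial_H1_V)
  fix f assume f: "\<And>g h. g \<in> G \<Longrightarrow> h \<in> G \<Longrightarrow> f (g \<circ> h) = f g + g (f h)"
  let ?z = "\<lambda>v. c *s v"
  \<comment> \<open>Comparing the cocycle identity at \<open>?z \<circ> g\<close> and at
    \<open>g \<circ> ?z\<close> gives \<open>(c - 1) *s f g = g (f ?z) - f ?z\<close>, which
    dictates the coboundary.\<close>
  have "f g = g (inverse (c - 1) *s f ?z) - inverse (c - 1) *s f ?z" if g: "g \<in> G" for g
  proof -
    have "?z \<circ> g = g \<circ> ?z" using G_scale[OF g] by (simp add: fun_eq_iff)
    then have "f ?z + c *s f g = f g + g (f ?z)" using f[OF z g] f[OF g z] by simp
    then have "(c - 1) *s f g = g (f ?z) - f ?z" by (simp add: scale_left_diff_distrib algebra_simps)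
    then have "inverse (c - 1) *s (c - 1) *s f g = inverse (c - 1) *s (g (f ?z) - f ?z)" by simp
    then show ?thesis using c g by (simp add: G_scale scale_right_diff_distrib)
  qed
  then show "\<exists>m. \<forall>g\<in>G. f g = g m - m" by blast
qed

lemma scalar_not_common:
  assumes z: "(\<lambda>v. c *s v) \<in> G" and c: "c \<noteq> 1"
  shows "\<not> common_factor"
proof
  assume "common_factor"
  then obtain W N W' N' where 1: "gsubquotient base_ring LG V W N"
    and 2: "gsubquotient base_ring LG E W' N'"
    and irr: "irreducible_gmodule base_ring LG (subquotient_gmodule V W N)"
    and iso: "gmodule_isomorphic base_ring LG (subquotient_gmodule V W N) (subquotient_gmodule E W' N')"
    by (rule common_factorE[OF _ gmodule_V gmodule_E])
  interpret A: gsubquotient base_ring LG V W N by fact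
  interpret B: gsubquotient base_ring LG E W' N' by fact
  let ?z = "\<lambda>v. c *s v"
  have trivial: "act E ?z f = f" if "f \<in> W'" for f
  proof -
    have "f \<in> carrier E" by (rule B.W_carrier) fact
    then have "f (c *s v) = c *s f v" for v by (simp add: endo_iff)
    moreover have "c *s inv_into UNIV ?z v = v" for v using G_inv(1)[OF z, of v] .
    ultimately show ?thesis unfolding act_End[OF z] by (metis comp_apply ext)
  qed
  have "x \<in> N" if "x \<in> W" for x
  proof -
    \<comment> \<open>\<open>[-1, 1]\<close> stands for \<open>?z - 1\<close>, which kills End V and
      is multiplication by \<open>c - 1\<close> on V.\<close>
    have "poly_act V ?z [-1, 1] x \<in> N"
    proof (rule annihilator_transfer[OF 1 2 iso _ _ _ that])
      fix y assume y: "y \<in> W'"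
      have "poly_act E ?z [-1, 1] y = (\<lambda>v. 0)"
        using trivial[OF y] B.act_zero[of ?z] z by (simp add: fun_eq_iff)
      then show "poly_act E ?z [-1, 1] y \<in> N'" using B.gsubmoduleD(2)[OF B.N] by simp
    qed (use z in auto)
    then have "(c - 1) *s x \<in> N" by (simp add: scale_left_diff_distrib)
    then have "inverse (c - 1) \<odot>\<^bsub>V\<^esub> ((c - 1) *s x) \<in> N"
      by (intro A.gsubmoduleD(6)[OF A.N]) simp_all
    moreover have "inverse (c - 1) * (c - 1) = 1" using c by simp
    ultimately show ?thesis by simp
  qed
  then show False using irr A.irreducible_sq_iff A.N_le_W by blast
qed

text \<open>Summing \<open>f (g \<circ> h) = f g + g (f h)\<close> over \<open>h\<close> gives
  \<open>s = n *s f g + g s\<close> for the total \<open>s\<close>, so \<open>f\<close> is the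
  coboundary of \<open>- s / n\<close>.\<close>

lemma averaging_trivial_H1:
  assumes "finite G" "of_nat (card G) \<noteq> (0 :: 'f)"
  shows "trivial_group (H1 LG V)"
proof (rule trivial_H1_V)
  fix f assume f: "\<And>g h. g \<in> G \<Longrightarrow> h \<in> G \<Longrightarrow> f (g \<circ> h) = f g + g (f h)"
  define n where "n = (of_nat (card G) :: 'f)"
  define s where "s = (\<Sum>h\<in>G. f h)"
  have "f g = g (- inverse n *s s) - (- inverse n *s s)" if g: "g \<in> G" for g
  proof -
    have "bij_betw (\<lambda>h. g \<circ> h) G G"
      by (rule bij_betw_byWitness[where f' = "\<lambda>h. inv_into UNIV g \<circ> h"])
        (use g inv_in_G comp_in_G in \<open>auto simp: fun_eq_iff\<close>)
    then have "s = (\<Sum>h\<in>G. f (g \<circ> h))"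
      unfolding s_def by (rule sum.reindex_bij_betw[symmetric])
    also have "\<dots> = (\<Sum>h\<in>G. f g) + (\<Sum>h\<in>G. g (f h))" using f[OF g] by (simp add: sum.distrib)
    also have "(\<Sum>h\<in>G. f g) = n *s f g" unfolding n_def by (rule sum_constant_scale)
    also have "(\<Sum>h\<in>G. g (f h)) = g s"
      unfolding s_def using assms(1) by (induction rule: finite_induct) (use g in \<open>auto simp: G_add\<close>)
    finally have "n *s f g = s - g s" by (metis add_diff_cancel_right')
    then have "inverse n *s n *s f g = inverse n *s (s - g s)" by simp
    then show ?thesis
      using assms(2) g by (simp add: n_def G_scale G_uminus scale_right_diff_distrib)
  qed
  then show "\<exists>m. \<forall>g\<in>G. f g = g m - m" by blast
qed

end

section \<open>Planes with a basis\<close>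

text \<open>The coordinates are parameters beside the basis, with linearity and
  \<open>expand\<close> as axioms. Equations between vectors and maps then become polynomial
  identities in the field.\<close>

locale plane_frame = vector_space scale
  for scale :: "'f::field \<Rightarrow> 'v::ab_group_add \<Rightarrow> 'v" (infixr \<open>*s\<close> 75) +
  fixes e1 e2 :: 'v and cx cy :: "'v \<Rightarrow> 'f"
  assumes cx_add: "cx (u + v) = cx u + cx v" and cx_scale: "cx (c *s v) = c * cx v"
    and cy_add: "cy (u + v) = cy u + cy v" and cy_scale: "cy (c *s v) = c * cy v"
    and cx_basis: "cx e1 = 1" "cx e2 = 0" and cy_basis: "cy e1 = 0" "cy e2 = 1"
    and expand: "cx v *s e1 + cy v *s e2 = v"
begin

lemma coord_zero: "cx 0 = 0" "cy 0 = 0"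
  using cx_scale[of 0 0] cy_scale[of 0 0] by simp_all

lemma coord_uminus: "cx (- v) = - cx v" "cy (- v) = - cy v"
  using cx_scale[of "-1" v] cy_scale[of "-1" v] by simp_all

lemma coord_diff: "cx (u - v) = cx u - cx v" "cy (u - v) = cy u - cy v"
  using cx_add[of u "- v"] cy_add[of u "- v"] by (simp_all add: coord_uminus)

lemmas coord_simps [simp] = cx_add cx_scale cy_add cy_scale cx_basis cy_basis
  coord_zero coord_uminus coord_diff

lemma eq_iff: "u = v \<longleftrightarrow> cx u = cx v \<and> cy u = cy v"
  by (metis expand)

lemma e1_nz: "e1 \<noteq> 0"
  by (simp add: eq_iff)

lemma coord_linear:
  assumes "endo scale f"
  shows "cx (f v) = cx v * cx (f e1) + cy v * cx (f e2)"
    and "cy (f v) = cx v * cy (f e1) + cy v * cy (f e2)"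
proof -
  have "f v = cx v *s f e1 + cy v *s f e2"
    using assms expand[of v] unfolding endo_iff by metis
  then show "cx (f v) = cx v * cx (f e1) + cy v * cx (f e2)"
    "cy (f v) = cx v * cy (f e1) + cy v * cy (f e2)" by simp_all
qed

lemma linear_eqI:
  assumes "endo scale f" "endo scale g"
    and "f e1 = g e1" "f e2 = g e2"
  shows "f = g"
proof
  fix v
  show "f v = g v"
    unfolding eq_iff coord_linear[OF assms(1), of v] coord_linear[OF assms(2), of v] assms(3,4) by simp
qed

section \<open>Trace and determinant in a frame\<close>

definition lin :: "'v \<Rightarrow> 'v \<Rightarrow> 'v \<Rightarrow> 'v" where
  "lin a b v = cx v *s a + cy v *s b"

lemma linear_lin: "endo scale (lin a b)"
  by (simp add: endo_iff lin_def vector_space_axioms algebra_simps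
      scale_left_distrib scale_right_distrib)

lemma lin_basis [simp]: "lin a b e1 = a" "lin a b e2 = b"
  by (simp_all add: lin_def)

definition tr :: "('v \<Rightarrow> 'v) \<Rightarrow> 'f" where
  "tr f = cx (f e1) + cy (f e2)"

definition dt :: "('v \<Rightarrow> 'v) \<Rightarrow> 'f" where
  "dt f = cx (f e1) * cy (f e2) - cx (f e2) * cy (f e1)"

lemma tr_id [simp]: "tr id = 2" and dt_id [simp]: "dt id = 1"
  by (simp_all add: tr_def dt_def)

lemma cayley_hamilton:
  assumes "endo scale f"
  shows "f (f v) = tr f *s f v - dt f *s v"
  unfolding eq_iff coord_diff coord_linear[OF assms, of "f v"] coord_linear[OF assms, of v]
    coord_linear[OF assms, of "f e1"] coord_linear[OF assms, of "f e2"] cx_scale cy_scale tr_def dt_def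
  by (simp add: algebra_simps)

lemma dt_comp:
  assumes "endo scale f"
  shows "dt (f \<circ> g) = dt f * dt g"
  unfolding dt_def comp_def coord_linear[OF assms, of "g e1"] coord_linear[OF assms, of "g e2"]
  by (simp add: algebra_simps)

lemma tr_comp:
  assumes "endo scale f"
  shows "tr (f \<circ> g) = cx (f e1) * cx (g e1) + cx (f e2) * cy (g e1) +
    cy (f e1) * cx (g e2) + cy (f e2) * cy (g e2)"
  unfolding tr_def comp_def coord_linear[OF assms, of "g e1"] coord_linear[OF assms, of "g e2"]
  by (simp add: algebra_simps)

lemma dt_inv:
  assumes "endo scale f" "f \<circ> f' = id"
  shows "dt f * dt f' = 1"
  using dt_comp[OF assms(1), of f'] assms(2) by simp

text \<open>Cayley-Hamilton at \<open>f' v\<close>. It expresses the inverse linearly through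
  \<open>f\<close>, without dividing by the determinant.\<close>

lemma adjugate:
  assumes f: "endo scale f" and ff': "\<And>v. f (f' v) = v"
    and f': "endo scale f'"
  shows "dt f *s f' v = tr f *s v - f v"
proof -
  have "f v = tr f *s v - dt f *s f' v"
    using cayley_hamilton[OF f, of "f' v"] ff' by simp
  then show ?thesis by simp
qed

text \<open>For determinant 1 the adjugate formula reads \<open>g + g' = tr g\<close>; compose with
  \<open>f\<close> and take traces.\<close>

lemma trace_identity:
  assumes f: "endo scale f" and g: "endo scale g"
    and g': "endo scale g'" and gg': "\<And>v. g (g' v) = v" and "dt g = 1"
  shows "tr (f \<circ> g) + tr (f \<circ> g') = tr f * tr g"
proof -
  have a: "g' v = tr g *s v - g v" for v using adjugate[OF g gg' g', of v] assms(5) by simp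
  show ?thesis unfolding tr_comp[OF f] a by (simp add: tr_def algebra_simps)
qed

lemma eigenvalue_root:
  assumes "endo scale f" "f v = c *s v" "v \<noteq> 0"
  shows "c * c - tr f * c + dt f = 0"
proof -
  have "f (f v) = (c * c) *s v" using assms by (simp add: endo_iff)
  then have "(c * c) *s v = tr f *s c *s v - dt f *s v"
    using cayley_hamilton[OF assms(1), of v] assms(2) by simp
  then have "(c * c - tr f * c + dt f) *s v = 0"
    by (simp add: scale_left_distrib scale_left_diff_distrib)
  then show ?thesis using assms(3) by simp
qed

text \<open>A vector orthogonal to a nonzero row of the matrix is killed by that row, and by the
  other one because the determinant vanishes.\<close>

lemma kernel_exists:
  assumes "endo scale f" "dt f = 0"
  shows "\<exists>v. v \<noteq> 0 \<and> f v = 0"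
proof -
  let ?a = "cx (f e1)" and ?b = "cx (f e2)" and ?c = "cy (f e1)" and ?d = "cy (f e2)"
  have *: "f (s *s e1 + t *s e2) = 0 \<longleftrightarrow> s * ?a + t * ?b = 0 \<and> s * ?c + t * ?d = 0" for s t
    unfolding eq_iff[of _ 0] coord_linear[OF assms(1), of "s *s e1 + t *s e2"] by simp
  have nz: "s *s e1 + t *s e2 = 0 \<longleftrightarrow> s = 0 \<and> t = 0" for s t by (simp add: eq_iff)
  have d: "?a * ?d = ?b * ?c" using assms(2) by (simp add: dt_def)
  consider "?a \<noteq> 0 \<or> ?b \<noteq> 0" | "?c \<noteq> 0 \<or> ?d \<noteq> 0" | "f e1 = 0" by (auto simp: eq_iff)
  then show ?thesis
  proof cases
    case 1
    have "f (?b *s e1 + (- ?a) *s e2) = 0" unfolding * using d by (simp add: algebra_simps)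
    then show ?thesis using 1 nz[of ?b "- ?a"] by (metis neg_equal_0_iff_equal)
  next
    case 2
    have "f (?d *s e1 + (- ?c) *s e2) = 0" unfolding * using d by (simp add: algebra_simps)
    then show ?thesis using 2 nz[of ?d "- ?c"] by (metis neg_equal_0_iff_equal)
  next
    case 3
    then show ?thesis using e1_nz by blast
  qed
qed

lemma dt_char_poly:
  assumes "endo scale f"
  shows "dt (\<lambda>v. f v - c *s v) = c * c - tr f * c + dt f"
  by (simp add: dt_def tr_def algebra_simps)

lemma eigenvector_exists:
  assumes f: "endo scale f" and "c * c - tr f * c + dt f = 0"
  shows "\<exists>v. v \<noteq> 0 \<and> f v = c *s v"
proof -
  have "endo scale (\<lambda>v. f v - c *s v)"
    using f by (simp add: endo_iff algebra_simps scale_right_distrib scale_right_diff_distrib)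
  from kernel_exists[OF this] show ?thesis
    using dt_char_poly[OF f] assms(2) by simp
qed

lemma bij_dt_nz:
  assumes f: "endo scale f" and "bij f"
  shows "dt f \<noteq> 0"
proof
  assume "dt f = 0"
  then obtain v where "v \<noteq> 0" "f v = 0" using kernel_exists[OF f] by blast
  moreover have "f 0 = 0" using f unfolding endo_iff by (metis scale_zero_left)
  ultimately show False using assms(2) by (metis bij_pointE)
qed

lemma span_e1: "span {e1} = {v. cy v = 0}"
proof -
  have "v = cx v *s e1" if "cy v = 0" for v using that by (simp add: eq_iff)
  then show ?thesis by (auto simp: span_singleton)
qed

end

section \<open>Existence of frames\<close>

context vector_space
begin

text \<open>Two independent vectors span a plane, and the coefficients picked by \<open>SOME\<close>
  are linear because they are unique.\<close>

lemma frame_of_basis: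
  assumes dim: "dim UNIV = 2" and e1: "e1 \<noteq> 0" and e2: "e2 \<notin> span {e1}"
  shows "\<exists>cx cy. plane_frame scale e1 e2 cx cy"
proof -
  obtain B where B: "independent B" "UNIV \<subseteq> span B" "card B = 2"
    using basis_exists[of UNIV] dim by metis
  interpret F: finite_dimensional_vector_space scale B
    using B by unfold_locales (auto intro: card_ge_0_finite)
  have ind: "independent {e2, e1}" and ne: "e1 \<noteq> e2"
    using e1 e2 by (auto simp: independent_insert dependent_single span_base)
  have "UNIV \<subseteq> span {e2, e1}"
    by (rule F.card_ge_dim_independent) (use ind ne dim in auto)
  then have ex: "\<exists>ab. v = fst ab *s e1 + snd ab *s e2" for v
    by (force simp: span_insert span_singleton algebra_simps)
  define c where "c v = (SOME ab. v = fst ab *s e1 + snd ab *s e2)" for v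
  have c: "v = fst (c v) *s e1 + snd (c v) *s e2" for v
    unfolding c_def by (rule someI_ex) (rule ex)
  have z: "a = 0 \<and> b = 0" if "a *s e1 + b *s e2 = 0" for a b
  proof -
    have "b = 0"
    proof (rule ccontr)
      assume "b \<noteq> 0"
      have "b *s e2 = (- a) *s e1" using that by (simp add: eq_neg_iff_add_eq_0 add.commute)
      then have "inverse b *s b *s e2 = inverse b *s (- a) *s e1" by simp
      then have "e2 = (inverse b * (- a)) *s e1" using \<open>b \<noteq> 0\<close> by simp
      then have "e2 \<in> span {e1}" by (metis span_base span_scale singletonI)
      then show False using e2 by blast
    qed
    then show ?thesis using that e1 by simp
  qed
  have u: "fst (c v) = a" "snd (c v) = b" if "v = a *s e1 + b *s e2" for v a b
  proof -
    have "(fst (c v) - a) *s e1 + (snd (c v) - b) *s e2 = 0"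
      using c[of v] that by (simp add: scale_left_diff_distrib algebra_simps)
    from z[OF this] show "fst (c v) = a" "snd (c v) = b" by simp_all
  qed
  have "plane_frame scale e1 e2 (\<lambda>v. fst (c v)) (\<lambda>v. snd (c v))"
  proof
    fix v w :: 'b and k
    have "v + w = (fst (c v) + fst (c w)) *s e1 + (snd (c v) + snd (c w)) *s e2"
      using c[of v] c[of w] by (simp add: scale_left_distrib algebra_simps)
    then show "fst (c (v + w)) = fst (c v) + fst (c w)" "snd (c (v + w)) = snd (c v) + snd (c w)"
      using u by blast+
    have "k *s v = (k * fst (c v)) *s e1 + (k * snd (c v)) *s e2"
      using c[of v] by (metis scale_right_distrib scale_scale)
    then show "fst (c (k *s v)) = k * fst (c v)" "snd (c (k *s v)) = k * snd (c v)"
      using u by blast+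
    show "fst (c v) *s e1 + snd (c v) *s e2 = v" using c by metis
  qed (use u[of e1 1 0] u[of e2 0 1] in auto)
  then show ?thesis by blast
qed

lemma frame_exists:
  assumes dim: "dim UNIV = 2" and e1: "e1 \<noteq> 0"
  shows "\<exists>e2 cx cy. plane_frame scale e1 e2 cx cy"
proof -
  have "\<exists>e2. e2 \<notin> span {e1}"
  proof (rule ccontr)
    assume "\<not> ?thesis"
    then have "dim UNIV \<le> card {e1}" by (intro dim_le_card) auto
    then show False using dim by simp
  qed
  then show ?thesis using frame_of_basis[OF dim e1] by blast
qed

lemma ex_nonzero: "dim UNIV = 2 \<Longrightarrow> \<exists>v::'b. v \<noteq> 0"
proof (rule ccontr)
  assume "dim UNIV = 2" "\<not> (\<exists>v::'b. v \<noteq> 0)"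
  then have "UNIV \<subseteq> span {}" by (simp add: subset_iff)
  then show False using dim_le_card[of UNIV "{}"] \<open>dim UNIV = 2\<close> by simp
qed

end

section \<open>Planes over a prime field\<close>

locale plane_group = linear_group_rep scale G
  for scale :: "'f::field \<Rightarrow> 'v::ab_group_add \<Rightarrow> 'v" (infixr \<open>*s\<close> 75) and G +
  fixes p :: nat
  assumes p: "Factorial_Ring.prime p" and card_f: "CARD('f) = p" and dim: "dim UNIV = 2"
begin

lemma finite_field: "finite (UNIV :: 'f set)"
  using card_f p by (metis card.infinite not_prime_0)

text \<open>Translation by 1 permutes the finite field, so comparing sums over all elements gives
  \<open>of_nat p = 0\<close>; the characteristic is then a divisor of \<open>p\<close> other than
  1.\<close>

lemma of_nat_eq_0_iff_p: "of_nat n = (0 :: 'f) \<longleftrightarrow> p dvd n"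
proof -
  have "(\<Sum>x\<in>UNIV. x :: 'f) = (\<Sum>x\<in>UNIV. x + 1)"
    by (rule sum.reindex_bij_betw[symmetric]) (rule bij_betw_byWitness[where f' = "\<lambda>x. x - 1"], auto)
  then have "of_nat p = (0 :: 'f)" by (simp add: sum.distrib card_f)
  then have "CHAR('f) dvd p" by (simp add: of_nat_eq_0_iff_char_dvd)
  moreover have "CHAR('f) \<noteq> 1" using of_nat_CHAR[where 'a = 'f] by (metis of_nat_1 zero_neq_one)
  ultimately have "CHAR('f) = p" using p unfolding prime_nat_iff by blast
  then show ?thesis by (simp add: of_nat_eq_0_iff_char_dvd)
qed

text \<open>Every scalar is a multiple of 1, so the powers of one transvection realize all multiples
  of its off-diagonal entry. The arguments with unipotent elements rest on this.\<close>

lemma of_nat_surj: "\<exists>k. of_nat k = (r :: 'f)"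
proof -
  have "inj_on (of_nat :: nat \<Rightarrow> 'f) {..<p}"
  proof (rule linorder_inj_onI)
    fix i j assume ij: "i < j" "i \<in> {..<p}" "j \<in> {..<p}"
    show "(of_nat i :: 'f) \<noteq> of_nat j"
    proof
      assume "(of_nat i :: 'f) = of_nat j"
      then have "of_nat (j - i) = (0 :: 'f)" using ij(1) by (simp add: of_nat_diff)
      then have "p dvd j - i" by (simp add: of_nat_eq_0_iff_p)
      then show False using ij by (auto dest: dvd_imp_le)
    qed
  qed auto
  then have "card ((of_nat :: nat \<Rightarrow> 'f) ` {..<p}) = card (UNIV :: 'f set)"
    by (simp add: card_image card_f)
  then have "(of_nat :: nat \<Rightarrow> 'f) ` {..<p} = UNIV"
    using finite_field by (intro card_subset_eq) auto
  then show ?thesis by (metis UNIV_I imageE)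
qed

lemma frame_ex: "\<exists>e1 e2 cx cy. plane_frame scale e1 e2 cx cy"
  using ex_nonzero[OF dim] frame_exists[OF dim] by blast

lemma finite_carrier_V: "finite (carrier V)"
proof -
  obtain e1 e2 cx cy where "plane_frame scale e1 e2 cx cy" using frame_ex by blast
  then interpret plane_frame scale e1 e2 cx cy .
  have "(UNIV :: 'v set) \<subseteq> (\<lambda>(a, b). a *s e1 + b *s e2) ` (UNIV \<times> UNIV)"
  proof
    fix v :: 'v
    show "v \<in> (\<lambda>(a, b). a *s e1 + b *s e2) ` (UNIV \<times> UNIV)"
      using expand[of v] by (intro image_eqI[of _ _ "(cx v, cy v)"]) simp_all
  qed
  moreover have "finite ((UNIV :: 'f set) \<times> (UNIV :: 'f set))" using finite_field by blast
  ultimately show ?thesis by (simp add: finite_surj)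
qed

lemma finite_carrier_E: "finite (carrier E)"
proof -
  obtain e1 e2 cx cy where "plane_frame scale e1 e2 cx cy" using frame_ex by blast
  then interpret plane_frame scale e1 e2 cx cy .
  have "carrier E \<subseteq> (\<lambda>(a, b). lin a b) ` (UNIV \<times> UNIV)"
  proof
    fix f assume "f \<in> carrier E"
    then have "f = lin (f e1) (f e2)" by (intro linear_eqI linear_lin) simp_all
    then show "f \<in> (\<lambda>(a, b). lin a b) ` (UNIV \<times> UNIV)"
      by (intro image_eqI[of _ _ "(f e1, f e2)"]) simp_all
  qed
  moreover have "finite ((UNIV :: 'v set) \<times> (UNIV :: 'v set))" using finite_carrier_V by (intro finite_cartesian_product) simp_all
  ultimately show ?thesis by (rule finite_surj[rotated])
qed

lemma finite_G: "finite G"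
  using finite_carrier_E by (rule rev_finite_subset) (use G_linear in auto)

text \<open>\<open>e2\<close> is taken outside the whole submodule \<open>W\<close>, which contains
  \<open>e1\<close>: a nonzero \<open>e2\<close>-coordinate of \<open>g e1\<close> would bring
  \<open>e2\<close> into \<open>W\<close>.\<close>

lemma reducible_frame:
  assumes "\<not> irreducible_V"
  shows "\<exists>e1 e2 cx cy. plane_frame scale e1 e2 cx cy \<and> (\<forall>g\<in>G. cy (g e1) = 0)"
proof -
  obtain W where W: "gsubmodule W base_ring LG V" "W \<noteq> {0}" "W \<noteq> UNIV"
    using assms ex_nonzero[OF dim] unfolding irreducible_V_iff by blast
  note W' = W(1)[unfolded gsubmodule_V_iff]
  obtain e1 where e1: "e1 \<in> W" "e1 \<noteq> 0" using W(2) W' by blast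
  obtain e2 where e2: "e2 \<notin> W" using W(3) by blast
  have "span {e1} \<subseteq> W" using W' e1(1) by (auto simp: span_singleton)
  then obtain cx cy where fr: "plane_frame scale e1 e2 cx cy"
    using frame_of_basis[OF dim e1(2), of e2] e2 by blast
  then interpret plane_frame scale e1 e2 cx cy .
  have "cy (g e1) = 0" if "g \<in> G" for g
  proof (rule ccontr)
    assume nz: "cy (g e1) \<noteq> 0"
    have "g e1 + (- cx (g e1)) *s e1 \<in> W" using W' that e1(1) by blast
    moreover have "g e1 + (- cx (g e1)) *s e1 = cy (g e1) *s e2" by (simp add: eq_iff)
    ultimately have "inverse (cy (g e1)) *s cy (g e1) *s e2 \<in> W" using W' by metis
    then show False using nz e2 by simp
  qed
  then show ?thesis using fr by blast
qed

end

section \<open>Reducible groups\<close>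

locale triangular_group = plane_group scale G p + plane_frame scale e1 e2 cx cy
  for scale :: "'f::field \<Rightarrow> 'v::ab_group_add \<Rightarrow> 'v" (infixr \<open>*s\<close> 75) and G p e1 e2 cx cy +
  assumes stable: "g \<in> G \<Longrightarrow> cy (g e1) = 0"
begin

text \<open>In the frame, \<open>g\<close> is upper triangular with diagonal
  \<open>\<chi>1 g\<close>, \<open>\<chi>2 g\<close> and corner \<open>\<beta> g\<close>.\<close>

definition \<chi>1 where "\<chi>1 g = cx (g e1)"
definition \<chi>2 where "\<chi>2 g = cy (g e2)"
definition \<beta> where "\<beta> g = cx (g e2)"

lemma G_e1: "g \<in> G \<Longrightarrow> g e1 = \<chi>1 g *s e1"
  by (simp add: eq_iff stable \<chi>1_def)

lemma G_e2: "g e2 = \<beta> g *s e1 + \<chi>2 g *s e2"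
  by (simp add: eq_iff \<beta>_def \<chi>2_def)

lemma cx_G: "g \<in> G \<Longrightarrow> cx (g v) = \<chi>1 g * cx v + \<beta> g * cy v"
  and cy_G: "g \<in> G \<Longrightarrow> cy (g v) = \<chi>2 g * cy v"
  unfolding coord_linear[OF G_linear, of g v] by (simp_all add: stable \<chi>1_def \<beta>_def \<chi>2_def)

lemma chi1_nz: "g \<in> G \<Longrightarrow> \<chi>1 g \<noteq> 0"
  using G_e1[of g] e1_nz by auto

lemma chi2_nz: "g \<in> G \<Longrightarrow> \<chi>2 g \<noteq> 0"
  using cy_G[of g "inv_into UNIV g e2"] by auto

lemma chi1_comp: "g \<in> G \<Longrightarrow> h \<in> G \<Longrightarrow> \<chi>1 (g \<circ> h) = \<chi>1 g * \<chi>1 h"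
  unfolding \<chi>1_def[of "g \<circ> h"] by (simp add: cx_G stable)

lemma chi2_comp: "g \<in> G \<Longrightarrow> h \<in> G \<Longrightarrow> \<chi>2 (g \<circ> h) = \<chi>2 g * \<chi>2 h"
  unfolding \<chi>2_def[of "g \<circ> h"] by (simp add: cy_G)

lemma chi_characters: "\<chi>1 \<in> characters LG" "\<chi>2 \<in> characters LG"
  by (simp_all add: characters_iff chi1_nz chi2_nz chi1_comp chi2_comp)

lemma extension: "is_extension base_ring LG (character_gmodule \<chi>1) V (character_gmodule \<chi>2)"
  unfolding is_extension_def
proof (intro bexI conjI)
  let ?i = "\<lambda>x. x *s e1"
  show "?i \<in> gmodule_hom base_ring LG (character_gmodule \<chi>1) V"
    by (auto simp: gmodule_hom_def hom_def scale_left_distrib G_scale G_e1 mult.commute)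
  show "cy \<in> gmodule_hom base_ring LG V (character_gmodule \<chi>2)"
    by (auto simp: gmodule_hom_def hom_def cy_G)
  show "inj_on ?i (carrier (character_gmodule \<chi>1))"
    using e1_nz by (auto simp: inj_on_def)
  show "?i ` carrier (character_gmodule \<chi>1) = a_kernel V (character_gmodule \<chi>2) cy"
    using span_e1 by (auto simp: a_kernel_def kernel_def span_singleton)
  show "cy ` carrier V = carrier (character_gmodule \<chi>2)"
    by (auto simp: image_iff intro: exI[of _ "_ *s e2"]) (metis coord_simps(4,8) mult.right_neutral)
qed

text \<open>Coordinates of \<open>f \<mapsto> g \<circ> f \<circ> g\<inverse>\<close>, read off one at a time along the filtration
  \<open>{f. f e1 = 0, f V \<subseteq> L} \<subseteq> {f. f V \<subseteq> L} \<subseteq> {f. f L \<subseteq> L} \<subseteq> End V\<close> with \<open>L = \<langle>e1\<rangle>\<close>.\<close>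

lemma act_End_coords:
  assumes g: "g \<in> G" and f: "endo scale f"
  defines "F \<equiv> act E g f"
  shows "cy (F e1) = \<chi>2 g / \<chi>1 g * cy (f e1)"
    and "cy (f e1) = 0 \<Longrightarrow> cx (F e1) = cx (f e1)"
    and "cy (f e1) = 0 \<Longrightarrow> cy (F e2) = cy (f e2)"
    and "f e1 = 0 \<Longrightarrow> cy (f e2) = 0 \<Longrightarrow> cx (F e2) = \<chi>1 g / \<chi>2 g * cx (f e2)"
proof -
  have F: "F (g v) = g (f v)" for v
    unfolding F_def act_End[OF g] using g by simp
  have Fl: "endo scale F"
    unfolding F_def act_End[OF g] by (intro linear_comp G_linear f g inv_in_G)
  have 1: "\<chi>1 g * cx (F e1) = \<chi>1 g * cx (f e1) + \<beta> g * cy (f e1)" "\<chi>1 g * cy (F e1) = \<chi>2 g * cy (f e1)"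
    using arg_cong[OF F[of e1], of cx] arg_cong[OF F[of e1], of cy] Fl g
    by (simp_all add: endo_iff G_e1 cx_G cy_G)
  have 2: "\<beta> g * cx (F e1) + \<chi>2 g * cx (F e2) = \<chi>1 g * cx (f e2) + \<beta> g * cy (f e2)"
    "\<beta> g * cy (F e1) + \<chi>2 g * cy (F e2) = \<chi>2 g * cy (f e2)"
    using arg_cong[OF F[of e2], of cx] arg_cong[OF F[of e2], of cy] Fl g
    by (simp_all add: endo_iff G_e2[of g] cx_G cy_G)
  note nz = chi1_nz[OF g] chi2_nz[OF g]
  show c: "cy (F e1) = \<chi>2 g / \<chi>1 g * cy (f e1)" using 1(2) nz by (simp add: field_simps)
  show a: "cx (F e1) = cx (f e1)" if "cy (f e1) = 0" using 1(1) nz that by simp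
  show "cy (F e2) = cy (f e2)" if "cy (f e1) = 0" using 2(2) c nz that by simp
  show "cx (F e2) = \<chi>1 g / \<chi>2 g * cx (f e2)" if "f e1 = 0" "cy (f e2) = 0"
    using 2(1) a that nz by (simp add: field_simps)
qed

text \<open>Isomorphic factors of V and End V carry the same scalars, so some
  \<open>\<phi> k\<close> equals some \<open>\<psi> j\<close>. Cleared of denominators, the possible
  equations are the four excluded ones: \<open>\<chi>1 = \<chi>1 / \<chi>2\<close> says
  \<open>\<chi>2 = 1\<close>, \<open>\<chi>2 = \<chi>1 / \<chi>2\<close> says
  \<open>\<chi>1 = \<chi>2 ^ 2\<close>, and so on.\<close>

lemma not_common_of_distinct:
  assumes "\<not> same_character LG \<chi>1 (\<lambda>_. 1)" "\<not> same_character LG \<chi>1 (\<lambda>g. \<chi>2 g ^ 2)"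
    "\<not> same_character LG \<chi>2 (\<lambda>_. 1)" "\<not> same_character LG \<chi>2 (\<lambda>g. \<chi>1 g ^ 2)"
  shows "\<not> common_factor"
proof
  assume "common_factor"
  then obtain W N W' N' where 1: "gsubquotient base_ring LG V W N"
    and 2: "gsubquotient base_ring LG E W' N'"
    and irr: "irreducible_gmodule base_ring LG (subquotient_gmodule V W N)"
    and irr': "irreducible_gmodule base_ring LG (subquotient_gmodule E W' N')"
    and iso: "gmodule_isomorphic base_ring LG (subquotient_gmodule V W N) (subquotient_gmodule E W' N')"
    by (rule common_factorE[OF _ gmodule_V gmodule_E])
  interpret A: gsubquotient base_ring LG V W N by fact
  interpret B: gsubquotient base_ring LG E W' N' by fact
  define \<phi> where "\<phi> k = (if k = 0 then \<chi>1 else \<chi>2)" for k :: nat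
  define \<psi> where "\<psi> k = (\<lambda>g. if k = 0 then \<chi>1 g / \<chi>2 g else if k = 3 then \<chi>2 g / \<chi>1 g else 1)" for k :: nat
  define Vs where "Vs k = {v. (k \<le> 1 \<longrightarrow> cy v = 0) \<and> (k = 0 \<longrightarrow> cx v = 0)}" for k :: nat
  \<comment> \<open>Raising \<open>k\<close> frees the matrix entries one at a time: upper right,
    first diagonal, second diagonal, lower left.\<close>
  define Es where "Es k = {f \<in> carrier E. (k \<le> 3 \<longrightarrow> cy (f e1) = 0) \<and> (k \<le> 2 \<longrightarrow> cy (f e2) = 0) \<and>
      (k \<le> 1 \<longrightarrow> cx (f e1) = 0) \<and> (k = 0 \<longrightarrow> cx (f e2) = 0)}" for k :: nat
  have "\<exists>k<2. \<forall>g\<in>G. \<forall>x\<in>W. g x - \<phi> k g *s x \<in> N"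
  proof (rule A.irreducible_scalar_action[OF irr, of Vs 2 \<phi>])
    show "Vs 0 = {\<zero>\<^bsub>V\<^esub>}" by (auto simp: Vs_def eq_iff)
    show "Vs 2 = carrier V" by (simp add: Vs_def)
    show "\<phi> k g \<in> carrier base_ring" for k g by simp
    fix k :: nat and g x assume "k < 2" "g \<in> carrier LG" "x \<in> Vs (Suc k)"
    then show "act V g x \<ominus>\<^bsub>V\<^esub> \<phi> k g \<odot>\<^bsub>V\<^esub> x \<in> Vs k"
      by (cases "k = 0") (auto simp: Vs_def \<phi>_def cx_G cy_G)
  next
    fix k assume "k < (2 :: nat)"
      "\<And>g x. g \<in> carrier LG \<Longrightarrow> x \<in> W \<Longrightarrow> act V g x \<ominus>\<^bsub>V\<^esub> \<phi> k g \<odot>\<^bsub>V\<^esub> x \<in> N"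
    then show ?thesis by (auto intro!: exI[of _ k])
  qed
  then obtain k where k: "k < 2" "\<And>g x. g \<in> G \<Longrightarrow> x \<in> W \<Longrightarrow> g x - \<phi> k g *s x \<in> N" by blast
  have "\<exists>k<4. \<forall>g\<in>G. \<forall>x\<in>W'. act E g x \<ominus>\<^bsub>E\<^esub> \<psi> k g \<odot>\<^bsub>E\<^esub> x \<in> N'"
  proof (rule B.irreducible_scalar_action[OF irr', of Es 4 \<psi>])
    have "f = (\<lambda>v. 0)" if "f \<in> Es 0" for f
      by (rule linear_eqI) (use that in \<open>auto simp: Es_def eq_iff endo_iff vector_space_axioms\<close>)
    then show "Es 0 = {\<zero>\<^bsub>E\<^esub>}"
      by (auto simp: Es_def endo_iff vector_space_axioms)
    show "Es 4 = carrier E" by (simp add: Es_def)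
    show "\<psi> k g \<in> carrier base_ring" for k g by simp
    fix k :: nat and g f assume k: "k < 4" and "g \<in> carrier LG" and fE: "f \<in> Es (Suc k)"
    then have g: "g \<in> G" and f: "endo scale f" by (auto simp: Es_def)
    have sf: "endo scale (\<lambda>v. \<psi> k g *s f v)"
      using f by (simp add: endo_iff scale_right_distrib mult.commute)
    have cl: "act E g f \<ominus>\<^bsub>E\<^esub> \<psi> k g \<odot>\<^bsub>E\<^esub> f \<in> carrier E"
      using g f sf B.act_closed[of g f] by (intro B.M.minus_closed) simp_all
    have val: "(act E g f \<ominus>\<^bsub>E\<^esub> \<psi> k g \<odot>\<^bsub>E\<^esub> f) v = act E g f v - \<psi> k g *s f v" for v
      using minus_E[OF sf, of "act E g f"] by simp
    note coords = act_End_coords[OF g f]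
    consider "k = 0" | "k = 1" | "k = 2" | "k = 3" using k by linarith
    then show "act E g f \<ominus>\<^bsub>E\<^esub> \<psi> k g \<odot>\<^bsub>E\<^esub> f \<in> Es k"
      using cl fE coords unfolding Es_def mem_Collect_eq val
      by cases (simp_all add: \<psi>_def eq_iff[of "f e1" 0] del: End_gmodule_simps)
  next
    fix k assume "k < (4 :: nat)"
      "\<And>g x. g \<in> carrier LG \<Longrightarrow> x \<in> W' \<Longrightarrow> act E g x \<ominus>\<^bsub>E\<^esub> \<psi> k g \<odot>\<^bsub>E\<^esub> x \<in> N'"
    then show ?thesis by (auto intro!: exI[of _ k] simp del: End_gmodule_simps)
  qed
  then obtain j where j: "j < 4" "\<And>g x. g \<in> G \<Longrightarrow> x \<in> W' \<Longrightarrow> act E g x \<ominus>\<^bsub>E\<^esub> \<psi> j g \<odot>\<^bsub>E\<^esub> x \<in> N'" by blast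
  obtain x where x: "x \<in> W" "x \<notin> N" using irr A.irreducible_sq_iff A.N_le_W by blast
  have eq: "\<phi> k g = \<psi> j g" if g: "g \<in> G" for g
  proof (rule ccontr)
    assume ne: "\<phi> k g \<noteq> \<psi> j g"
    \<comment> \<open>A polynomial of degree 1 compares the scalars: \<open>g - \<psi> j g\<close>
      kills the factor of End V, hence that of V, which \<open>g - \<phi> k g\<close> kills as
      well.\<close>
    have "poly_act V g [- \<psi> j g, 1] x \<in> N"
    proof (rule annihilator_transfer[OF 1 2 iso _ _ _ x(1)])
      fix y assume y: "y \<in> W'"
      have yE: "y \<in> carrier E" by (rule B.W_carrier[OF y])
      have "endo scale (\<lambda>v. \<psi> j g *s y v)"
        using yE by (simp add: endo_iff scale_right_distrib mult.commute)
      then have "act E g y \<ominus>\<^bsub>E\<^esub> \<psi> j g \<odot>\<^bsub>E\<^esub> y = (\<lambda>v. act E g y v - \<psi> j g *s y v)"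
        using minus_E by simp
      moreover have "poly_act E g [- \<psi> j g, 1] y = (\<lambda>v. act E g y v - \<psi> j g *s y v)"
        using B.act_zero[of g] g by (simp add: fun_eq_iff)
      ultimately show "poly_act E g [- \<psi> j g, 1] y \<in> N'" using j(2)[OF g y] by simp
    qed (use g in auto)
    then have a: "g x - \<psi> j g *s x \<in> N" using g by simp
    have "(g x - \<psi> j g *s x) - (g x - \<phi> k g *s x) \<in> N"
      using A.gsubmoduleD(5)[OF A.N a k(2)[OF g x(1)]] by simp
    then have "(\<phi> k g - \<psi> j g) *s x \<in> N" by (simp add: scale_left_diff_distrib)
    then have "inverse (\<phi> k g - \<psi> j g) *s (\<phi> k g - \<psi> j g) *s x \<in> N"
      using A.N unfolding gsubmodule_V_iff by blast
    then show False using ne x(2) by simp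
  qed
  have "k = 0 \<or> k = 1" "j = 0 \<or> j = 1 \<or> j = 2 \<or> j = 3" using k(1) j(1) by auto
  then show False
    using assms eq chi1_nz chi2_nz unfolding same_character_def \<phi>_def \<psi>_def
    by (elim disjE) (auto simp: field_simps power2_eq_square)
qed

text \<open>Conjugation by \<open>b\<close> raises an element \<open>u\<close> with diagonal 1, 1 to
  the power \<open>\<chi>1 b / \<chi>2 b\<close>, whereas the cocycle identity multiplies
  \<open>f u\<close> by \<open>\<chi> b\<close>. The hypothesis on \<open>b\<close> separates the
  two factors, so \<open>f u = 0\<close>. Commutators have diagonal 1, 1, hence
  \<open>f (g \<circ> h) = f (h \<circ> g)\<close>, and taking \<open>h = a\<close> exhibits the
  coboundary.\<close>

lemma character_cocycle:
  assumes chi: "\<And>g h. g \<in> G \<Longrightarrow> h \<in> G \<Longrightarrow> \<chi> (g \<circ> h) = \<chi> g * \<chi> h"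
    and unip: "\<And>u. u \<in> G \<Longrightarrow> \<chi>1 u = 1 \<Longrightarrow> \<chi>2 u = 1 \<Longrightarrow> \<chi> u = (1 :: 'f)"
    and cocycle: "\<And>g h. g \<in> G \<Longrightarrow> h \<in> G \<Longrightarrow> f (g \<circ> h) = f g + \<chi> g * f h"
    and a: "a \<in> G" "\<chi> a \<noteq> 1" and b: "b \<in> G" "\<chi> b * \<chi>2 b \<noteq> \<chi>1 b"
  shows "\<exists>m. \<forall>g\<in>G. f g = (\<chi> g - 1) * m"
proof -
  have U: "f u = 0" if u: "u \<in> G" "\<chi>1 u = 1" "\<chi>2 u = 1" for u
  proof -
    obtain k where k: "of_nat k = \<chi>1 b / \<chi>2 b" using of_nat_surj by blast
    have uk: "(u ^^ k) \<in> G \<and> (u ^^ k) e1 = e1 \<and> (u ^^ k) e2 = (of_nat k * \<beta> u) *s e1 + e2 \<and>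
        f (u ^^ k) = of_nat k * f u \<and> \<chi> (u ^^ k) = 1" for k
    proof (induction k)
      case 0
      have chi_id: "\<chi> id = 1" using unip[OF id_in_G] by (simp add: \<chi>1_def \<chi>2_def)
      moreover have "f id = f id + \<chi> id * f id" using cocycle[OF id_in_G id_in_G] by simp
      then have "f id = 0" unfolding chi_id by (metis add_cancel_right_right mult_1)
      ultimately show ?case using id_in_G by (simp add: id_def)
    next
      case (Suc k)
      have "u ((u ^^ k) e2) = (of_nat (Suc k) * \<beta> u) *s e1 + e2"
        using Suc u G_e2[of u] by (simp add: G_add G_scale G_e1 scale_left_distrib algebra_simps)
      moreover have "f (u \<circ> u ^^ k) = of_nat (Suc k) * f u" "\<chi> (u \<circ> u ^^ k) = 1"
        using Suc u cocycle[of u "u ^^ k"] chi[of u "u ^^ k"] unip by (simp_all add: algebra_simps)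
      moreover have "u \<circ> u ^^ k \<in> G" "(u \<circ> u ^^ k) e1 = e1"
        using Suc.IH u comp_in_G[of u "u ^^ k"] by (simp_all add: G_e1)
      moreover have "u ^^ Suc k = u \<circ> u ^^ k" by (rule funpow.simps(2))
      ultimately show ?case by (metis comp_apply)
    qed
    \<comment> \<open>The conjugation relation; \<open>k\<close> is the quotient of the diagonal
      entries of \<open>b\<close>, lifted to a natural number to serve as an exponent.\<close>
    have "b \<circ> u = u ^^ k \<circ> b"
    proof (rule linear_eqI)
      show "endo scale (b \<circ> u)" "endo scale (u ^^ k \<circ> b)"
        using uk b u by (simp_all add: linear_comp G_linear)
      show "(b \<circ> u) e1 = (u ^^ k \<circ> b) e1"
        using u uk[of k] b by (simp add: G_e1 G_scale)
      have "(b \<circ> u) e2 = \<beta> u *s \<chi>1 b *s e1 + b e2"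
        using u b G_e2[of u] by (simp add: G_add G_scale G_e1)
      moreover have "(u ^^ k \<circ> b) e2 = \<beta> b *s e1 + \<chi>2 b *s ((of_nat k * \<beta> u) *s e1 + e2)"
        using uk[of k] by (simp add: G_e2[of b] G_add G_scale)
      ultimately show "(b \<circ> u) e2 = (u ^^ k \<circ> b) e2"
        using k chi2_nz[OF b(1)] by (simp add: G_e2[of b] eq_iff field_simps)
    qed
    moreover have "f (u ^^ k \<circ> b) = of_nat k * f u + f b"
      using cocycle[of "u ^^ k" b] uk[of k] b(1) by simp
    ultimately have "f b + \<chi> b * f u = of_nat k * f u + f b"
      using cocycle[OF b(1) u(1)] by metis
    then have "(\<chi> b * \<chi>2 b - \<chi>1 b) * f u = 0"
      using k chi2_nz[OF b(1)] by (simp add: field_simps)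
    then show ?thesis using b(2) by simp
  qed
  have comm: "f (g \<circ> h) = f (h \<circ> g)" if gh: "g \<in> G" "h \<in> G" for g h
  proof -
    obtain u where uG: "u \<in> G" and e: "u \<circ> (h \<circ> g) = g \<circ> h"
      using commutator_in_G[OF gh] by blast
    have hg: "h \<circ> g \<in> G" using gh by (simp add: comp_in_G)
    have "\<chi>1 u * (\<chi>1 h * \<chi>1 g) = \<chi>1 g * \<chi>1 h"
      using chi1_comp[OF uG hg] chi1_comp[OF gh(2,1)] chi1_comp[OF gh] by (simp only: e)
    then have u1: "\<chi>1 u = 1" using chi1_nz gh by simp
    have "\<chi>2 u * (\<chi>2 h * \<chi>2 g) = \<chi>2 g * \<chi>2 h"
      using chi2_comp[OF uG hg] chi2_comp[OF gh(2,1)] chi2_comp[OF gh] by (simp only: e)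
    then have u2: "\<chi>2 u = 1" using chi2_nz gh by simp
    show ?thesis using cocycle[OF uG hg] U[OF uG u1 u2] unip[OF uG u1 u2] e by simp
  qed
  have "f g = (\<chi> g - 1) * (f a / (\<chi> a - 1))" if g: "g \<in> G" for g
  proof -
    have "f g + \<chi> g * f a = f a + \<chi> a * f g"
      using comm[OF g a(1)] cocycle[OF g a(1)] cocycle[OF a(1) g] by simp
    then show ?thesis using a(2) by (simp add: field_simps)
  qed
  then show ?thesis by blast
qed

text \<open>The \<open>cy\<close>-coordinate is a cocycle for \<open>\<chi>2\<close>; subtracting
  its coboundary leaves values in the line of \<open>e1\<close>, a cocycle for
  \<open>\<chi>1\<close>. The two applications of \<open>character_cocycle\<close> ask that neither
  \<open>\<chi>2\<close> nor \<open>\<chi>1\<close> equal \<open>\<chi>1 / \<chi>2\<close>.\<close>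

lemma trivial_H1_of_distinct:
  assumes "\<not> same_character LG \<chi>1 (\<lambda>_. 1)" "\<not> same_character LG \<chi>1 (\<lambda>g. \<chi>2 g ^ 2)"
    "\<not> same_character LG \<chi>2 (\<lambda>_. 1)"
  shows "trivial_group (H1 LG V)"
proof (rule trivial_H1_V)
  fix f assume f: "\<And>g h. g \<in> G \<Longrightarrow> h \<in> G \<Longrightarrow> f (g \<circ> h) = f g + g (f h)"
  obtain a1 where a1: "a1 \<in> G" "\<chi>1 a1 \<noteq> 1" using assms(1) by (auto simp: same_character_def)
  obtain a2 where a2: "a2 \<in> G" "\<chi>2 a2 \<noteq> 1" using assms(3) by (auto simp: same_character_def)
  obtain b where b: "b \<in> G" "\<chi>1 b \<noteq> \<chi>2 b ^ 2" using assms(2) by (auto simp: same_character_def)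
  have "\<exists>m. \<forall>g\<in>G. cy (f g) = (\<chi>2 g - 1) * m"
  proof (rule character_cocycle[where \<chi> = \<chi>2 and f = "\<lambda>g. cy (f g)" and a = a2 and b = b])
    show "\<chi>2 b * \<chi>2 b \<noteq> \<chi>1 b" using b(2) by (metis power2_eq_square)
  qed (simp_all add: f cy_G chi2_comp a2 b)
  then obtain m2 where m2: "\<And>g. g \<in> G \<Longrightarrow> cy (f g) = (\<chi>2 g - 1) * m2" by blast
  define f' where "f' g = f g - (g (m2 *s e2) - m2 *s e2)" for g
  have f'0: "cy (f' g) = 0" if "g \<in> G" for g
    using m2[OF that] that by (simp add: f'_def cy_G algebra_simps)
  have f': "f' (g \<circ> h) = f' g + g (f' h)" if "g \<in> G" "h \<in> G" for g h
    using f[OF that] that by (simp add: f'_def G_diff)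
  have "\<exists>m. \<forall>g\<in>G. cx (f' g) = (\<chi>1 g - 1) * m"
  proof (rule character_cocycle[where \<chi> = \<chi>1 and f = "\<lambda>g. cx (f' g)" and a = a1 and b = a2])
    show "\<chi>1 a2 * \<chi>2 a2 \<noteq> \<chi>1 a2" using a2 chi1_nz by simp
  qed (simp_all add: f' cx_G f'0 chi1_comp a1 a2)
  then obtain m1 where m1: "\<And>g. g \<in> G \<Longrightarrow> cx (f' g) = (\<chi>1 g - 1) * m1" by blast
  have "f g = g (m1 *s e1 + m2 *s e2) - (m1 *s e1 + m2 *s e2)" if g: "g \<in> G" for g
  proof -
    have "f' g = g (m1 *s e1) - m1 *s e1"
      using m1[OF g] f'0[OF g] g by (simp add: eq_iff cx_G cy_G algebra_simps)
    then show ?thesis using g by (simp add: f'_def G_add algebra_simps)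
  qed
  then show "\<exists>m. \<forall>g\<in>G. f g = g m - m" by blast
qed

end

section \<open>Subgroups isomorphic to the symmetric group\<close>

context plane_frame
begin

text \<open>The vertices of a triangle with centre 0, which the symmetric group permutes. They are
  distinct in every characteristic.\<close>

definition vertex :: "nat \<Rightarrow> 'v" where
  "vertex i = (if i = 1 then e1 else if i = 2 then e2 else - e1 - e2)"

lemma vertex_simps [simp]:
  "vertex (Suc 0) = e1" "vertex 1 = e1" "vertex 2 = e2" "vertex 3 = - e1 - e2"
  by (simp_all add: vertex_def)

abbreviation "trigon \<equiv> {e1, e2, - e1 - e2}"

definition perm_lin :: "(nat \<Rightarrow> nat) \<Rightarrow> 'v \<Rightarrow> 'v" where
  "perm_lin \<sigma> = lin (vertex (\<sigma> 1)) (vertex (\<sigma> 2))"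

lemma atLeastAtMost_1_3: "{1..3} = {1, 2, 3 :: nat}"
  by auto

lemma inj_vertex: "inj_on vertex {1..3}"
  unfolding atLeastAtMost_1_3 by (auto simp: inj_on_def vertex_def eq_iff)

lemma vertex_image: "vertex ` {1..3} = trigon"
  unfolding atLeastAtMost_1_3 by (auto simp: vertex_def)

text \<open>Two vertices determine a linear map; the third follows because a permutation preserves
  the sum of all three, which is 0.\<close>

lemma perm_lin_vertex:
  assumes s: "\<sigma> permutes {1..3}" and i: "i \<in> {1..3}"
  shows "perm_lin \<sigma> (vertex i) = vertex (\<sigma> i)"
proof -
  have "(\<Sum>i\<in>{1..3}. vertex (\<sigma> i)) = (\<Sum>i\<in>{1..3}. vertex i)"
    using sum.permute[OF s, of vertex] by (simp add: comp_def)
  then have s: "vertex (\<sigma> 1) + vertex (\<sigma> 2) + vertex (\<sigma> 3) = 0"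
    unfolding atLeastAtMost_1_3 by (simp add: vertex_def add.assoc)
  then have "vertex (\<sigma> 3) = - vertex (\<sigma> 1) - vertex (\<sigma> 2)"
    by (metis add.commute add_diff_cancel_left' diff_0 diff_diff_add)
  then have "perm_lin \<sigma> (vertex 3) = vertex (\<sigma> 3)"
    by (simp add: perm_lin_def lin_def)
  moreover have "perm_lin \<sigma> (vertex 1) = vertex (\<sigma> 1)" "perm_lin \<sigma> (vertex 2) = vertex (\<sigma> 2)"
    by (simp_all add: perm_lin_def)
  ultimately show ?thesis using i unfolding atLeastAtMost_1_3 by auto
qed

lemma perm_lin_eqI:
  assumes f: "endo scale f" and s: "\<sigma> permutes {1..3}"
    and fv: "\<And>i. i \<in> {1..3} \<Longrightarrow> f (vertex i) = vertex (\<sigma> i)"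
  shows "f = perm_lin \<sigma>"
proof (rule linear_eqI[OF f])
  show "endo scale (perm_lin \<sigma>)" unfolding perm_lin_def by (rule linear_lin)
  show "f e1 = perm_lin \<sigma> e1" "f e2 = perm_lin \<sigma> e2"
    using fv[of 1] fv[of 2] by (simp_all add: perm_lin_def)
qed

lemma linear_perm_lin: "endo scale (perm_lin \<sigma>)"
  unfolding perm_lin_def by (rule linear_lin)

lemma perm_lin_comp:
  assumes "\<sigma> permutes {1..3}" "\<tau> permutes {1..3}"
  shows "perm_lin (\<sigma> \<circ> \<tau>) = perm_lin \<sigma> \<circ> perm_lin \<tau>"
proof (rule perm_lin_eqI[symmetric])
  show "\<sigma> \<circ> \<tau> permutes {1..3}" using assms by (simp add: permutes_compose)
  fix i :: nat assume "i \<in> {1..3}"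
  then show "(perm_lin \<sigma> \<circ> perm_lin \<tau>) (vertex i) = vertex ((\<sigma> \<circ> \<tau>) i)"
    using assms permutes_in_image[OF assms(2), of i] by (simp add: perm_lin_vertex)
qed (simp add: linear_comp linear_perm_lin)

lemma perm_lin_id: "perm_lin id = id"
  by (rule perm_lin_eqI[symmetric]) (auto simp: endo_iff vector_space_axioms permutes_id)

lemma perm_lin_group_hom: "group_hom (sym_group 3) (GL scale) perm_lin"
proof -
  have "perm_lin \<in> hom (sym_group 3) (GL scale)"
  proof (rule homI)
    fix \<sigma> assume "\<sigma> \<in> carrier (sym_group 3)"
    then have s: "\<sigma> permutes {1..3}" by (simp add: sym_group_carrier)
    have "bij (perm_lin \<sigma>)"
      using perm_lin_comp[OF permutes_inv[OF s] s] perm_lin_comp[OF s permutes_inv[OF s]]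
      by (intro o_bij[of "perm_lin (inv_into UNIV \<sigma>)"])
        (simp_all add: permutes_inv_o[OF s] perm_lin_id)
    then show "perm_lin \<sigma> \<in> carrier (GL scale)" by (simp add: linear_perm_lin)
  qed (simp add: sym_group_carrier sym_group_mult perm_lin_comp)
  then show ?thesis
    by (simp add: group_hom_def group_hom_axioms_def sym_group_is_group group_GL)
qed

text \<open>The enclosing copy is the image of \<open>perm_lin\<close>. As \<open>g\<close> is
  injective, mapping \<open>trigon\<close> into itself already makes it a permutation of the
  indices.\<close>

lemma contained_in_S3I:
  assumes "\<And>g. g \<in> G \<Longrightarrow> endo scale g \<and> bij g \<and> g ` trigon \<subseteq> trigon"
  shows "contained_in_S3 G scale"
proof -
  interpret P: group_hom "sym_group 3" "GL scale" perm_lin by (rule perm_lin_group_hom)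
  let ?H = "perm_lin ` carrier (sym_group 3)"
  have sub: "subgroup ?H (GL scale)" by (rule P.img_is_subgroup)
  have inj: "inj_on perm_lin (carrier (sym_group 3))"
  proof (rule inj_onI)
    fix \<sigma> \<tau> assume "\<sigma> \<in> carrier (sym_group 3)" "\<tau> \<in> carrier (sym_group 3)"
      and eq: "perm_lin \<sigma> = perm_lin \<tau>"
    then have s: "\<sigma> permutes {1..3}" "\<tau> permutes {1..3}" by (simp_all add: sym_group_carrier)
    show "\<sigma> = \<tau>"
    proof
      fix i
      show "\<sigma> i = \<tau> i"
      proof (cases "i \<in> {1..3}")
        case True
        then have "vertex (\<sigma> i) = vertex (\<tau> i)"
          using perm_lin_vertex[OF s(1)] perm_lin_vertex[OF s(2)] eq by metis
        then show ?thesis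
          using inj_onD[OF inj_vertex] permutes_in_image[OF s(1), of i] permutes_in_image[OF s(2), of i] True
          by simp
      next
        case False
        then show ?thesis using s by (simp add: permutes_not_in)
      qed
    qed
  qed
  have "perm_lin \<in> iso (sym_group 3) (linear_group scale ?H)"
    unfolding iso_def hom_def
    by (auto simp: bij_betw_def inj sym_group_carrier sym_group_mult perm_lin_comp)
  then have "linear_group scale ?H \<cong> sym_group 3"
    using group.iso_sym[OF sym_group_is_group] unfolding is_iso_def by blast
  moreover have "G \<subseteq> ?H"
  proof
    fix g assume "g \<in> G"
    then have g: "endo scale g" "bij g" "g ` trigon \<subseteq> trigon"
      using assms by auto
    \<comment> \<open>Outside \<open>{1..3}\<close> it is the identity, as \<open>permutes\<close>
      demands.\<close>
    define \<sigma> where "\<sigma> i = (if i \<in> {1..3} then inv_into {1..3} vertex (g (vertex i)) else i)" for i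
    have in_im: "g (vertex i) \<in> vertex ` {1..3}" if "i \<in> {1..3}" for i
      using g(3) that unfolding vertex_image[symmetric] by blast
    have sv: "vertex (\<sigma> i) = g (vertex i)" "\<sigma> i \<in> {1..3}" if "i \<in> {1..3}" for i
    proof -
      show "vertex (\<sigma> i) = g (vertex i)"
        using that f_inv_into_f[OF in_im[OF that]] by (simp add: \<sigma>_def)
      show "\<sigma> i \<in> {1..3}"
        using that inv_into_into[OF in_im[OF that]] by (simp add: \<sigma>_def)
    qed
    have "inj_on \<sigma> {1..3}"
    proof (rule inj_onI)
      fix i j :: nat assume ij: "i \<in> {1..3}" "j \<in> {1..3}" "\<sigma> i = \<sigma> j"
      then have "g (vertex i) = g (vertex j)" using sv(1) by metis
      then have "vertex i = vertex j" using g(2) by (simp add: bij_def inj_eq)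
      then show "i = j" using inj_onD[OF inj_vertex] ij by blast
    qed
    then have "bij_betw \<sigma> {1..3} {1..3}"
      unfolding bij_betw_def using sv(2) by (intro conjI endo_inj_surj) auto
    then have s: "\<sigma> permutes {1..3}"
      by (rule bij_imp_permutes) (auto simp: \<sigma>_def)
    have "g = perm_lin \<sigma>" using perm_lin_eqI[OF g(1) s] sv(1) by simp
    then show "g \<in> ?H" using s by (simp add: sym_group_carrier)
  qed
  ultimately show ?thesis unfolding contained_in_S3_def using sub by blast
qed

end

context plane_group
begin

text \<open>Over the field with two elements \<open>trigon\<close> is the set of nonzero vectors,
  which every invertible map permutes.\<close>

lemma contained_in_S3_if_2:
  assumes "p = 2"
  shows "contained_in_S3 G scale"
proof -
  obtain e1 e2 cx cy where "plane_frame scale e1 e2 cx cy" using frame_ex by blast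
  then interpret plane_frame scale e1 e2 cx cy .
  have "{0, 1 :: 'f} = UNIV"
    by (rule card_subset_eq[OF finite_field]) (simp_all add: card_f assms)
  then have c: "c = 0 \<or> c = 1" for c :: 'f by blast
  have neg: "(- 1 :: 'f) = 1" using c[of "- 1"] by simp
  have tri: "v \<in> trigon \<longleftrightarrow> v \<noteq> 0" for v
    using c[of "cx v"] c[of "cy v"] by (auto simp: eq_iff neg)
  show ?thesis
  proof (rule contained_in_S3I)
    fix g assume g: "g \<in> G"
    have "g v \<in> trigon" if "v \<in> trigon" for v using that g unfolding tri by simp
    then show "endo scale g \<and> bij g \<and> g ` trigon \<subseteq> trigon"
      using G_linear[OF g] G_bij[OF g] by (simp add: image_subset_iff)
  qed
qed

section \<open>Irreducible groups\<close>

lemma irreducible_line: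
  assumes irr: "irreducible_V" and v: "v \<noteq> 0"
    and st: "\<And>g. g \<in> G \<Longrightarrow> g v \<in> span {v}"
  shows False
proof -
  have "gsubmodule (span {v}) base_ring LG V"
    unfolding gsubmodule_V_iff
  proof (intro conjI ballI allI)
    fix g x assume g: "g \<in> G" and "x \<in> span {v}"
    then obtain c where "x = c *s v" by (auto simp: span_singleton)
    then show "g x \<in> span {v}" using st[OF g] g by (simp add: G_scale span_scale)
  qed (auto intro: span_add span_scale span_zero)
  moreover have "v \<in> span {v}" by (simp add: span_base)
  ultimately have "span {v} = UNIV" using irr v unfolding irreducible_V_iff by blast
  obtain e2 cx cy where "plane_frame scale v e2 cx cy" using frame_exists[OF dim v] by blast
  then interpret plane_frame scale v e2 cx cy .
  have "cy e2 = 0" using \<open>span {v} = UNIV\<close> span_e1 by blast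
  then show False by simp
qed

text \<open>The condition \<open>(u - 1)^2 = 0\<close>.\<close>

definition unipotent :: "('v \<Rightarrow> 'v) \<Rightarrow> bool" where
  "unipotent u \<longleftrightarrow> (\<forall>v. u (u v - v) = u v - v)"

lemma unipotent_power:
  assumes u: "u \<in> G" and "u e = e" "u w = w + b *s e"
  shows "u ^^ k \<in> G \<and> (u ^^ k) e = e \<and> (u ^^ k) w = w + (of_nat k * b) *s e"
proof (induction k)
  case 0
  then show ?case using id_in_G by (simp add: id_def)
next
  case (Suc k)
  have "u ^^ Suc k = u \<circ> u ^^ k" by (rule funpow.simps(2))
  moreover have "u \<circ> u ^^ k \<in> G" using Suc u comp_in_G by blast
  moreover have "u ((u ^^ k) w) = w + (of_nat (Suc k) * b) *s e"
    using Suc u assms by (simp add: G_add G_scale scale_left_distrib algebra_simps)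
  moreover have "u ((u ^^ k) e) = e" using Suc assms by simp
  ultimately show ?case by (metis comp_apply)
qed

text \<open>Two unipotents with distinct fixed lines generate a conjugate of \<open>SL\<^sub>2\<close>, which contains \<open>-1\<close>
  as the square of the Weyl element.\<close>

lemma minus_one_in_G:
  assumes irr: "irreducible_V" and u: "u \<in> G" "unipotent u" "u \<noteq> id"
  shows "(\<lambda>v. (- 1) *s v) \<in> G"
proof -
  obtain x where x: "u x \<noteq> x" using u(3) by (auto simp: fun_eq_iff)
  define e where "e = u x - x"
  have e: "e \<noteq> 0" "u e = e" using x u(2) by (auto simp: e_def unipotent_def)
  obtain g where g: "g \<in> G" "g e \<notin> span {e}" using irreducible_line[OF irr e(1)] by blast
  obtain cx cy where "plane_frame scale e (g e) cx cy" using frame_of_basis[OF dim e(1) g(2)] by blast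
  then interpret plane_frame scale e "g e" cx cy .
  have line: "\<exists>b. u y = y + b *s e" for y
  proof -
    have lin: "u v = cx v *s e + cy v *s u (g e)" for v
    proof -
      have "u v = u (cx v *s e + cy v *s g e)" by (simp add: expand)
      then show ?thesis using u(1) e(2) by (simp only: G_add G_scale)
    qed
    \<comment> \<open>In the basis \<open>e\<close>, \<open>g e\<close> the matrix of
      \<open>u\<close> is upper triangular with diagonal entries 1 and \<open>cy (u (g e))\<close>;
      unipotence forces the second to be 1.\<close>
    have "u (u (g e) - g e) = u (g e) - g e" using u(2) unfolding unipotent_def by blast
    then have "cy (u (u (g e) - g e)) = cy (u (g e) - g e)" by simp
    then have "cy (u (g e) - g e) * cy (u (g e)) = cy (u (g e) - g e)"
      using lin[of "u (g e) - g e"] by simp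
    then have "(cy (u (g e)) - 1) * (cy (u (g e)) - 1) = 0" by (simp add: algebra_simps)
    then have "cy (u (g e)) = 1" by simp
    then have "u y = y + (cy y * cx (u (g e))) *s e"
      unfolding eq_iff lin[of y] by simp
    then show ?thesis by blast
  qed
  obtain b where b: "u (g e) = g e + b *s e" using line by blast
  have bnz: "b \<noteq> 0"
  proof
    assume "b = 0"
    then have "u = id" using b e(2) u(1)
      by (intro linear_eqI G_linear id_in_G) simp_all
    then show False using u(3) by simp
  qed
  define g' where "g' = inv_into UNIV g"
  \<comment> \<open>The conjugate of \<open>u\<close> fixes the line of \<open>g e\<close> instead
    of that of \<open>e\<close>.\<close>
  define u' where "u' = g \<circ> u \<circ> g'"
  have u'G: "u' \<in> G" unfolding u'_def g'_def by (intro comp_in_G inv_in_G g u)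
  have u'ge: "u' (g e) = g e" using g(1) e(2) by (simp add: u'_def g'_def)
  obtain c where "u (g' e) = g' e + c *s e" using line by blast
  then have c: "u' e = e + c *s g e"
    using g(1) by (simp add: u'_def g'_def G_add G_scale)
  have cnz: "c \<noteq> 0"
  proof
    assume "c = 0"
    then have "u' = id" using c u'ge u'G
      by (intro linear_eqI G_linear id_in_G) simp_all
    then have "u (g' (g y)) = g' (g y)" for y
      using g(1) by (metis G_inv(2) comp_apply g'_def id_apply u'_def)
    then show False using x g(1) by (simp add: g'_def)
  qed
  \<comment> \<open>The exponents turn \<open>s\<close> and \<open>t\<close> into the elementary
    matrices with upper entry 1 and lower entry -1; then \<open>s \<circ> t \<circ> s\<close> is the
    Weyl element.\<close>
  obtain k where k: "of_nat k = 1 / b" using of_nat_surj by blast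
  obtain l where l: "of_nat l = - 1 / c" using of_nat_surj by blast
  define s where "s = u ^^ k"
  define t where "t = u' ^^ l"
  have s: "s \<in> G" "s e = e" "s (g e) = g e + e"
    using unipotent_power[OF u(1) e(2) b, of k] bnz by (simp_all add: s_def k)
  have t: "t \<in> G" "t (g e) = g e" "t e = e - g e"
    using unipotent_power[OF u'G u'ge c, of l] cnz by (simp_all add: t_def l)
  define w where "w = s \<circ> t \<circ> s"
  have w: "w \<in> G" unfolding w_def by (intro comp_in_G s t)
  have we: "w e = - g e" "w (g e) = e"
    using s t by (simp_all add: w_def G_add G_diff)
  have "w \<circ> w = (\<lambda>v. (- 1) *s v)"
  proof (rule linear_eqI)
    show "endo scale (\<lambda>v. (- 1) *s v)"
      by (simp add: endo_iff vector_space_axioms)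
  qed (use w we in \<open>simp_all add: G_linear comp_in_G G_uminus\<close>)
  then show ?thesis using comp_in_G[OF w w] by simp
qed

section \<open>Elements of order p\<close>

lemma binomial_iterate:
  assumes g: "endo scale g"
  defines "d \<equiv> \<lambda>v. g v - v"
  shows "(g ^^ n) v = (\<Sum>i\<le>n. of_nat (n choose i) *s (d ^^ i) v)"
proof (induction n)
  case 0
  then show ?case by simp
next
  case (Suc n)
  have g_sum: "g (\<Sum>i\<le>m. c i *s x i) = (\<Sum>i\<le>m. c i *s g (x i))" for m :: nat and c x
    using g by (induction m) (simp_all add: endo_iff)
  have "(g ^^ Suc n) v = g (\<Sum>i\<le>n. of_nat (n choose i) *s (d ^^ i) v)"
    by (simp add: Suc)
  also have "\<dots> = (\<Sum>i\<le>n. of_nat (n choose i) *s ((d ^^ i) v + (d ^^ Suc i) v))"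
    unfolding g_sum by (simp add: d_def)
  also have "\<dots> = (\<Sum>i\<le>n. of_nat (n choose i) *s (d ^^ i) v) +
      (\<Sum>i\<le>n. of_nat (n choose i) *s (d ^^ Suc i) v)"
    by (simp only: scale_right_distrib sum.distrib)
  also have "(\<Sum>i\<le>n. of_nat (n choose i) *s (d ^^ i) v) =
      v + (\<Sum>i\<le>n. of_nat (n choose Suc i) *s (d ^^ Suc i) v)"
  proof -
    have "(\<Sum>i\<le>n. of_nat (n choose i) *s (d ^^ i) v) = (\<Sum>i\<le>Suc n. of_nat (n choose i) *s (d ^^ i) v)"
      by (simp add: binomial_eq_0)
    also have "\<dots> = v + (\<Sum>i\<le>n. of_nat (n choose Suc i) *s (d ^^ Suc i) v)"
      by (subst sum.atMost_Suc_shift) simp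
    finally show ?thesis .
  qed
  also have "v + (\<Sum>i\<le>n. of_nat (n choose Suc i) *s (d ^^ Suc i) v) +
      (\<Sum>i\<le>n. of_nat (n choose i) *s (d ^^ Suc i) v) =
      v + (\<Sum>i\<le>n. of_nat (Suc n choose Suc i) *s (d ^^ Suc i) v)"
    by (simp add: scale_left_distrib sum.distrib add_ac del: funpow.simps)
  also have "\<dots> = (\<Sum>i\<le>Suc n. of_nat (Suc n choose i) *s (d ^^ i) v)"
    by (subst sum.atMost_Suc_shift) simp
  finally show ?case .
qed

text \<open>Write \<open>g = 1 + d\<close>. The inner binomial coefficients vanish in characteristic
  p, so the p-th power of \<open>d\<close> is \<open>g ^^ p - 1 = 0\<close>. A nilpotent map of the
  plane kills some nonzero \<open>e\<close> and acts as zero modulo its line, so \<open>d\<close>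
  maps into that line and \<open>d (d v) = 0\<close>.\<close>

lemma unipotent_of_order_p:
  assumes g: "g \<in> G" and gp: "g ^^ p = id"
  shows "unipotent g"
proof -
  define d where "d = (\<lambda>v. g v - v)"
  have p0: "p \<noteq> 0" using p by (metis not_prime_0)
  have dp: "(d ^^ p) v = 0" for v
  proof -
    have "{..p} = {0, p} \<union> {0<..<p}" using p0 by auto
    then have "(g ^^ p) v = (\<Sum>i\<in>{0, p} \<union> {0<..<p}. of_nat (p choose i) *s (d ^^ i) v)"
      using binomial_iterate[OF G_linear[OF g], of p v] by (simp add: d_def)
    also have "\<dots> = (\<Sum>i\<in>{0, p}. of_nat (p choose i) *s (d ^^ i) v) +
        (\<Sum>i\<in>{0<..<p}. of_nat (p choose i) *s (d ^^ i) v)"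
      by (rule sum.union_disjoint) auto
    also have "(\<Sum>i\<in>{0<..<p}. of_nat (p choose i) *s (d ^^ i) v) = 0"
    proof (rule sum.neutral, rule ballI)
      fix i assume "i \<in> {0<..<p}"
      then have "p dvd (p choose i)" using p by (intro dvd_choose_prime) auto
      then have "of_nat (p choose i) = (0 :: 'f)" by (simp add: of_nat_eq_0_iff_p)
      then show "of_nat (p choose i) *s (d ^^ i) v = 0" by simp
    qed
    finally have "(g ^^ p) v = v + (d ^^ p) v" using p0 by simp
    then show ?thesis using gp by simp
  qed
  have "\<exists>v. v \<noteq> 0 \<and> d v = 0"
  proof (rule ccontr)
    assume c: "\<not> ?thesis"
    obtain v :: 'v where v: "v \<noteq> 0" using ex_nonzero[OF dim] by blast
    have "(d ^^ k) v \<noteq> 0" for k by (induction k) (use v c in auto)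
    then show False using dp by blast
  qed
  then obtain e where e: "e \<noteq> 0" "d e = 0" by blast
  then have ge: "g e = e" by (simp add: d_def)
  obtain e2 cx cy where "plane_frame scale e e2 cx cy" using frame_exists[OF dim e(1)] by blast
  then interpret plane_frame scale e e2 cx cy .
  have cyg: "cy (g v) = cy (g e2) * cy v" for v
    using coord_linear(2)[OF G_linear[OF g], of v] ge by simp
  have "cy (d v) = (cy (g e2) - 1) * cy v" for v
    unfolding d_def coord_diff cyg[of v] by (simp add: algebra_simps)
  then have "cy ((d ^^ k) e2) = (cy (g e2) - 1) ^ k" for k by (induction k) simp_all
  then have "(cy (g e2) - 1) ^ p = 0" using dp[of e2] by (metis coord_zero(2))
  then have "cy (g e2) = 1" by simp
  then have "cy (d v) = 0" for v using cyg[of v] by (simp add: d_def)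
  then have "d v = cx (d v) *s e" for v by (simp add: eq_iff)
  then have "g (d v) = d v" for v using ge G_scale[OF g] by metis
  then show ?thesis by (simp add: unipotent_def d_def)
qed

text \<open>Cauchy's theorem, drawn from Sylow with exponent 1: a subgroup of order p exists even if
  a higher power of p divides the order.\<close>

lemma unipotent_exists:
  assumes "p dvd card G"
  shows "\<exists>u\<in>G. unipotent u \<and> u \<noteq> id"
proof -
  interpret LG: group LG by (rule group_LG)
  obtain m where "card G = p * m" using assms by blast
  then obtain H where H: "subgroup H LG" "card H = p"
    using sylow_thm[of p LG 1 m] p group_LG finite_G by (auto simp: Coset.order_def)
  interpret H: subgroup H LG by fact
  have "H \<noteq> {id}" using H(2) p not_prime_1 by force
  then obtain u where u: "u \<in> H" "u \<noteq> id" using H.one_closed by auto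
  have uG: "u \<in> G" using H.subset u(1) by auto
  interpret LH: group "LG\<lparr>carrier := H\<rparr>" by (rule LG.subgroup_imp_group[OF H(1)])
  have "u [^]\<^bsub>LG\<lparr>carrier := H\<rparr>\<^esub> p = id"
    using LH.pow_order_eq_1[of u] u(1) H(2) by (simp add: Coset.order_def)
  moreover have "u [^]\<^bsub>LG\<lparr>carrier := H\<rparr>\<^esub> n = u ^^ n" for n :: nat
    by (induction n) (simp_all add: funpow_swap1 fun_eq_iff)
  ultimately have "unipotent u" using unipotent_of_order_p[OF uG] by simp
  then show ?thesis using uG u(2) by blast
qed

end

section \<open>Characteristic polynomials of the elements of G\<close>

locale framed_group = plane_group scale G p + plane_frame scale e1 e2 cx cy
  for scale :: "'f::field \<Rightarrow> 'v::ab_group_add \<Rightarrow> 'v" (infixr \<open>*s\<close> 75) and G p e1 e2 cx cy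
begin

lemma G_dt_nz: "g \<in> G \<Longrightarrow> dt g \<noteq> 0"
  by (intro bij_dt_nz G_linear G_bij)

lemma G_dt_comp: "g \<in> G \<Longrightarrow> dt (g \<circ> h) = dt g * dt h"
  by (intro dt_comp G_linear)

lemma G_dt_inv: "g \<in> G \<Longrightarrow> dt g * dt (inv_into UNIV g) = 1"
  by (intro dt_inv G_linear ext) simp_all

lemma G_CH: "g \<in> G \<Longrightarrow> g (g v) = tr g *s g v - dt g *s v"
  by (intro cayley_hamilton G_linear)

text \<open>With \<open>\<alpha>\<close>, \<open>\<beta>\<close> the eigenvalues of \<open>g\<close>, the action of \<open>g\<close> on \<open>End V\<close> is annihilated by
  \<open>\<alpha>\<beta>(x - 1)(x - \<alpha>/\<beta>)(x - \<beta>/\<alpha>)\<close>.\<close>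

lemma poly_act_End:
  assumes g: "g \<in> G" and f: "endo scale f"
  defines "q \<equiv> tr g * tr g - dt g"
  shows "poly_act E g [- dt g, q, - q, dt g] f = (\<lambda>v. 0)"
proof -
  define h where "h = inv_into UNIV g"
  define A where "A = act E g"
  have gl: "endo scale g" and hl: "endo scale h"
    using g by (simp_all add: h_def G_linear inv_in_G)
  have gh: "g (h v) = v" for v using g by (simp add: h_def)
  have A: "A f v = g (f (h v))" for f v unfolding A_def act_End[OF g] h_def by simp
  have g_simps: "g (x + y) = g x + g y" "g (c *s x) = c *s g x" "g (x - y) = g x - g y" for x y c
    using g by (simp_all add: G_add G_scale G_diff)
  have hh: "dt g *s h (h v) = tr g *s h v - v" for v
    using adjugate[OF gl gh hl, of "h v"] gh by simp
  have Al: "endo scale (A k)" if "endo scale k" for k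
    unfolding A_def act_End[OF g] by (intro linear_comp gl that hl[unfolded h_def])
  have k_hh: "dt g *s k (h (h v)) = tr g *s k (h v) - k v"
    if k: "endo scale k" for k v
  proof -
    have "dt g *s k (h (h v)) = k (dt g *s h (h v))" by (simp add: endo_simps[OF k])
    then show ?thesis unfolding hh by (simp add: endo_simps[OF k])
  qed
  \<comment> \<open>Cayley-Hamilton for \<open>g\<close> on the left and for its inverse
    \<open>h\<close> on the right, multiplied by \<open>dt g\<close> to stay free of
    division.\<close>
  have AA: "dt g *s A (A k) v = (tr g * tr g) *s A k v - tr g *s g (k v)
      - (dt g * tr g) *s k (h v) + dt g *s k v"
    if k: "endo scale k" for k v
  proof -
    have "dt g *s A (A k) v = g (g (dt g *s k (h (h v))))"
      by (simp add: A g_simps)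
    also have "\<dots> = tr g *s g (g (k (h v))) - g (g (k v))"
      unfolding k_hh[OF k] by (simp add: g_simps)
    also have "\<dots> = tr g *s (tr g *s g (k (h v)) - dt g *s k (h v)) - (tr g *s g (k v) - dt g *s k v)"
      by (simp only: G_CH[OF g])
    finally show ?thesis by (simp add: A scale_right_diff_distrib algebra_simps)
  qed
  have AAA: "dt g *s A (A (A f)) v = q *s A (A f) v - q *s A f v + dt g *s f v" for v
  proof -
    have 1: "g (A f v) = tr g *s A f v - dt g *s f (h v)"
      unfolding A by (rule G_CH[OF g])
    have 2: "dt g *s A f (h v) = tr g *s A f v - g (f v)"
    proof -
      have "dt g *s A f (h v) = g (dt g *s f (h (h v)))" by (simp add: A g_simps)
      then show ?thesis unfolding k_hh[OF f] by (simp add: A g_simps)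
    qed
    have 3: "(dt g * tr g) *s A f (h v) = tr g *s (tr g *s A f v - g (f v))"
      using arg_cong[OF 2, of "\<lambda>x. tr g *s x"] by (simp add: mult.commute)
    \<comment> \<open>The mixed terms \<open>g \<circ> f\<close> and \<open>f \<circ> h\<close>
      disappear by solving the relation \<open>AA\<close> at \<open>f\<close> for the first of them;
      only powers of \<open>A\<close> survive.\<close>
    have 4: "tr g *s g (f v) = (tr g * tr g) *s A f v - (dt g * tr g) *s f (h v) + dt g *s f v
        - dt g *s A (A f) v"
      using AA[OF f, of v] by (simp add: algebra_simps)
    have "dt g *s A (A (A f)) v = (tr g * tr g) *s A (A f) v - tr g *s (tr g *s A f v - dt g *s f (h v))
        - tr g *s (tr g *s A f v - g (f v)) + dt g *s A f v"
      using AA[OF Al[OF f], of v] unfolding 1 3 .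
    also have "\<dots> = (tr g * tr g) *s A (A f) v - (tr g * tr g) *s A f v + (dt g * tr g) *s f (h v)
        - (tr g * tr g) *s A f v + tr g *s g (f v) + dt g *s A f v"
      by (simp add: scale_right_diff_distrib mult.commute algebra_simps)
    also have "\<dots> = (tr g * tr g) *s A (A f) v - dt g *s A (A f) v - (tr g * tr g) *s A f v
        + dt g *s A f v + dt g *s f v"
      unfolding 4 by (simp add: algebra_simps)
    finally show ?thesis by (simp add: q_def scale_left_diff_distrib algebra_simps)
  qed
  interpret E: gmodule base_ring LG E by (rule gmodule_E)
  have "poly_act E g [- dt g, q, - q, dt g] f =
      (\<lambda>v. (- dt g) *s f v + A (\<lambda>v. q *s f v + A (\<lambda>v. (- q) *s f v + A (\<lambda>v. dt g *s f v) v) v) v)"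
    using E.act_zero[of g] g by (simp add: A_def fun_eq_iff)
  also have "\<dots> = (\<lambda>v. 0)"
  proof
    fix v
    show "(- dt g) *s f v + A (\<lambda>v. q *s f v + A (\<lambda>v. (- q) *s f v + A (\<lambda>v. dt g *s f v) v) v) v = 0"
      using AAA[of v] by (simp add: A g_simps algebra_simps)
  qed
  finally show ?thesis .
qed

text \<open>The cubic that annihilates \<open>g\<close> on End V must annihilate it on V, whose only
  factor is V itself. Modulo the characteristic polynomial of \<open>g\<close> the cubic becomes
  \<open>x *s g v + y *s v = 0\<close>. Either \<open>g\<close> is scalar, hence the identity, or
  \<open>x = y = 0\<close>, and these equations factor into the two alternatives.\<close>

lemma common_char_poly:
  assumes common: "common_factor"
    and irr: "irreducible_V"
    and noscalar: "\<And>c. (\<lambda>v. c *s v) \<in> G \<Longrightarrow> c = 1"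
    and g: "g \<in> G"
  shows "tr g = 1 + dt g \<or> (tr g = - 1 \<and> dt g = 1)"
proof -
  obtain W N W' N' where 1: "gsubquotient base_ring LG V W N"
    and 2: "gsubquotient base_ring LG E W' N'"
    and irrq: "irreducible_gmodule base_ring LG (subquotient_gmodule V W N)"
    and iso: "gmodule_isomorphic base_ring LG (subquotient_gmodule V W N) (subquotient_gmodule E W' N')"
    by (rule common_factorE[OF common gmodule_V gmodule_E])
  interpret A: gsubquotient base_ring LG V W N by fact
  interpret B: gsubquotient base_ring LG E W' N' by fact
  have "N \<noteq> W" using irrq A.irreducible_sq_iff by blast
  then have N: "N = {0}" and W: "W = UNIV"
    using A.N_le_W A.gsubmoduleD(2)[OF A.N] A.W A.N irr
    unfolding irreducible_V_iff by auto
  define q where "q = tr g * tr g - dt g"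
  have P: "poly_act V g [- dt g, q, - q, dt g] v = 0" for v
  proof -
    have "poly_act V g [- dt g, q, - q, dt g] v \<in> N"
    proof (rule annihilator_transfer[OF 1 2 iso])
      fix f assume "f \<in> W'"
      then have "f \<in> carrier E" by (rule B.W_carrier)
      then have "poly_act E g [- dt g, q, - q, dt g] f = \<zero>\<^bsub>E\<^esub>"
        using poly_act_End[OF g] unfolding q_def by simp
      then show "poly_act E g [- dt g, q, - q, dt g] f \<in> N'" using B.gsubmoduleD(2)[OF B.N] by simp
    qed (use g W in auto)
    then show ?thesis using N by simp
  qed
  \<comment> \<open>The coefficients of the remainder of the cubic; \<open>q\<close> also occurs in
    \<open>g^3 = q g - tr g dt g\<close>.\<close>
  define x where "x = q * (1 - tr g + dt g)"
  define y where "y = dt g * (tr g + 1) * (tr g - 1 - dt g)"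
  have xy: "x *s g v + y *s v = 0" for v
  proof -
    have 1: "g (g v) = tr g *s g v - dt g *s v" by (rule G_CH[OF g])
    have 2: "g (g (g v)) = (tr g * tr g - dt g) *s g v - (tr g * dt g) *s v"
      unfolding 1 using g by (simp add: G_diff G_scale G_CH[OF g, of v]
          scale_right_diff_distrib scale_left_diff_distrib algebra_simps)
    have "(- dt g) *s v + q *s g v - q *s g (g v) + dt g *s g (g (g v)) = 0"
      using P[of v] g by (simp add: G_add G_scale G_uminus G_diff algebra_simps)
    then have "cx ((- dt g) *s v + q *s g v - q *s g (g v) + dt g *s g (g (g v))) = 0"
      "cy ((- dt g) *s v + q *s g v - q *s g (g v) + dt g *s g (g (g v))) = 0" by simp_all
    then show ?thesis
      unfolding 2 unfolding 1 eq_iff x_def y_def q_def by (simp add: algebra_simps)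
  qed
  show ?thesis
  proof (cases "x = 0")
    case True
    then have "y = 0" using xy[of e1] e1_nz by simp
    then have "tr g + 1 = 0 \<or> tr g - 1 - dt g = 0"
      using G_dt_nz[OF g] unfolding y_def by simp
    then have "tr g = - 1 \<or> tr g = 1 + dt g"
      by (auto simp: eq_neg_iff_add_eq_0 diff_diff_eq)
    moreover have "dt g = 1 \<or> tr g = 1 + dt g" if "tr g = - 1"
    proof -
      have "(1 - dt g) * (2 + dt g) = 0"
        using True unfolding x_def q_def that by (simp add: algebra_simps)
      then have "dt g = 1 \<or> 2 + dt g = 0" by auto
      moreover have "tr g = 1 + dt g" if "2 + dt g = 0"
      proof -
        have "1 + (1 + dt g) = 0" using that by (metis add.assoc one_add_one)
        then show ?thesis using \<open>tr g = - 1\<close> by (metis add_eq_0_iff)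
      qed
      ultimately show ?thesis by blast
    qed
    ultimately show ?thesis by blast
  next
    case False
    have "g v = (- y / x) *s v" for v
    proof -
      have "x *s g v = x *s ((- y / x) *s v)"
        using xy[of v] False by (simp add: eq_neg_iff_add_eq_0)
      then show ?thesis using False scale_left_imp_eq by blast
    qed
    then have eq: "g = (\<lambda>v. (- y / x) *s v)" by blast
    then have "- y / x = 1" using noscalar g by metis
    then have "g = id" using eq by (simp add: fun_eq_iff)
    then show ?thesis by simp
  qed
qed

text \<open>The elements of determinant 1 are \<open>id\<close>, \<open>t\<close> and
  \<open>t \<circ> t\<close>; every other element inverts \<open>t\<close> under conjugation, and
  two others multiply into this set. So the orbit of a suitable \<open>v\<close> lies in
  \<open>{v, t v, t (t v)}\<close>, of sum 0 because \<open>t\<close> has trace -1 and determinant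
  1.\<close>

lemma contained_in_S3I_char_poly:
  assumes irr: "irreducible_V"
    and noscalar: "\<And>c. (\<lambda>v. c *s v) \<in> G \<Longrightarrow> c = 1"
    and nounip: "\<And>u. u \<in> G \<Longrightarrow> unipotent u \<Longrightarrow> u = id"
    and dich: "\<And>g. g \<in> G \<Longrightarrow> tr g = 1 + dt g \<or> (tr g = - 1 \<and> dt g = 1)"
  shows "contained_in_S3 G scale"
proof -
  \<comment> \<open>Trace 2 and determinant 1 give \<open>(u - 1)^2 = 0\<close> by Cayley-Hamilton.
    So an element of determinant 1 other than \<open>id\<close> falls under the second alternative
    of \<open>dich\<close>.\<close>
  have tr2: "u = id" if "u \<in> G" "dt u = 1" "tr u = 2" for u
  proof (rule nounip[OF that(1)])
    have "u (u v - v) = u v - v" for v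
    proof -
      have "2 *s u v = u v + u v" by (metis one_add_one scale_left_distrib scale_one)
      then show ?thesis
        using G_CH[OF that(1), of v] that by (simp add: G_diff algebra_simps)
    qed
    then show "unipotent u" by (simp add: unipotent_def)
  qed
  have trS: "tr u = - 1" if "u \<in> G" "dt u = 1" "u \<noteq> id" for u
    using dich[OF that(1)] tr2[OF that(1,2)] that by auto
  have line: "\<exists>g\<in>G. g v \<notin> span {v}" if "v \<noteq> 0" for v
    using irreducible_line[OF irr that] by blast
  have fixed: "g = id" if gv: "g \<in> G" "v \<noteq> 0" "g v = v" "w \<notin> span {v}" "g w = w" for g v w
  proof -
    obtain cx' cy' where "plane_frame scale v w cx' cy'"
      using frame_of_basis[OF dim gv(2,4)] by blast
    then interpret F: plane_frame scale v w cx' cy' .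
    show ?thesis using gv by (intro F.linear_eqI G_linear id_in_G) simp_all
  qed
  have eigen1: "\<exists>v. v \<noteq> 0 \<and> g v = v" if "g \<in> G" "tr g = 1 + dt g" for g
    using eigenvector_exists[OF G_linear[OF that(1)], of 1] that(2) by simp
  \<comment> \<open>Otherwise commutators, having determinant 1, are trivial and \<open>G\<close> is
    abelian. A fixed vector \<open>v\<close> of some \<open>g \<noteq> id\<close> is then
    accompanied by a fixed vector \<open>k v\<close> off its line, so \<open>g = id\<close>.\<close>
  have ex_t: "\<exists>t\<in>G. dt t = 1 \<and> t \<noteq> id"
  proof (rule ccontr)
    assume c: "\<not> ?thesis"
    have comm: "g \<circ> h = h \<circ> g" if gh: "g \<in> G" "h \<in> G" for g h
    proof -
      obtain u where uG: "u \<in> G" and e: "u \<circ> (h \<circ> g) = g \<circ> h"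
        using commutator_in_G[OF gh] by blast
      have hg: "h \<circ> g \<in> G" using gh by (simp add: comp_in_G)
      have "dt u * (dt h * dt g) = dt g * dt h"
        using G_dt_comp[OF uG, of "h \<circ> g"] G_dt_comp[OF gh(2), of g] G_dt_comp[OF gh(1), of h]
        by (simp only: e)
      then have "dt u = 1" using G_dt_nz gh by simp
      then have "u = id" using c uG by blast
      then show ?thesis using e by simp
    qed
    obtain g where g: "g \<in> G" "g \<noteq> id"
    proof -
      obtain g where "g \<in> G" "g e1 \<notin> span {e1}" using line[OF e1_nz] by blast
      then show ?thesis using that span_base[of e1 "{e1}"] by fastforce
    qed
    then have "dt g \<noteq> 1" using c by blast
    then obtain v where v: "v \<noteq> 0" "g v = v" using eigen1 dich g(1) by blast
    obtain k where k: "k \<in> G" "k v \<notin> span {v}" using line[OF v(1)] by blast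
    have "g (k v) = k v" using comm[OF g(1) k(1)] v(2) by (metis comp_apply)
    then show False using fixed[OF g(1) v k(2)] g(2) by blast
  qed
  then obtain t where t: "t \<in> G" "dt t = 1" "t \<noteq> id" by blast
  have trt: "tr t = - 1" by (rule trS[OF t])
  \<comment> \<open>In characteristic 3 the trace -1 equals 2, which \<open>tr2\<close>
    excludes.\<close>
  have three: "(3 :: 'f) \<noteq> 0"
  proof
    assume "(3 :: 'f) = 0"
    then have "(2 :: 'f) + 1 = 0" by simp
    then have "tr t = 2" using trt by (simp only: eq_neg_iff_add_eq_0[symmetric])
    then show False using tr2 t by blast
  qed
  have tt: "t (t v) = - v - t v" for v
    using G_CH[OF t(1), of v] trt t(2) by simp
  have ttt: "t (t (t v)) = v" for v
  proof -
    have "t (t (t v)) = - t v - t (t v)" by (rule tt)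
    also have "\<dots> = v" unfolding tt by simp
    finally show ?thesis .
  qed
  \<comment> \<open>For a further \<open>b\<close>, both \<open>t \<circ> b\<close> and
    \<open>t \<circ> b'\<close> have trace -1, while the trace identity gives the sum 1; this would
    mean 3 = 0.\<close>
  have S: "b = id \<or> b = t \<or> b = t \<circ> t" if b: "b \<in> G" "dt b = 1" for b
  proof (rule ccontr)
    assume n: "\<not> ?thesis"
    define b' where "b' = inv_into UNIV b"
    have b': "b' \<in> G" "\<And>v. b (b' v) = v" "\<And>v. b' (b v) = v"
      using b(1) by (simp_all add: b'_def inv_in_G)
    have dtb': "dt b' = 1" using G_dt_inv[OF b(1)] b(2) by (simp add: b'_def)
    have sum: "tr (t \<circ> b) + tr (t \<circ> b') = 1"
      using trace_identity[OF G_linear[OF t(1)] G_linear[OF b(1)] G_linear[OF b'(1)] b'(2) b(2)]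
        trt trS[OF b] n by simp
    have tb: "t \<circ> b \<noteq> id"
    proof
      assume "t \<circ> b = id"
      then have "t (b v) = v" for v by (metis comp_apply id_apply)
      then have "b v = t (t v)" for v by (metis ttt)
      then show False using n by auto
    qed
    have tb': "t \<circ> b' \<noteq> id"
    proof
      assume "t \<circ> b' = id"
      then have "t (b' (b v)) = b v" for v by (metis comp_apply id_apply)
      then show False using n b'(3) by auto
    qed
    have "tr (t \<circ> b) = - 1" "tr (t \<circ> b') = - 1"
      using trS tb tb' t b b' dtb' comp_in_G G_dt_comp by auto
    then have "(- 1 :: 'f) + (- 1) = 1" using sum by simp
    moreover have "(3 :: 'f) = 1 - (- 1 + (- 1))" by simp
    ultimately have "(3 :: 'f) = 0" by (metis diff_self)
    then show False using three by simp
  qed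
  have notS: "g (t v) = t (t (g v))" if g: "g \<in> G" "dt g \<noteq> 1" for g v
  proof -
    define g' where "g' = inv_into UNIV g"
    have g': "g' \<in> G" "\<And>v. g (g' v) = v" "\<And>v. g' (g v) = v"
      using g(1) by (simp_all add: g'_def inv_in_G)
    \<comment> \<open>The conjugate of \<open>t\<close> has determinant 1, so it is
      \<open>id\<close>, \<open>t\<close> or \<open>t \<circ> t\<close>; the claim is the last
      case.\<close>
    define c where "c = g \<circ> t \<circ> g'"
    have cG: "c \<in> G" unfolding c_def by (intro comp_in_G g t g')
    have cg: "c (g v) = g (t v)" for v by (simp add: c_def g')
    have "dt c = 1"
      using G_dt_inv[OF g(1)] G_dt_comp[OF comp_in_G[OF g(1) t(1)], of g'] G_dt_comp[OF g(1), of t] t(2)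
      by (simp add: c_def g'_def)
    then consider "c = id" | "c = t" | "c = t \<circ> t" using S cG by blast
    then show ?thesis
    proof cases
      case 1
      then have "t (g' (g v)) = g' (g v)" for v using cg[of v] g' by (metis id_apply)
      then have "t = id" using g' by (simp add: fun_eq_iff)
      then show ?thesis using t(3) by simp
    next
      case 2
      \<comment> \<open>If \<open>g\<close> commutes with \<open>t\<close>, a nonzero vector
        \<open>u\<close> fixed by \<open>g\<close> is an eigenvector of \<open>t\<close>, say for
        \<open>l\<close>. Then \<open>l\<close> and \<open>l * l\<close> are eigenvalues of
        \<open>g \<circ> t\<close> and \<open>g \<circ> (t \<circ> t)\<close>, of the same
        determinant as \<open>g\<close>, so each is 1 or \<open>dt g\<close>. But 1,
        \<open>l\<close> and \<open>l * l\<close> are distinct.\<close>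
      then have comm: "t (g v) = g (t v)" for v using cg by simp
      have trg: "tr k = 1 + dt k" if "k \<in> G" "dt k \<noteq> 1" for k using dich that by blast
      obtain u where u: "u \<noteq> 0" "g u = u" using eigen1[OF g(1) trg[OF g]] by blast
      have "t u \<in> span {u}"
      proof (rule ccontr)
        assume "t u \<notin> span {u}"
        moreover have "g (t u) = t u" using comm[of u] u(2) by simp
        ultimately have "g = id" using fixed[OF g(1) u] by blast
        then show False using g(2) by simp
      qed
      then obtain l where l: "t u = l *s u" by (auto simp: span_singleton)
      have r: "l * l + l + 1 = 0" using eigenvalue_root[OF G_linear[OF t(1)] l u(1)] trt t(2) by simp
      have lr: "m = 1 \<or> m = dt g" if "k \<in> G" "dt k = dt g" "k u = m *s u" for k m
      proof -
        have "m * m - (1 + dt g) * m + dt g = 0"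
          using eigenvalue_root[OF G_linear[OF that(1)] that(3) u(1)] trg[OF that(1)] that(2) g(2) by simp
        then have "(m - 1) * (m - dt g) = 0" by (simp add: algebra_simps)
        then show ?thesis by simp
      qed
      have "l = 1 \<or> l = dt g"
        by (rule lr[of "g \<circ> t"]) (use g t u l in \<open>simp_all add: comp_in_G G_dt_comp G_scale\<close>)
      moreover have "l * l = 1 \<or> l * l = dt g"
        by (rule lr[of "g \<circ> (t \<circ> t)"]) (use g t u l in \<open>simp_all add: comp_in_G G_dt_comp G_scale\<close>)
      moreover have "l \<noteq> 1" using r three by auto
      moreover have "l * l \<noteq> 1"
      proof
        assume a: "l * l = 1"
        then have "l + 2 = 0" using r by (simp add: algebra_simps)
        then have "l = - 2" by (simp only: eq_neg_iff_add_eq_0)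
        then have "(3 :: 'f) = l * l - 1" by simp
        then have "(3 :: 'f) = 0" unfolding a by simp
        then show False using three by simp
      qed
      moreover have "l * l \<noteq> l" using r \<open>l \<noteq> 1\<close> by auto
      ultimately show ?thesis by metis
    next
      case 3
      then show ?thesis using cg[of v] by simp
    qed
  qed
  \<comment> \<open>The product commutes with \<open>t\<close>, as both factors invert it; with
    determinant other than 1 it would also invert \<open>t\<close>, forcing
    \<open>t = id\<close>.\<close>
  have notS2: "dt (g \<circ> s) = 1" if gs: "g \<in> G" "dt g \<noteq> 1" "s \<in> G" "dt s \<noteq> 1" for g s
  proof (rule ccontr)
    assume n: "dt (g \<circ> s) \<noteq> 1"
    have "(g \<circ> s) (t v) = t ((g \<circ> s) v)" for v
      using notS[OF gs(1,2)] notS[OF gs(3,4)] ttt by simp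
    moreover have "(g \<circ> s) (t v) = t (t ((g \<circ> s) v))" for v
      using notS[OF comp_in_G[OF gs(1,3)] n] .
    ultimately have "t (t (g (s v))) = t (g (s v))" for v by (metis comp_apply)
    then have "t (g (s v)) = g (s v)" for v by (metis ttt)
    then have "t (g (s (inv_into UNIV s (inv_into UNIV g v)))) =
      g (s (inv_into UNIV s (inv_into UNIV g v)))" for v by blast
    then have "t v = v" for v using gs by simp
    then show False using t(3) by auto
  qed
  \<comment> \<open>If some \<open>s\<close> has determinant other than 1, \<open>v\<close> is a
    fixed vector of \<open>s\<close>: then \<open>g\<close> and \<open>g \<circ> s\<close> agree on
    \<open>v\<close>, and one of them is a power of \<open>t\<close>.\<close>
  obtain v where v: "v \<noteq> 0" "\<And>g. g \<in> G \<Longrightarrow> g v = v \<or> g v = t v \<or> g v = t (t v)"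
  proof (cases "\<exists>s\<in>G. dt s \<noteq> 1")
    case False
    then show ?thesis using that[OF e1_nz] S by (metis comp_apply id_apply)
  next
    case True
    then obtain s where s: "s \<in> G" "dt s \<noteq> 1" by blast
    then obtain v where v: "v \<noteq> 0" "s v = v" using eigen1 dich by blast
    have "g v = v \<or> g v = t v \<or> g v = t (t v)" if g: "g \<in> G" for g
    proof (cases "dt g = 1")
      case True
      then show ?thesis using S[OF g] by auto
    next
      case False
      have "g v = (g \<circ> s) v" using v(2) by simp
      then show ?thesis
        using S[OF comp_in_G[OF g s(1)] notS2[OF g False s]] by (metis comp_apply id_apply)
    qed
    then show ?thesis using that v(1) by blast
  qed
  have tv: "t v \<notin> span {v}"
  proof
    assume a: "t v \<in> span {v}"
    have "v \<in> span {v}" by (simp add: span_base)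
    then have "t (t v) \<in> span {v}" unfolding tt using a by (intro span_diff span_neg)
    then show False using line[OF v(1)] v(2) a \<open>v \<in> span {v}\<close> by metis
  qed
  obtain cx' cy' where "plane_frame scale v (t v) cx' cy'"
    using frame_of_basis[OF dim v(1) tv] by blast
  then interpret F: plane_frame scale v "t v" cx' cy' .
  show ?thesis
  proof (rule F.contained_in_S3I)
    fix g assume g: "g \<in> G"
    have gtv: "g (t v) = v \<or> g (t v) = t v \<or> g (t v) = t (t v)"
    proof (cases "dt g = 1")
      case True
      then have "g (t v) = t (g v)" using S[OF g] by auto
      then show ?thesis using v(2)[OF g] ttt by auto
    next
      case False
      then have "g (t v) = t (t (g v))" by (rule notS[OF g])
      then show ?thesis using v(2)[OF g] ttt by auto
    qed
    have gttv: "g (t (t v)) = v \<or> g (t (t v)) = t v \<or> g (t (t v)) = t (t v)"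
    proof (cases "dt g = 1")
      case True
      then have "g (t (t v)) = t (t (g v))" using S[OF g] by auto
      then show ?thesis using v(2)[OF g] ttt by auto
    next
      case False
      then have "g (t (t v)) = t (g v)" using notS[OF g, of "t v"] notS[OF g, of v] ttt by simp
      then show ?thesis using v(2)[OF g] ttt by auto
    qed
    have "g ` {v, t v, - v - t v} \<subseteq> {v, t v, - v - t v}"
      using v(2)[OF g] gtv gttv unfolding tt[symmetric] by blast
    then show "endo scale g \<and> bij g \<and> g ` F.trigon \<subseteq> F.trigon"
      using G_linear[OF g] G_bij[OF g] by blast
  qed
qed

end

context plane_group
begin

lemma irreducible_imp_no_common_and_trivial_H1:
  assumes irr: "irreducible_V" and S3: "\<not> contained_in_S3 G scale"
  shows "\<not> common_factor \<and> trivial_group (H1 LG V)"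
proof (cases "\<exists>c. (\<lambda>v. c *s v) \<in> G \<and> c \<noteq> 1")
  case True
  then show ?thesis using scalar_not_common scalar_trivial_H1 by blast
next
  case False
  have p2: "p \<noteq> 2" using S3 contained_in_S3_if_2 by blast
  have "(- 1 :: 'f) \<noteq> 1"
  proof
    assume "(- 1 :: 'f) = 1"
    then have "of_nat 2 = (0 :: 'f)" by (metis neg_equal_iff_equal add.right_inverse one_add_one of_nat_numeral)
    then have "p dvd 2" by (simp only: of_nat_eq_0_iff_p)
    then show False using p p2 by (metis dvd_imp_le prime_ge_2_nat le_antisym zero_less_numeral)
  qed
  then have nounip: "u = id" if "u \<in> G" "unipotent u" for u
    using minus_one_in_G[OF irr that] False by blast
  then have "\<not> p dvd card G" using unipotent_exists by blast
  then have "trivial_group (H1 LG V)"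
    using averaging_trivial_H1[OF finite_G] by (simp add: of_nat_eq_0_iff_p)
  moreover have "\<not> common_factor"
  proof
    assume common: "common_factor"
    obtain e1 e2 cx cy where "plane_frame scale e1 e2 cx cy" using frame_ex by blast
    then interpret plane_frame scale e1 e2 cx cy .
    interpret framed_group scale G p e1 e2 cx cy ..
    show False
      using contained_in_S3I_char_poly[OF irr _ nounip common_char_poly[OF common irr]] False S3 by blast
  qed
  ultimately show ?thesis by blast
qed

end

section \<open>Exhibiting common composition factors\<close>

text \<open>The image of \<open>\<phi>\<close> is a submodule of an irreducible module, so one
  nonzero value makes \<open>\<phi>\<close> onto; \<open>N\<close> is its kernel.\<close>

lemma factor_of_gsubmodule:
  assumes M: "gmodule R G M" and F: "gmodule R G F" "irreducible_gmodule R G F"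
    and W: "gsubmodule W R G M" and phi: "\<phi> \<in> gmodule_hom R G (M\<lparr>carrier := W\<rparr>) F"
    and nz: "x \<in> W" "\<phi> x \<noteq> \<zero>\<^bsub>F\<^esub>"
  obtains N where "gsubquotient R G M W N" "\<phi> ` W = carrier F"
    "\<And>y. y \<in> W \<Longrightarrow> \<phi> y = \<zero>\<^bsub>F\<^esub> \<longleftrightarrow> y \<in> N"
proof -
  interpret M: gmodule R G M by fact
  interpret F: gmodule R G F by fact
  note D = M.gsubmoduleD[OF W]
  have ph: "\<And>x y. x \<in> W \<Longrightarrow> y \<in> W \<Longrightarrow> \<phi> (x \<oplus>\<^bsub>M\<^esub> y) = \<phi> x \<oplus>\<^bsub>F\<^esub> \<phi> y"
    "\<And>r x. r \<in> carrier R \<Longrightarrow> x \<in> W \<Longrightarrow> \<phi> (r \<odot>\<^bsub>M\<^esub> x) = r \<odot>\<^bsub>F\<^esub> \<phi> x"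
    "\<And>g x. g \<in> carrier G \<Longrightarrow> x \<in> W \<Longrightarrow> \<phi> (act M g x) = act F g (\<phi> x)"
    "\<And>x. x \<in> W \<Longrightarrow> \<phi> x \<in> carrier F"
    using phi by (auto simp: gmodule_hom_def hom_def)
  have "\<phi> \<zero>\<^bsub>M\<^esub> \<oplus>\<^bsub>F\<^esub> \<phi> \<zero>\<^bsub>M\<^esub> = \<phi> \<zero>\<^bsub>M\<^esub>" using ph(1)[OF D(2) D(2)] by simp
  then have zero: "\<phi> \<zero>\<^bsub>M\<^esub> = \<zero>\<^bsub>F\<^esub>" using F.M.add.r_cancel_one[OF ph(4)[OF D(2)] ph(4)[OF D(2)]] by simp
  have ker: "gsubmodule {y \<in> W. \<phi> y = \<zero>\<^bsub>F\<^esub>} R G M"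
    by (rule M.gsubmoduleI) (auto simp: D(2-) ph zero intro: subsetD[OF D(1)])
  have "gsubmodule (\<phi> ` W) R G F"
  proof (rule F.gsubmoduleI)
    show "\<zero>\<^bsub>F\<^esub> \<in> \<phi> ` W" using zero D(2) by (metis imageI)
    show "x \<oplus>\<^bsub>F\<^esub> y \<in> \<phi> ` W" if "x \<in> \<phi> ` W" "y \<in> \<phi> ` W" for x y
      using that by (auto simp: ph(1)[symmetric] D)
    show "r \<odot>\<^bsub>F\<^esub> x \<in> \<phi> ` W" if "r \<in> carrier R" "x \<in> \<phi> ` W" for r x
      using that by (auto simp: ph(2)[symmetric] D)
    show "act F g x \<in> \<phi> ` W" if "g \<in> carrier G" "x \<in> \<phi> ` W" for g x
      using that by (auto simp: ph(3)[symmetric] D)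
  qed (use ph in auto)
  moreover have "\<phi> ` W \<noteq> {\<zero>\<^bsub>F\<^esub>}" using nz by auto
  ultimately have "\<phi> ` W = carrier F" using F(2) unfolding irreducible_gmodule_def by blast
  moreover have "gsubquotient R G M W {y \<in> W. \<phi> y = \<zero>\<^bsub>F\<^esub>}"
    using M W ker by (intro gsubquotient.intro gsubquotient_axioms.intro) auto
  ultimately show ?thesis using that by auto
qed

lemma common_factor_of_homs:
  assumes M: "gmodule R G M" "finite (carrier M)" and M': "gmodule R G M'" "finite (carrier M')"
    and F: "gmodule R G F" "irreducible_gmodule R G F"
    and W: "gsubmodule W R G M" "\<phi> \<in> gmodule_hom R G (M\<lparr>carrier := W\<rparr>) F" "x \<in> W" "\<phi> x \<noteq> \<zero>\<^bsub>F\<^esub>"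
    and W': "gsubmodule W' R G M'" "\<psi> \<in> gmodule_hom R G (M'\<lparr>carrier := W'\<rparr>) F"
      "y \<in> W'" "\<psi> y \<noteq> \<zero>\<^bsub>F\<^esub>"
  shows "common_composition_factor R G M M'"
proof -
  obtain N where N: "gsubquotient R G M W N" "\<phi> ` W = carrier F"
      "\<And>y. y \<in> W \<Longrightarrow> \<phi> y = \<zero>\<^bsub>F\<^esub> \<longleftrightarrow> y \<in> N"
    by (rule factor_of_gsubmodule[OF M(1) F W]) blast
  obtain N' where N': "gsubquotient R G M' W' N'" "\<psi> ` W' = carrier F"
      "\<And>y. y \<in> W' \<Longrightarrow> \<psi> y = \<zero>\<^bsub>F\<^esub> \<longleftrightarrow> y \<in> N'"
    by (rule factor_of_gsubmodule[OF M'(1) F W']) blast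
  show ?thesis
    by (rule common_factorI[OF N(1) N'(1) M(2) M'(2) F W(2) N(2,3) W'(2) N'(2,3)])
qed

context linear_group_rep
begin

lemma irreducible_character:
  fixes \<chi> :: "('v \<Rightarrow> 'v) \<Rightarrow> 'f"
  assumes "\<chi> \<in> characters LG"
  shows "irreducible_gmodule base_ring LG (character_gmodule \<chi>)"
  unfolding irreducible_gmodule_def
proof (intro conjI allI impI)
  have "1 \<in> carrier (character_gmodule \<chi>)" "1 \<notin> {\<zero>\<^bsub>character_gmodule \<chi>\<^esub>}" by simp_all
  then show "carrier (character_gmodule \<chi>) \<noteq> {\<zero>\<^bsub>character_gmodule \<chi>\<^esub>}" by metis
  interpret F: gmodule base_ring LG "character_gmodule \<chi>" by (rule gmodule_character[OF assms])
  fix W assume W: "gsubmodule W base_ring LG (character_gmodule \<chi>)"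
  have "c \<in> W" if "d \<in> W" "d \<noteq> 0" for c d
  proof -
    have "(c / d) \<odot>\<^bsub>character_gmodule \<chi>\<^esub> d \<in> W" by (rule F.gsubmoduleD(6)[OF W]) (use that in simp_all)
    then show ?thesis using that(2) by simp
  qed
  then show "W = {\<zero>\<^bsub>character_gmodule \<chi>\<^esub>} \<or> W = carrier (character_gmodule \<chi>)"
    using F.gsubmoduleD(2)[OF W] by auto
qed

lemma gsubmodule_E_I:
  assumes "\<And>f. f \<in> W \<Longrightarrow> endo scale f" "(\<lambda>v. 0) \<in> W"
    and "\<And>f f'. f \<in> W \<Longrightarrow> f' \<in> W \<Longrightarrow> (\<lambda>v. f v + f' v) \<in> W"
    and "\<And>c f. f \<in> W \<Longrightarrow> (\<lambda>v. c *s f v) \<in> W"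
    and "\<And>g f. g \<in> G \<Longrightarrow> f \<in> W \<Longrightarrow> act E g f \<in> W"
  shows "gsubmodule W base_ring LG E"
proof -
  interpret E: gmodule base_ring LG E by (rule gmodule_E)
  show ?thesis by (rule E.gsubmoduleI) (use assms in auto)
qed

end

context triangular_group
begin

text \<open>Each case equates the character of a factor of V, the line of \<open>e1\<close> or the
  quotient by it, with that of a matrix entry of End V. The entry is equivariant on a step of the
  filtration: upper right on \<open>?E1\<close>, first diagonal on \<open>?E2\<close>, lower left on
  all of End V.\<close>

lemma common_of_coincidence:
  assumes "same_character LG \<chi>1 (\<lambda>_. 1) \<or> same_character LG \<chi>1 (\<lambda>g. \<chi>2 g ^ 2) \<or>
    same_character LG \<chi>2 (\<lambda>_. 1) \<or> same_character LG \<chi>2 (\<lambda>g. \<chi>1 g ^ 2)"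
  shows "common_factor"
proof -
  let ?L = "{v. cy v = 0}"
  let ?E1 = "{f \<in> carrier E. f e1 = 0 \<and> cy (f e2) = 0}"
  let ?E2 = "{f \<in> carrier E. cy (f e1) = 0 \<and> cy (f e2) = 0}"
  interpret V: gmodule base_ring LG V by (rule gmodule_V)
  interpret E: gmodule base_ring LG E by (rule gmodule_E)
  have L: "gsubmodule ?L base_ring LG V" by (auto simp: gsubmodule_V_iff cy_G)
  have V: "gsubmodule UNIV base_ring LG V" using V.gsubmodule_carrier by simp
  have cxL: "cx \<in> gmodule_hom base_ring LG (V\<lparr>carrier := ?L\<rparr>) (character_gmodule \<chi>1)"
    by (auto simp: gmodule_hom_def hom_def cx_G)
  have cyV: "cy \<in> gmodule_hom base_ring LG (V\<lparr>carrier := UNIV\<rparr>) (character_gmodule \<chi>2)"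
    by (auto simp: gmodule_hom_def hom_def cy_G)
  have cl: "endo scale (act E g f)"
    if "g \<in> G" "endo scale f" for g f
    using E.act_closed[of g f] that by simp
  have lin0: "endo scale (\<lambda>v. 0)" by (simp add: endo_iff vector_space_axioms)
  have lin_add: "endo scale (\<lambda>v. f v + f' v)"
    if "endo scale f" "endo scale f'" for f f'
    using that by (simp add: endo_iff scale_right_distrib add_ac)
  have lin_scale: "endo scale (\<lambda>v. c *s f v)"
    if "endo scale f" for f c
    using that by (simp add: endo_iff scale_right_distrib mult.commute)
  note del = End_gmodule_simps(5)
  have E1: "gsubmodule ?E1 base_ring LG E"
    by (rule gsubmodule_E_I)
      (auto simp: lin0 lin_add lin_scale cl act_End_coords eq_iff[of _ 0] simp del: del)
  have E2: "gsubmodule ?E2 base_ring LG E"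
    by (rule gsubmodule_E_I)
      (auto simp: lin0 lin_add lin_scale cl act_End_coords simp del: del)
  have EE: "gsubmodule (carrier E) base_ring LG E" by (rule E.gsubmodule_carrier)
  note I = common_factor_of_homs[OF gmodule_V finite_carrier_V gmodule_E finite_carrier_E
      gmodule_character irreducible_character]
  have h0: "(\<lambda>f. cx (f e2)) \<in> gmodule_hom base_ring LG (E\<lparr>carrier := ?E1\<rparr>) (character_gmodule \<chi>)"
    if "\<And>g. g \<in> G \<Longrightarrow> \<chi> g = \<chi>1 g / \<chi>2 g" for \<chi> :: "('v \<Rightarrow> 'v) \<Rightarrow> 'f"
    using that act_End_coords(4) by (auto simp: gmodule_hom_def hom_def simp del: del)
  have h1: "(\<lambda>f. cx (f e1)) \<in> gmodule_hom base_ring LG (E\<lparr>carrier := ?E2\<rparr>) (character_gmodule \<chi>)"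
    if "\<And>g. g \<in> G \<Longrightarrow> \<chi> g = 1" for \<chi> :: "('v \<Rightarrow> 'v) \<Rightarrow> 'f"
    using that act_End_coords(2) by (auto simp: gmodule_hom_def hom_def simp del: del)
  have h3: "(\<lambda>f. cy (f e1)) \<in> gmodule_hom base_ring LG (E\<lparr>carrier := carrier E\<rparr>) (character_gmodule \<chi>)"
    if "\<And>g. g \<in> G \<Longrightarrow> \<chi> g = \<chi>2 g / \<chi>1 g" for \<chi> :: "('v \<Rightarrow> 'v) \<Rightarrow> 'f"
    using that act_End_coords(1) by (auto simp: gmodule_hom_def hom_def simp del: del)
  from assms show ?thesis
  proof (elim disjE)
    assume "same_character LG \<chi>1 (\<lambda>_. 1)"
    then have *: "\<And>g. g \<in> G \<Longrightarrow> \<chi>1 g = 1" by (simp add: same_character_def)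
    have H: "(\<lambda>f. cx (f e1)) \<in> gmodule_hom base_ring LG (E\<lparr>carrier := ?E2\<rparr>) (character_gmodule \<chi>1)"
      by (rule h1) (rule *)
    show ?thesis
      by (rule I[OF chi_characters(1) chi_characters(1) L cxL _ _ E2 H, of e1 "lin e1 0"])
        (simp_all add: linear_lin)
  next
    assume "same_character LG \<chi>1 (\<lambda>g. \<chi>2 g ^ 2)"
    then have *: "\<And>g. g \<in> G \<Longrightarrow> \<chi>2 g = \<chi>1 g / \<chi>2 g"
      using chi2_nz by (simp add: same_character_def power2_eq_square)
    have H: "(\<lambda>f. cx (f e2)) \<in> gmodule_hom base_ring LG (E\<lparr>carrier := ?E1\<rparr>) (character_gmodule \<chi>2)"
      by (rule h0) (rule *)
    show ?thesis
      by (rule I[OF chi_characters(2) chi_characters(2) V cyV _ _ E1 H, of e2 "lin 0 e1"])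
        (simp_all add: linear_lin)
  next
    assume "same_character LG \<chi>2 (\<lambda>_. 1)"
    then have *: "\<And>g. g \<in> G \<Longrightarrow> \<chi>2 g = 1" by (simp add: same_character_def)
    have H: "(\<lambda>f. cx (f e1)) \<in> gmodule_hom base_ring LG (E\<lparr>carrier := ?E2\<rparr>) (character_gmodule \<chi>2)"
      by (rule h1) (rule *)
    show ?thesis
      by (rule I[OF chi_characters(2) chi_characters(2) V cyV _ _ E2 H, of e2 "lin e1 0"])
        (simp_all add: linear_lin)
  next
    assume "same_character LG \<chi>2 (\<lambda>g. \<chi>1 g ^ 2)"
    then have *: "\<And>g. g \<in> G \<Longrightarrow> \<chi>1 g = \<chi>2 g / \<chi>1 g"
      using chi1_nz by (simp add: same_character_def power2_eq_square)
    have H: "(\<lambda>f. cy (f e1)) \<in> gmodule_hom base_ring LG (E\<lparr>carrier := carrier E\<rparr>) (character_gmodule \<chi>1)"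
      by (rule h3) (rule *)
    show ?thesis
      by (rule I[OF chi_characters(1) chi_characters(1) L cxL _ _ EE H, of e1 "lin e2 0"])
        (simp_all add: linear_lin)
  qed
qed

end

section \<open>Extensions of characters in triangular form\<close>

context plane_group
begin

text \<open>\<open>e1\<close> is the image of 1 and \<open>e2\<close> a preimage of 1, so the given
  characters become the diagonal entries and \<open>\<pi>\<close> the second coordinate.\<close>

lemma extension_frame:
  fixes \<psi>1 \<psi>2 :: "('v \<Rightarrow> 'v) \<Rightarrow> 'f"
  assumes "is_extension base_ring LG (character_gmodule \<psi>1) V (character_gmodule \<psi>2)"
  obtains e1 e2 cx cy where "triangular_group scale G p e1 e2 cx cy"
    "\<And>g. g \<in> G \<Longrightarrow> cx (g e1) = \<psi>1 g" "\<And>g. g \<in> G \<Longrightarrow> cy (g e2) = \<psi>2 g"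
proof -
  obtain i \<pi> where i: "i \<in> gmodule_hom base_ring LG (character_gmodule \<psi>1) V"
    and pi: "\<pi> \<in> gmodule_hom base_ring LG V (character_gmodule \<psi>2)"
    and inj: "inj_on i (carrier (character_gmodule \<psi>1))"
    and ker: "i ` carrier (character_gmodule \<psi>1) = a_kernel V (character_gmodule \<psi>2) \<pi>"
    and onto: "\<pi> ` carrier V = carrier (character_gmodule \<psi>2)"
    using assms unfolding is_extension_def by blast
  have i_scale: "i (c * x) = c *s i x" for c x
    using i by (simp add: gmodule_hom_def)
  have "\<forall>g\<in>carrier LG. \<forall>x\<in>carrier (character_gmodule \<psi>1).
      i (act (character_gmodule \<psi>1) g x) = act V g (i x)"
    using i unfolding gmodule_hom_def by blast
  then have i_act: "i (\<psi>1 g * x) = g (i x)" if "g \<in> G" for g x using that by simp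
  have pi_add: "\<pi> (v + w) = \<pi> v + \<pi> w" and pi_scale: "\<pi> (c *s v) = c * \<pi> v"
    and pi_act: "g \<in> G \<Longrightarrow> \<pi> (g v) = \<psi>2 g * \<pi> v" for c v w g
    using pi by (simp_all add: gmodule_hom_def hom_def)
  have i0: "i 0 = 0" using i_scale[of 0 0] by simp
  define e1 where "e1 = i 1"
  have "e1 \<noteq> i 0" using inj using inj_onD[OF inj, of 1 0] unfolding e1_def by auto
  then have e1: "e1 \<noteq> 0" using i0 by simp
  have pi_e1: "\<pi> e1 = 0" using ker unfolding e1_def a_kernel_def kernel_def by auto
  obtain e2 where e2: "\<pi> e2 = 1" using onto by (metis UNIV_I character_gmodule_simps(1) imageE)
  have "e2 \<notin> span {e1}" using e2 pi_e1 pi_scale by (auto simp: span_singleton)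
  then obtain cx cy where "plane_frame scale e1 e2 cx cy" using frame_of_basis[OF dim e1] by blast
  then interpret plane_frame scale e1 e2 cx cy .
  have ge1: "g e1 = \<psi>1 g *s e1" if "g \<in> G" for g
    using i_act[OF that, of 1] i_scale[of "\<psi>1 g" 1] unfolding e1_def by simp
  have pi_cy: "\<pi> v = cy v" for v
  proof -
    have "\<pi> v = \<pi> (cx v *s e1 + cy v *s e2)" by (simp add: expand)
    then show ?thesis by (simp only: pi_add pi_scale pi_e1 e2) simp
  qed
  interpret triangular_group scale G p e1 e2 cx cy
    by unfold_locales (simp add: ge1)
  show ?thesis
  proof (rule that)
    show "triangular_group scale G p e1 e2 cx cy" by (rule triangular_group_axioms)
    show "\<And>g. g \<in> G \<Longrightarrow> cx (g e1) = \<psi>1 g" by (simp add: ge1)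
    show "\<And>g. g \<in> G \<Longrightarrow> cy (g e2) = \<psi>2 g" using pi_act[of _ e2] e2 pi_cy by simp
  qed
qed

lemma extension_coincidence_common:
  fixes \<psi>1 \<psi>2 :: "('v \<Rightarrow> 'v) \<Rightarrow> 'f"
  assumes ext: "is_extension base_ring LG (character_gmodule \<psi>1) V (character_gmodule \<psi>2)"
    and co: "same_character LG \<psi>1 (\<lambda>_. 1) \<or> same_character LG \<psi>1 (\<lambda>g. \<psi>2 g ^ 2) \<or>
    same_character LG \<psi>2 (\<lambda>_. 1) \<or> same_character LG \<psi>2 (\<lambda>g. \<psi>1 g ^ 2)"
  shows "common_factor"
proof -
  obtain e1 e2 cx cy where t: "triangular_group scale G p e1 e2 cx cy"
    and psi: "\<And>g. g \<in> G \<Longrightarrow> cx (g e1) = \<psi>1 g" "\<And>g. g \<in> G \<Longrightarrow> cy (g e2) = \<psi>2 g"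
    using extension_frame[OF ext] by blast
  interpret triangular_group scale G p e1 e2 cx cy by (rule t)
  show ?thesis
    by (rule common_of_coincidence) (use co psi in \<open>simp add: same_character_def \<chi>1_def \<chi>2_def\<close>)
qed

end

section \<open>Subgroups of the symmetric group\<close>

lemma perm3_values:
  assumes "\<sigma> permutes {1..3}"
  shows "(\<sigma> 1, \<sigma> 2, \<sigma> 3) \<in> {(1, 2, 3), (1, 3, 2), (2, 1, 3), (2, 3, 1), (3, 1, 2), (3, 2, 1 :: nat)}"
proof -
  have v: "\<sigma> i = 1 \<or> \<sigma> i = 2 \<or> \<sigma> i = 3" if "i \<in> {1..3}" for i
    using permutes_in_image[OF assms, of i] that by auto
  have ne: "\<sigma> 1 \<noteq> \<sigma> 2" "\<sigma> 1 \<noteq> \<sigma> 3" "\<sigma> 2 \<noteq> \<sigma> 3"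
    using permutes_inj[OF assms] by (simp_all add: inj_eq)
  have "(a, b, c) \<in> {(1, 2, 3), (1, 3, 2), (2, 1, 3), (2, 3, 1), (3, 1, 2), (3, 2, 1 :: nat)}"
    if "a = 1 \<or> a = 2 \<or> a = 3" "b = 1 \<or> b = 2 \<or> b = 3" "c = 1 \<or> c = 2 \<or> c = 3"
      "a \<noteq> b" "a \<noteq> c" "b \<noteq> c" for a b c :: nat
    using that by auto
  from this[OF v v v ne] show ?thesis by simp
qed

lemma perm3_eq_iff:
  assumes "\<sigma> permutes {1..3}" "\<tau> permutes {1..3}"
  shows "\<sigma> = \<tau> \<longleftrightarrow> \<sigma> 1 = \<tau> 1 \<and> \<sigma> 2 = \<tau> 2 \<and> \<sigma> 3 = \<tau> (3 :: nat)"
proof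
  assume e: "\<sigma> 1 = \<tau> 1 \<and> \<sigma> 2 = \<tau> 2 \<and> \<sigma> 3 = \<tau> 3"
  show "\<sigma> = \<tau>"
  proof
    fix i
    show "\<sigma> i = \<tau> i"
    proof (cases "i \<in> {1..3}")
      case True
      then have "i = 1 \<or> i = 2 \<or> i = 3" by auto
      then show ?thesis using e by blast
    next
      case False
      then show ?thesis using assms by (simp add: permutes_not_in)
    qed
  qed
qed simp


text \<open>Parity is encoded by the cube: even permutations satisfy
  \<open>\<sigma> \<circ> \<sigma> \<circ> \<sigma> = id\<close>, odd ones do not. In this form the
  facts survive transport along an abstract isomorphism. They are checked on tables of
  values.\<close>

lemma sym_group_3_facts:
  assumes s: "\<sigma> permutes {1..3 :: nat}" and t: "\<tau> permutes {1..3}"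
  shows "\<sigma> \<circ> \<sigma> \<circ> \<sigma> = id \<or> \<sigma> \<circ> \<sigma> = id"
    and "\<sigma> \<circ> \<sigma> \<circ> \<sigma> \<noteq> id \<Longrightarrow> \<tau> \<circ> \<tau> \<circ> \<tau> = id \<Longrightarrow> \<sigma> \<circ> \<tau> \<circ> \<sigma> = \<tau> \<circ> \<tau>"
    and "\<sigma> \<circ> \<sigma> \<circ> \<sigma> \<noteq> id \<Longrightarrow> \<tau> \<circ> \<tau> \<circ> \<tau> \<noteq> id \<Longrightarrow> (\<sigma> \<circ> \<tau>) \<circ> (\<sigma> \<circ> \<tau>) \<circ> (\<sigma> \<circ> \<tau>) = id"
    and "\<sigma> \<circ> \<sigma> \<circ> \<sigma> = id \<Longrightarrow> \<tau> \<circ> \<tau> \<circ> \<tau> = id \<Longrightarrow> \<sigma> \<noteq> id \<Longrightarrow> \<tau> = id \<or> \<tau> = \<sigma> \<or> \<tau> = \<sigma> \<circ> \<sigma>"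
proof -
  note comp = permutes_compose
  note st = comp[OF t s] and ss = comp[OF s s] and tt = comp[OF t t]
  note eqs = perm3_eq_iff[OF comp[OF s ss] permutes_id] perm3_eq_iff[OF comp[OF t tt] permutes_id]
    perm3_eq_iff[OF comp[OF s st] tt] perm3_eq_iff[OF comp[OF st comp[OF st st]] permutes_id]
    perm3_eq_iff[OF ss permutes_id] perm3_eq_iff[OF s permutes_id] perm3_eq_iff[OF t permutes_id]
    perm3_eq_iff[OF t s] perm3_eq_iff[OF t ss] comp_apply id_apply
  have s': "(\<sigma> 1 = 1 \<and> \<sigma> 2 = 2 \<and> \<sigma> 3 = 3) \<or> (\<sigma> 1 = 1 \<and> \<sigma> 2 = 3 \<and> \<sigma> 3 = 2) \<or> (\<sigma> 1 = 2 \<and> \<sigma> 2 = 1 \<and> \<sigma> 3 = 3) \<or>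
    (\<sigma> 1 = 2 \<and> \<sigma> 2 = 3 \<and> \<sigma> 3 = 1) \<or> (\<sigma> 1 = 3 \<and> \<sigma> 2 = 1 \<and> \<sigma> 3 = 2) \<or> (\<sigma> 1 = 3 \<and> \<sigma> 2 = 2 \<and> \<sigma> 3 = 1)"
    using perm3_values[OF s] by simp
  have t': "(\<tau> 1 = 1 \<and> \<tau> 2 = 2 \<and> \<tau> 3 = 3) \<or> (\<tau> 1 = 1 \<and> \<tau> 2 = 3 \<and> \<tau> 3 = 2) \<or> (\<tau> 1 = 2 \<and> \<tau> 2 = 1 \<and> \<tau> 3 = 3) \<or>
    (\<tau> 1 = 2 \<and> \<tau> 2 = 3 \<and> \<tau> 3 = 1) \<or> (\<tau> 1 = 3 \<and> \<tau> 2 = 1 \<and> \<tau> 3 = 2) \<or> (\<tau> 1 = 3 \<and> \<tau> 2 = 2 \<and> \<tau> 3 = 1)"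
    using perm3_values[OF t] by simp
  show "\<sigma> \<circ> \<sigma> \<circ> \<sigma> = id \<or> \<sigma> \<circ> \<sigma> = id"
    unfolding eqs using s' by (elim disjE conjE) simp_all
  show "\<sigma> \<circ> \<sigma> \<circ> \<sigma> \<noteq> id \<Longrightarrow> \<tau> \<circ> \<tau> \<circ> \<tau> = id \<Longrightarrow> \<sigma> \<circ> \<tau> \<circ> \<sigma> = \<tau> \<circ> \<tau>"
    unfolding eqs using s' t' by (elim disjE conjE) simp_all
  show "\<sigma> \<circ> \<sigma> \<circ> \<sigma> \<noteq> id \<Longrightarrow> \<tau> \<circ> \<tau> \<circ> \<tau> \<noteq> id \<Longrightarrow> (\<sigma> \<circ> \<tau>) \<circ> (\<sigma> \<circ> \<tau>) \<circ> (\<sigma> \<circ> \<tau>) = id"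
    unfolding eqs using s' t' by (elim disjE conjE) simp_all
  show "\<sigma> \<circ> \<sigma> \<circ> \<sigma> = id \<Longrightarrow> \<tau> \<circ> \<tau> \<circ> \<tau> = id \<Longrightarrow> \<sigma> \<noteq> id \<Longrightarrow> \<tau> = id \<or> \<tau> = \<sigma> \<or> \<tau> = \<sigma> \<circ> \<sigma>"
    unfolding eqs using s' t' by (elim disjE conjE) simp_all
qed

text \<open>The abstract copy \<open>H\<close> of the symmetric group, seen through identities of
  its elements; \<open>s\<close> plays a transposition and \<open>t\<close> a 3-cycle. They may lie
  outside \<open>G\<close>.\<close>

locale group_in_S3 = plane_group scale G p
  for scale :: "'f::field \<Rightarrow> 'v::ab_group_add \<Rightarrow> 'v" (infixr \<open>*s\<close> 75) and G p +
  fixes H :: "('v \<Rightarrow> 'v) set" and s t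
  assumes H: "subgroup H (GL scale)" and G_le_H: "G \<subseteq> H"
    and s: "s \<in> H" "s \<circ> s \<circ> s \<noteq> id" and t: "t \<in> H" "t \<circ> t \<circ> t = id" "t \<noteq> id"
    and cube_or_square: "\<And>g. g \<in> H \<Longrightarrow> g \<circ> g \<circ> g = id \<or> g \<circ> g = id"
    and conj: "\<And>g h. g \<in> H \<Longrightarrow> h \<in> H \<Longrightarrow> g \<circ> g \<circ> g \<noteq> id \<Longrightarrow> h \<circ> h \<circ> h = id \<Longrightarrow> g \<circ> h \<circ> g = h \<circ> h"
    and prod_odd: "\<And>g h. g \<in> H \<Longrightarrow> h \<in> H \<Longrightarrow> g \<circ> g \<circ> g \<noteq> id \<Longrightarrow> h \<circ> h \<circ> h \<noteq> id \<Longrightarrow>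
      (g \<circ> h) \<circ> (g \<circ> h) \<circ> (g \<circ> h) = id"
    and cubes: "\<And>g. g \<in> H \<Longrightarrow> g \<circ> g \<circ> g = id \<Longrightarrow> g = id \<or> g = t \<or> g = t \<circ> t"
begin

lemma H_linear: "g \<in> H \<Longrightarrow> endo scale g"
  and H_comp: "g \<in> H \<Longrightarrow> h \<in> H \<Longrightarrow> g \<circ> h \<in> H"
  using subgroup.subset[OF H] subgroup.m_closed[OF H] by auto

lemma odd_square: "g \<in> H \<Longrightarrow> g \<circ> g \<circ> g \<noteq> id \<Longrightarrow> g \<circ> g = id"
  using cube_or_square by blast

lemma ss: "s (s v) = v"
  using odd_square[OF s] by (metis comp_apply id_apply)

lemma ttt: "t (t (t v)) = v"
  using t(2) by (metis comp_apply id_apply)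

lemma sts: "s (t (s v)) = t (t v)"
  using conj[OF s(1) t(1) s(2) t(2)] by (metis comp_apply)

lemma st: "s (t v) = t (t (s v))"
  using sts[of "s v"] ss by simp

lemma H_cases:
  assumes "g \<in> H"
  obtains "g = id" | "g = t" | "g = t \<circ> t" | "g = s" | "g = s \<circ> t" | "g = s \<circ> (t \<circ> t)"
proof (cases "g \<circ> g \<circ> g = id")
  case True
  then show ?thesis using cubes[OF assms] that by blast
next
  case False
  have "g = s \<circ> (s \<circ> g)" using ss by (simp add: fun_eq_iff)
  moreover have "s \<circ> g = id \<or> s \<circ> g = t \<or> s \<circ> g = t \<circ> t"
    using cubes[OF H_comp[OF s(1) assms]] prod_odd[OF s(1) assms s(2) False] by blast
  ultimately show ?thesis using that by (metis comp_id)
qed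

text \<open>By \<open>conj\<close>, a central \<open>z\<close> with trivial cube satisfies
  \<open>z \<circ> z = z\<close>; a central \<open>z\<close> with nontrivial cube would both commute
  with \<open>t\<close> and invert it.\<close>

lemma trivial_center:
  assumes z: "z \<in> H" and comm: "\<And>h. h \<in> H \<Longrightarrow> z \<circ> h = h \<circ> z"
  shows "z = id"
proof (cases "z \<circ> z \<circ> z = id")
  case True
  have "z \<circ> z = s \<circ> z \<circ> s" using conj[OF s(1) z s(2) True] by simp
  also have "\<dots> = z \<circ> (s \<circ> s)" using comm[OF s(1)] by (metis comp_assoc)
  also have "s \<circ> s = id" by (rule odd_square[OF s])
  finally have "z (z v) = z v" for v by (metis comp_apply comp_id)
  then have "z (z (z v)) = z v" for v by metis
  then show ?thesis using True by (metis comp_apply ext id_apply)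
next
  case False
  have "t \<circ> t = z \<circ> t \<circ> z" using conj[OF z t(1) False t(2)] by simp
  also have "\<dots> = t \<circ> (z \<circ> z)" using comm[OF t(1)] by (metis comp_assoc)
  also have "z \<circ> z = id" by (rule odd_square[OF z False])
  finally have "t (t v) = t v" for v by (metis comp_apply comp_id)
  then have "t v = v" for v by (metis ttt)
  then show ?thesis using t(3) by auto
qed

text \<open>Multiplication by -1 commutes with all of \<open>H\<close>, whose centre is
  trivial.\<close>

lemma not_minus_one:
  assumes "g \<in> H" "\<And>v. g v = - v"
  shows "g = id"
proof (rule trivial_center[OF assms(1)])
  fix h assume "h \<in> H"
  then have "h (c *s v) = c *s h v" for c v using H_linear by (simp add: endo_iff)
  from this[of "- 1"] show "g \<circ> h = h \<circ> g" by (simp add: fun_eq_iff assms(2))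
qed

text \<open>If all cubes in \<open>G\<close> are trivial, then \<open>\<chi>1 * \<chi>2 = 1\<close>
  and \<open>\<chi>1 ^ 3 = 1\<close>, so \<open>\<chi>2 = \<chi>1 ^ 2\<close>. Otherwise an
  involution \<open>r\<close> in \<open>G\<close> decides: a character with value 1 at
  \<open>r\<close> is trivial, and if neither diagonal character had value 1 there, \<open>r\<close>
  would be -1, which \<open>H\<close> allows only as the identity.\<close>

lemma reducible_common:
  assumes "\<not> irreducible_V"
  shows "common_factor"
proof -
  obtain e1 e2 cx cy where fr: "plane_frame scale e1 e2 cx cy" "\<forall>g\<in>G. cy (g e1) = 0"
    using reducible_frame[OF assms] by blast
  interpret plane_frame scale e1 e2 cx cy by (rule fr(1))
  interpret triangular_group scale G p e1 e2 cx cy by unfold_locales (use fr(2) in blast)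
  have dt_chi: "dt g = \<chi>1 g * \<chi>2 g" if "g \<in> G" for g
    using stable[OF that] by (simp add: dt_def \<chi>1_def \<chi>2_def)
  have chi_id: "\<chi>1 id = 1" "\<chi>2 id = 1" by (simp_all add: \<chi>1_def \<chi>2_def)
  \<comment> \<open>\<open>s\<close> may lie outside \<open>G\<close> and move the line of
    \<open>e1\<close>, so the relation \<open>s \<circ> g \<circ> s = g \<circ> g\<close> is
    exploited through determinants instead of characters.\<close>
  have dt_cube: "dt g = 1" if g: "g \<in> G" "g \<circ> g \<circ> g = id" for g
  proof -
    have gH: "g \<in> H" using g G_le_H by blast
    note lin = H_linear[OF s(1)] H_linear[OF gH]
    have "dt (s \<circ> g \<circ> s) = dt (g \<circ> g)" using conj[OF s(1) gH s(2) g(2)] by simp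
    then have "dt s * dt g * dt s = dt g * dt g"
      using dt_comp[OF linear_comp[OF lin]] dt_comp[OF lin(1)] dt_comp[OF lin(2)] by simp
    moreover have "dt s * dt s = 1" using dt_comp[OF lin(1), of s] odd_square[OF s] by simp
    ultimately have "dt g = dt g * dt g" by (metis mult.assoc mult.commute mult_1)
    moreover have "dt g \<noteq> 0" using dt_chi chi1_nz chi2_nz g(1) by simp
    ultimately show ?thesis by simp
  qed
  show ?thesis
  proof (cases "\<exists>g\<in>G. g \<circ> g \<circ> g \<noteq> id")
    case False
    have "\<chi>2 g = \<chi>1 g ^ 2" if g: "g \<in> G" for g
    proof -
      have c: "g \<circ> g \<circ> g = id" using False g by blast
      have "\<chi>1 g * \<chi>2 g = 1" using dt_cube[OF g c] dt_chi[OF g] by simp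
      moreover have "\<chi>1 g * \<chi>1 g ^ 2 = 1"
        using arg_cong[OF c, of \<chi>1] g chi_id by (simp add: chi1_comp comp_in_G power2_eq_square mult.assoc)
      ultimately show ?thesis using chi1_nz[OF g] by (metis mult_left_cancel)
    qed
    then show ?thesis by (intro common_of_coincidence) (simp add: same_character_def)
  next
    case True
    then obtain r where r: "r \<in> G" "r \<circ> r \<circ> r \<noteq> id" by blast
    have rH: "r \<in> H" using r G_le_H by blast
    have rr: "r \<circ> r = id" by (rule odd_square[OF rH r(2)])
    \<comment> \<open>On elements of trivial cube, conjugation by \<open>r\<close> gives
      \<open>\<chi> h = \<chi> h * \<chi> h\<close>; the other elements acquire trivial cube after
      multiplication by \<open>r\<close>.\<close>
    have trivial: "\<chi> g = 1" if chi: "\<And>g h. g \<in> G \<Longrightarrow> h \<in> G \<Longrightarrow> \<chi> (g \<circ> h) = \<chi> g * \<chi> h"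
      and nz: "\<And>g. g \<in> G \<Longrightarrow> \<chi> g \<noteq> (0 :: 'f)" and r1: "\<chi> r = 1" and g: "g \<in> G" for \<chi> g
    proof -
      have cube: "\<chi> h = 1" if h: "h \<in> G" "h \<circ> h \<circ> h = id" for h
      proof -
        have "h \<in> H" using h G_le_H by blast
        then have "r \<circ> h \<circ> r = h \<circ> h" using conj rH r(2) h(2) by blast
        then have "\<chi> (r \<circ> h \<circ> r) = \<chi> (h \<circ> h)" by simp
        then have "\<chi> h = \<chi> h * \<chi> h" using h r(1) r1 by (simp add: chi comp_in_G)
        then show ?thesis using nz[OF h(1)] by simp
      qed
      show ?thesis
      proof (cases "g \<circ> g \<circ> g = id")
        case True
        then show ?thesis by (rule cube[OF g])
      next
        case False
        then have "\<chi> (r \<circ> g) = 1"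
          using prod_odd[OF rH _ r(2) False] g G_le_H by (intro cube comp_in_G r(1) g) blast
        then show ?thesis using chi[OF r(1) g] r1 by simp
      qed
    qed
    have "\<chi>1 r = 1 \<or> \<chi>2 r = 1"
    proof (rule ccontr)
      assume n: "\<not> ?thesis"
      have "\<chi>1 r * \<chi>1 r = 1" "\<chi>2 r * \<chi>2 r = 1"
        using arg_cong[OF rr, of \<chi>1] arg_cong[OF rr, of \<chi>2] r(1) chi_id by (simp_all add: chi1_comp chi2_comp)
      then have m: "\<chi>1 r = - 1" "\<chi>2 r = - 1" using n by (simp_all add: square_eq_1_iff)
      have "r (r e2) = e2" using rr by (metis comp_apply id_apply)
      then have "cx (r (r e2)) = 0" by simp
      then have "- \<beta> r - \<beta> r = 0"
        unfolding cx_G[OF r(1), of "r e2"] m by (simp add: \<beta>_def[symmetric] \<chi>2_def[symmetric] m)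
      then have "(2 :: 'f) * \<beta> r = 0" by simp
      moreover have "(2 :: 'f) \<noteq> 0"
      proof
        assume "(2 :: 'f) = 0"
        then have "(1 :: 'f) + 1 = 0" by simp
        then have "(1 :: 'f) = - 1" by (simp only: eq_neg_iff_add_eq_0)
        then show False using n m by simp
      qed
      ultimately have "\<beta> r = 0" by simp
      then have "r v = - v" for v using r(1) m by (simp add: eq_iff cx_G cy_G)
      then have "r = id" by (rule not_minus_one[OF rH])
      then show False using r(2) by simp
    qed
    then show ?thesis
    proof
      assume "\<chi>1 r = 1"
      then have "\<chi>1 g = 1" if "g \<in> G" for g using trivial[OF chi1_comp chi1_nz _ that] by blast
      then show ?thesis by (intro common_of_coincidence) (simp add: same_character_def)
    next
      assume "\<chi>2 r = 1"
      then have "\<chi>2 g = 1" if "g \<in> G" for g using trivial[OF chi2_comp chi2_nz _ that] by blast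
      then show ?thesis by (intro common_of_coincidence) (simp add: same_character_def)
    qed
  qed
qed

text \<open>If \<open>V\<close> is irreducible, it is spanned by vectors \<open>v\<close>, \<open>t v\<close>, \<open>t\<^sup>2 v\<close> of sum \<open>0\<close> which \<open>H\<close> permutes.
  With \<open>\<lambda>\<^sub>i\<close> the functionals that are \<open>2\<close> at the \<open>i\<close>-th and \<open>-1\<close> at the other two of these
  vectors \<open>v\<^sub>i\<close>, the map below is \<open>f \<mapsto> \<Sum>\<^sub>i \<lambda>\<^sub>i (f v\<^sub>i) v\<^sub>i\<close>.\<close>

lemma irreducible_common:
  assumes irr: "irreducible_V"
  shows "common_factor"
proof -
  note s_lin = H_linear[OF s(1), unfolded endo_iff]
  note t_lin = H_linear[OF t(1), unfolded endo_iff]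
  have s_simps: "s (x + y) = s x + s y" "s (c *s x) = c *s s x" for x y c using s_lin by simp_all
  have t_simps: "t (x + y) = t x + t y" "t (c *s x) = c *s t x" for x y c using t_lin by simp_all
  have "s \<noteq> id" using s(2) by auto
  then obtain w where w: "s w \<noteq> - w" using not_minus_one[OF s(1)] by blast
  \<comment> \<open>A nonzero fixed vector of \<open>s\<close>, obtained by symmetrizing without
    division by 2, so that \<open>p = 2\<close> is covered.\<close>
  define v where "v = w + s w"
  have v: "v \<noteq> 0" "s v = v" using w by (auto simp: v_def s_simps ss add.commute eq_neg_iff_add_eq_0)
  have stv: "s (t v) = t (t v)" "s (t (t v)) = t v" using v(2) st ttt by simp_all
  \<comment> \<open>The sum is fixed by \<open>s\<close> and \<open>t\<close>, hence by
    \<open>G\<close>; a nonzero value would span a stable line.\<close>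
  have sum0: "v + t v + t (t v) = 0"
  proof (rule ccontr)
    let ?x = "v + t v + t (t v)"
    assume "?x \<noteq> 0"
    have fixed: "t ?x = ?x" "s ?x = ?x" by (simp_all add: t_simps s_simps v ttt stv add_ac)
    have "g ?x = ?x" if "g \<in> G" for g
    proof -
      have "g \<in> H" using that G_le_H by blast
      then show ?thesis by (rule H_cases) (simp_all add: fixed)
    qed
    then have "g ?x \<in> span {?x}" if "g \<in> G" for g
      using that span_base[of ?x "{?x}"] by (metis singletonI)
    then show False by (rule irreducible_line[OF irr \<open>?x \<noteq> 0\<close>])
  qed
  then have ttv: "t (t v) = - v - t v" by (simp add: eq_diff_eq eq_neg_iff_add_eq_0 add_ac)
  have tv: "t v \<notin> span {v}"
  proof
    assume a: "t v \<in> span {v}"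
    have b: "v \<in> span {v}" by (simp add: span_base)
    have c: "t (t v) \<in> span {v}" unfolding ttv using a b by (intro span_diff span_neg)
    have "g v \<in> span {v}" if "g \<in> G" for g
    proof -
      have "g \<in> H" using that G_le_H by blast
      then show ?thesis by (rule H_cases) (simp_all add: a b c v stv)
    qed
    then show False using irreducible_line[OF irr v(1)] by blast
  qed
  obtain cx cy where "plane_frame scale v (t v) cx cy" using frame_of_basis[OF dim v(1) tv] by blast
  then interpret plane_frame scale v "t v" cx cy .
  \<comment> \<open>The sum over the three vectors in the frame \<open>v\<close>,
    \<open>t v\<close>: the third vector is \<open>- v - t v\<close>, so its term is spread over
    both coefficients.\<close>
  define \<phi> where "\<phi> f = (cx (f v) - cx (f (t v)) - 2 * cy (f v) - cy (f (t v))) *s v +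
    (cy (f (t v)) - cx (f v) - 2 * cx (f (t v)) - cy (f v)) *s t v" for f
  have phi_add: "\<phi> (\<lambda>v. f v + f' v) = \<phi> f + \<phi> f'" for f f' by (simp add: \<phi>_def eq_iff algebra_simps)
  have phi_scale: "\<phi> (\<lambda>v. c *s f v) = c *s \<phi> f" for c f by (simp add: \<phi>_def eq_iff algebra_simps)
  \<comment> \<open>\<open>\<phi>\<close> carries conjugation by \<open>k\<close> to
    \<open>k\<close>. The inverse \<open>k'\<close> is existential, so \<open>P\<close> can be
    checked on \<open>s\<close> and \<open>t\<close> with inverses \<open>s\<close> and
    \<open>t \<circ> t\<close> and passes to products, also through elements outside
    \<open>G\<close>.\<close>
  define P where "P k \<longleftrightarrow> (\<exists>k'. endo scale k' \<and> (\<forall>v. k (k' v) = v) \<and>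
    (\<forall>v. k' (k v) = v) \<and> (\<forall>f. endo scale f \<longrightarrow> \<phi> (k \<circ> f \<circ> k') = k (\<phi> f)))" for k
  have P_comp: "P (k \<circ> l)" if k: "P k" "endo scale k" and l: "P l" "endo scale l" for k l
  proof -
    obtain k' where k': "endo scale k'" "\<And>v. k (k' v) = v" "\<And>v. k' (k v) = v"
      "\<And>f. endo scale f \<Longrightarrow> \<phi> (k \<circ> f \<circ> k') = k (\<phi> f)"
      using k unfolding P_def by blast
    obtain l' where l': "endo scale l'" "\<And>v. l (l' v) = v" "\<And>v. l' (l v) = v"
      "\<And>f. endo scale f \<Longrightarrow> \<phi> (l \<circ> f \<circ> l') = l (\<phi> f)"
      using l unfolding P_def by blast
    have "\<phi> ((k \<circ> l) \<circ> f \<circ> (l' \<circ> k')) = (k \<circ> l) (\<phi> f)" if f: "endo scale f" for f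
    proof -
      have "(k \<circ> l) \<circ> f \<circ> (l' \<circ> k') = k \<circ> (l \<circ> f \<circ> l') \<circ> k'" by (simp add: comp_assoc)
      then show ?thesis using k'(4)[of "l \<circ> f \<circ> l'"] l'(4)[OF f] l l'(1) f
        by (simp add: linear_comp)
    qed
    then show ?thesis unfolding P_def using k' l'
      by (intro exI[of _ "l' \<circ> k'"]) (simp add: linear_comp)
  qed
  have coords: "cx (f x) = cx x * cx (f v) + cy x * cx (f (t v))"
    "cy (f x) = cx x * cy (f v) + cy x * cy (f (t v))" if "endo scale f" for f x
    by (rule coord_linear[OF that])+
  have P_t: "P t" unfolding P_def
  proof (intro exI[of _ "t \<circ> t"] conjI allI impI)
    fix f assume f: "endo scale f"
    have c: "cx (t x) = - cy x" "cy (t x) = cx x - cy x" for x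
      using coords[OF H_linear[OF t(1)], of x] by (simp_all add: ttv)
    show "\<phi> (t \<circ> f \<circ> (t \<circ> t)) = t (\<phi> f)"
      unfolding eq_iff c using ttt[of v, unfolded ttv]
      by (simp add: \<phi>_def c ttt ttv endo_simps(3,4)[OF f] algebra_simps)
  qed (simp_all add: ttt linear_comp H_linear t(1))
  have P_s: "P s" unfolding P_def
  proof (intro exI[of _ s] conjI allI impI)
    fix f assume f: "endo scale f"
    have c: "cx (s x) = cx x - cy x" "cy (s x) = - cy x" for x
      using coords[OF H_linear[OF s(1)], of x] by (simp_all add: ttv stv v)
    show "\<phi> (s \<circ> f \<circ> s) = s (\<phi> f)"
      unfolding eq_iff c by (simp add: \<phi>_def c v stv ttv endo_simps(3,4)[OF f] algebra_simps)
  qed (simp_all add: ss H_linear s(1))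
  have P_id: "P id" unfolding P_def by (intro exI[of _ id]) (simp add: G_linear id_in_G)
  note lt = H_linear[OF t(1)] and ls = H_linear[OF s(1)]
  have P_H: "P g" if "g \<in> H" for g
    using that by (rule H_cases) (simp_all add: P_id P_t P_s P_comp lt ls linear_comp)
  have phi_act: "\<phi> (act E g f) = g (\<phi> f)" if g: "g \<in> G" and f: "endo scale f" for g f
  proof -
    obtain k' where k': "\<And>v. g (k' v) = v" "\<phi> (g \<circ> f \<circ> k') = g (\<phi> f)"
      using P_H[of g] g f G_le_H unfolding P_def by blast
    have "inv_into UNIV g x = k' x" for x using k'(1)[of x] G_inv(2)[OF g, of "k' x"] by simp
    then have "inv_into UNIV g = k'" by blast
    then show ?thesis using k'(2) unfolding act_End[OF g] by simp
  qed
  interpret V: gmodule base_ring LG V by (rule gmodule_V)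
  interpret E: gmodule base_ring LG E by (rule gmodule_E)
  have "(\<lambda>x. x) \<in> gmodule_hom base_ring LG (V\<lparr>carrier := carrier V\<rparr>) V"
    by (auto simp: gmodule_hom_def hom_def)
  moreover have "\<phi> \<in> gmodule_hom base_ring LG (E\<lparr>carrier := carrier E\<rparr>) V"
    by (auto simp: gmodule_hom_def hom_def phi_add phi_scale phi_act simp del: End_gmodule_simps(5))
  \<comment> \<open>The projection to \<open>v\<close> along \<open>t v\<close> goes to
    \<open>v - t v\<close>, nonzero in every characteristic.\<close>
  moreover have "\<phi> (lin v 0) \<noteq> 0" by (simp add: \<phi>_def eq_iff)
  ultimately show ?thesis
    using common_factor_of_homs[OF gmodule_V finite_carrier_V gmodule_E finite_carrier_E
        gmodule_V irr V.gsubmodule_carrier _ _ _ E.gsubmodule_carrier, of "\<lambda>x. x" v \<phi> "lin v 0"]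
      v(1) linear_lin by simp
qed

end

context plane_group
begin

text \<open>The identities of \<open>group_in_S3\<close> are pulled back along an isomorphism
  \<open>\<theta>\<close>; \<open>s\<close> and \<open>t\<close> are preimages of a transposition
  and a 3-cycle.\<close>

lemma contained_in_S3_common:
  assumes "contained_in_S3 G scale"
  shows "common_factor"
proof -
  obtain H where H: "subgroup H (GL scale)" "G \<subseteq> H" "linear_group scale H \<cong> sym_group 3"
    using assms unfolding contained_in_S3_def by blast
  obtain \<theta> where theta: "\<theta> \<in> iso (linear_group scale H) (sym_group 3)"
    using H(3) unfolding is_iso_def by blast
  have perm: "\<theta> g permutes {1..3}" if "g \<in> H" for g
    using theta that by (auto simp: iso_def hom_def sym_group_carrier)
  have comp: "\<theta> (g \<circ> h) = \<theta> g \<circ> \<theta> h" if "g \<in> H" "h \<in> H" for g h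
    using theta that by (auto simp: iso_def hom_def sym_group_mult)
  have bij: "bij_betw \<theta> H {\<sigma>. \<sigma> permutes {1..3}}"
    using theta by (simp add: iso_def sym_group_def)
  have cl: "g \<circ> h \<in> H" if "g \<in> H" "h \<in> H" for g h
    using subgroup.m_closed[OF H(1)] that by simp
  have idH: "id \<in> H" using subgroup.one_closed[OF H(1)] by simp
  have theta_id: "\<theta> id = id"
  proof -
    have "\<theta> id \<circ> \<theta> id = \<theta> id" using comp[OF idH idH] by simp
    then have "\<theta> id (\<theta> id i) = \<theta> id i" for i by (metis comp_apply)
    then have "\<theta> id i = i" for i using permutes_inj[OF perm[OF idH]] by (simp add: inj_eq)
    then show ?thesis by auto
  qed
  have eq: "g = h \<longleftrightarrow> \<theta> g = \<theta> h" if "g \<in> H" "h \<in> H" for g h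
    using inj_onD[OF bij_betw_imp_inj_on[OF bij]] that by blast
  have cube: "g \<circ> g \<circ> g = id \<longleftrightarrow> \<theta> g \<circ> \<theta> g \<circ> \<theta> g = id" if "g \<in> H" for g
    using eq[of "g \<circ> g \<circ> g" id] that by (simp add: cl comp idH theta_id)
  let ?c = "Transposition.transpose 1 2 \<circ> Transposition.transpose 2 (3 :: nat)"
  let ?s = "Transposition.transpose 1 (2 :: nat)"
  have sp: "?s permutes {1..3}" by (rule permutes_swap_id) simp_all
  have cp: "?c permutes {1..3}" by (intro permutes_compose permutes_swap_id) simp_all
  obtain s where s: "s \<in> H" "\<theta> s = ?s" using bij sp unfolding bij_betw_def by (metis imageE mem_Collect_eq)
  obtain t where t: "t \<in> H" "\<theta> t = ?c" using bij cp unfolding bij_betw_def by (metis imageE mem_Collect_eq)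
  have "?s \<circ> ?s \<circ> ?s \<noteq> id"
  proof
    assume "?s \<circ> ?s \<circ> ?s = id"
    from fun_cong[OF this, of 1] show False by (simp add: Transposition.transpose_def)
  qed
  then have s3: "s \<circ> s \<circ> s \<noteq> id" using cube[OF s(1)] s(2) by simp
  have c3: "?c \<circ> ?c \<circ> ?c = id"
    unfolding perm3_eq_iff[OF permutes_compose[OF cp permutes_compose[OF cp cp]] permutes_id]
    by (simp add: Transposition.transpose_def)
  then have t3: "t \<circ> t \<circ> t = id" using cube[OF t(1)] t(2) by simp
  have "?c \<noteq> id"
  proof
    assume "?c = id"
    from fun_cong[OF this, of 1] show False by (simp add: Transposition.transpose_def)
  qed
  then have tne: "t \<noteq> id" using t(2) theta_id by auto
  interpret group_in_S3 scale G p H s t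
  proof (intro group_in_S3.intro group_in_S3_axioms.intro plane_group_axioms)
    fix g assume g: "g \<in> H"
    have "g \<circ> g = id \<longleftrightarrow> \<theta> g \<circ> \<theta> g = id" using eq[of "g \<circ> g" id] g by (simp add: cl comp idH theta_id)
    then show "g \<circ> g \<circ> g = id \<or> g \<circ> g = id"
      using sym_group_3_facts(1)[OF perm perm, OF g g] cube[OF g] by simp
    show "g = id \<or> g = t \<or> g = t \<circ> t" if "g \<circ> g \<circ> g = id"
      using sym_group_3_facts(4)[OF perm perm, OF t(1) g] cube[OF g] cube[OF t(1)] that t3 tne
        eq[OF g idH] eq[OF g t(1)] eq[OF g cl[OF t(1) t(1)]] eq[OF t(1) idH]
      by (simp add: comp t(1) theta_id)
    fix h assume h: "h \<in> H"
    show "g \<circ> h \<circ> g = h \<circ> h" if "g \<circ> g \<circ> g \<noteq> id" "h \<circ> h \<circ> h = id"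
      using sym_group_3_facts(2)[OF perm perm, OF g h] cube[OF g] cube[OF h] that
        eq[OF cl[OF cl[OF g h] g] cl[OF h h]] by (simp add: comp cl g h)
    show "(g \<circ> h) \<circ> (g \<circ> h) \<circ> (g \<circ> h) = id" if "g \<circ> g \<circ> g \<noteq> id" "h \<circ> h \<circ> h \<noteq> id"
      using sym_group_3_facts(3)[OF perm perm, OF g h] cube[OF g] cube[OF h] that
        cube[OF cl[OF g h]] by (simp add: comp g h)
  qed (fact H(1,2) s(1) s3 t(1) t3 tne)+
  show ?thesis using reducible_common irreducible_common by blast
qed

end

theorem theorem3p1:
  fixes scale :: "'f::field \<Rightarrow> 'v::ab_group_add \<Rightarrow> 'v"
    and p :: nat
    and G :: "('v \<Rightarrow> 'v) set"
  assumes "Factorial_Ring.prime p" and "CARD('f) = p"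
    and "vector_space scale" and "vector_space.dim scale (UNIV :: 'v set) = 2"
    and "subgroup G (GL scale)"
  shows
    "((\<not> common_composition_factor base_ring (linear_group scale G)
            (standard_gmodule scale) (End_gmodule scale) \<and>
       trivial_group (H1 (linear_group scale G) (standard_gmodule scale)))
      \<longleftrightarrow>
      (\<not> contained_in_S3 G scale \<and>
       (\<not> irreducible_gmodule base_ring (linear_group scale G) (standard_gmodule scale) \<longrightarrow>
         (\<forall>\<chi>\<^sub>1 \<in> characters (linear_group scale G).
          \<forall>\<chi>\<^sub>2 \<in> characters (linear_group scale G).
            is_extension base_ring (linear_group scale G)
              (character_gmodule \<chi>\<^sub>1) (standard_gmodule scale) (character_gmodule \<chi>\<^sub>2) \<longrightarrow>
            \<not> same_character (linear_group scale G) \<chi>\<^sub>1 (\<lambda>_. 1) \<and>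
            \<not> same_character (linear_group scale G) \<chi>\<^sub>1 (\<lambda>g. \<chi>\<^sub>2 g ^ 2) \<and>
            \<not> same_character (linear_group scale G) \<chi>\<^sub>2 (\<lambda>_. 1) \<and>
            \<not> same_character (linear_group scale G) \<chi>\<^sub>2 (\<lambda>g. \<chi>\<^sub>1 g ^ 2)))))
     \<and> (\<not> contained_in_S3 G scale \<longrightarrow> p > 2)"
proof -
  interpret vector_space scale by fact
  interpret plane_group scale G p
    by (intro plane_group.intro linear_group_rep.intro linear_group_rep_axioms.intro
        plane_group_axioms.intro) (fact assms)+
  let ?C = "common_composition_factor base_ring LG V E"
  let ?S = "contained_in_S3 G scale"
  let ?I = "irreducible_gmodule base_ring LG V"
  let ?X = "\<lambda>\<chi>\<^sub>1 \<chi>\<^sub>2 :: ('v \<Rightarrow> 'v) \<Rightarrow> 'f. \<not> same_character LG \<chi>\<^sub>1 (\<lambda>_. 1) \<and>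
            \<not> same_character LG \<chi>\<^sub>1 (\<lambda>g. \<chi>\<^sub>2 g ^ 2) \<and>
            \<not> same_character LG \<chi>\<^sub>2 (\<lambda>_. 1) \<and>
            \<not> same_character LG \<chi>\<^sub>2 (\<lambda>g. \<chi>\<^sub>1 g ^ 2)"
  let ?D = "\<forall>\<chi>\<^sub>1 \<in> characters LG. \<forall>\<chi>\<^sub>2 \<in> characters LG.
      is_extension base_ring LG (character_gmodule \<chi>\<^sub>1) V (character_gmodule \<chi>\<^sub>2) \<longrightarrow> ?X \<chi>\<^sub>1 \<chi>\<^sub>2"
  have "?D" if "\<not> ?C" using extension_coincidence_common that by blast
  moreover have "\<not> ?S" if "\<not> ?C" using contained_in_S3_common that by blast
  moreover have "\<not> ?C \<and> trivial_group (H1 LG V)" if red: "\<not> ?I" "?D"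
  proof -
    obtain e1 e2 cx cy where fr: "plane_frame scale e1 e2 cx cy" "\<forall>g\<in>G. cy (g e1) = 0"
      using reducible_frame[OF red(1)] by blast
    interpret plane_frame scale e1 e2 cx cy by (rule fr(1))
    interpret triangular_group scale G p e1 e2 cx cy by unfold_locales (use fr(2) in blast)
    \<comment> \<open>The condition on extensions is applied to the one that the triangular frame
      provides.\<close>
    have "?X \<chi>1 \<chi>2" using red(2) chi_characters extension by blast
    then show ?thesis using not_common_of_distinct trivial_H1_of_distinct by blast
  qed
  moreover have "\<not> ?C \<and> trivial_group (H1 LG V)" if "?I" "\<not> ?S"
    using irreducible_imp_no_common_and_trivial_H1 that by blast
  moreover have "p > 2" if "\<not> ?S"
    using contained_in_S3_if_2 that prime_ge_2_nat[OF p] by (metis le_neq_implies_less)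
  ultimately show ?thesis by blast
qed

end
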